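(* Let $I=[0,1]$, $K=[0,1]$, $\Sigma=I\times K$, and let $\mathcal P=\{I_i=(a_i,b_i)\}_{i\ge1}$ be a family of disjoint open subintervals of $I$ with $m(I\setminus\bigcup_iI_i)=0$. Let $F_0=(f_0,G_0):\Sigma\to\Sigma$, $F_0(x,y)=(f_0(x),G_0(x,y))$, satisfy: (G$_0$) $G_0$ satisfies (H1) and (H2), and for every $i$ the restriction of $G_0$ to $I_i\times[0,1]$ admits a $C^2$ extension to the boundary of the strip. (f$_0$) $f_0$ is as in one of the two cases: (1) $f_0$ is a pre-piecewise convex or expanding map on $\mathcal P$, is strictly convex on each branch ($f_{0,i}''>0$, $f_{0,i}=f_0|_{I_i}$), and $\sum_{i}\frac1{|f_{0,i}'(a_i)|}<\infty$; (2) $f_0$ is a piecewise expanding map on $\mathcal P$, and $\sum_i\frac1{|f_0'(a_i)|}<\infty$. In both cases, moreover: (a) there is $D>0$ such that $\frac{|f_0''(x)|}{|f_0'(x)|^2}\le D$ for all $i\ge1$ and $x\in I_i$; (b) $|f_0'(x)|\ge1$ for all $x\in\bigcup_iI_i$ and there is $\lambda>1$ with $|(f_0^2)'(x)|\ge\lambda$ for all $x$ where it is defined; $f_0(I_i)=(0,1)$ for all $i$; and $f_0$ has continuous first and second derivatives in each $I_i$ (which may blow up at the endpoints). Let $\{F_\delta\}_{\delta\in[0,1)}$, $F_\delta=(f_\delta,G_\delta)$, be a one-parameter family (with $F_0$ at $\delta=0$) such that for all $\delta\in[0,1)$ and all $i$: $\|G_{\delta}|_{I_i\times[0,1]}-G_{0}|_{I_i\times[0,1]}\|_{C^2}\le\delta$;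 $f_\delta:\bigcup_iI_i\to[0,1]$ with $f_\delta|_{I_i}$ of class $C^2$ and $\|f_\delta|_{I_i}-f_0|_{I_i}\|_{C^2}\le\delta$; and $f_\delta|_{I_i}:I_i\to(0,1)$ is a diffeomorphism. Then there exists $\delta_1\in(0,1)$ such that the subfamily $\{F_\delta\}_{\delta\in[0,\delta_1)}$ is an admissible $R(\delta)$-perturbation of $F_0$ (for some function $R$).
   Context: **Notation.** $m$ is Lebesgue measure on $I$; $d_1$, $d_2$ are the Euclidean metrics on $I$ and $K=[0,1]$. $C^2$-norms are sup norms of the function and its derivatives up to order $2$ on the indicated open set. $f'(a_i)$ denotes the one-sided limit at $a_i$ of $f_i'$, $f_i=f|_{I_i}$. **Variation.** For $h:I\to\mathbb R$, $J\subset I$: $V_J(h)=\sup\sum_{i=1}^k|h(x_i)-h(x_{i-1})|$ over finite increasing sequences in $J$. For $h\in L^1_m$, $V(h)$ is the infimum of $V_I(h^* )$ over representatives $h^*$ of $h$; $BV_m=\{h\in L^1_m:V(h)<\infty\}$, $|h|_1=\int|h|\,dm$, $|h|_v=|h|_1+V(h)$. For non-singular $f$ ($f_*m\ll m$), $\mathrm P_f:L^1_m\to L^1_m$ is the Frobenius–Perron operator: $\int h_1\mathrm P_f(h_2)\,dm=\int (h_1\circ f)h_2\,dm$. **Piecewise convex map** (on $\mathcal P$): (1) each $f_i$ is increasing, convex, differentiable, $\lim_{x\to a_i^+}f_i(x)=0$ (and $f_i'(a_i)$ is defined by right-continuity); (2) $\sum_i 1/f_i'(a_i)<\infty$; (3)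 if $0$ is not a limit point of $\{a_i\}$ then $f'(0)=1/\beta>1$ for some $0<\beta<1$. **Piecewise expanding map** (on $\mathcal P$): each $f|_{I_i}$ extends to a homeomorphism $f_i:[a_i,b_i]\to f_i([a_i,b_i])$, and $g(x)=1/|f_i'(x)|$ for $x\in I_i$, $g=0$ elsewhere, satisfies $\sup g\le\beta<1$. **Pre-piecewise convex or expanding map** (on $\mathcal P$): (1) for some $n_0\in\mathbb N$ there is a countable family $\{J_j=(c_j,d_j)\}_{j\ge1}$ of disjoint open subintervals of $I$ with $m(I\setminus\bigcup_jJ_j)=0$ (the countable partition corresponding to $f^{n_0}$) on which the iterate $\tau=f^{n_0}$, with branches $\tau_j=\tau|_{J_j}$, is either a piecewise convex map, i.e. each $\tau_j$ is increasing, convex, differentiable with $\lim_{x\to c_j^+}\tau_j(x)=0$, $\sum_j1/\tau_j'(c_j)<\infty$ (with $\tau_j'(c_j)$ defined by right-continuity), and if $0$ is not a limit point of $\{c_j\}$ then $\tau'(0)=1/\beta>1$ for some $0<\beta<1$; or a piecewise expanding map, i.e. each $\tau_j$ extends to a homeomorphism of $[c_j,d_j]$ onto its image, and the function equal to $1/|\tau_j'(x)|$ for $x\in J_j$ and to $0$ elsewhere has supremum $\le\beta<1$; (2) $f$ is non-singular; (3) $\mathrm P_f:BV_m\to BV_m$ is bounded; (4) there is $h_1\in BV_m$ with $\mathrm P_f h_1=h_1$ and $m_1=h_1m$ a mixing probability measure. **Fiber conditions.** (H1) There is $0\le\alpha<1$ such that for $m$-a.e. $x$: $d_2(G(x,z_1),G(x,z_2))\le\alpha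 d_2(z_1,z_2)$ for all $z_1,z_2\in K$. (H2) $|G|_{\mathrm{Lip}}:=\sup_s|G_s|_{\mathrm{Lip}}<\infty$, where $|G_s|_{\mathrm{Lip}}=\sup_{y\in K}\sup_{x_1\ne x_2\in I_s}d_2(G(x_1,y),G(x_2,y))/d_1(x_1,x_2)$. (H3) For some $k\in\mathbb N$, writing $F^k=(f^k,G_k)$: $\alpha^k\cdot\operatorname{ess\,sup}_m\frac1{|(f^k)'|}<1$, and $G_k$ satisfies (H1) with rate $\alpha^k$ and (H2) (with respect to the partition of $f^k$). **$R(\delta)$-perturbation.** A family $\{F_\delta\}_{\delta\in[0,\delta_1)}$ is an $R(\delta)$-perturbation of $F_0$ if there is $\delta_0\in(0,\delta_1]$, $\delta_0<1$, such that: (U1) for all $\delta\in[0,\delta_0)$, $f_\delta$ is pre-piecewise convex or expanding for the same partition $\mathcal P$; moreover $f_\delta(I_i)=f_0(I_i)$ for all $i,\delta$; (U2) writing $\gamma_{\delta,i}$ for the $i$-th pre-image of $\gamma$ under $f_\delta$ (the pre-image in $I_i$; for $\gamma\in\{0,1\}$ via the continuous extension to $[a_i,b_i]$), there is $\delta\mapsto R(\delta)\in\mathbb R^+$ with $\lim_{\delta\to0^+}R(\delta)\log\delta=0$ and, for all $\delta\in[0,\delta_0)$: (U2.1) $\sum_i\left|\frac1{f_\delta'(\gamma_{\delta,i})}-\frac1{f_0'(\gamma_{0,i})}\right|\le R(\delta)$ for every $\gamma$; (U2.2) $\operatorname{ess\,sup}_\gamma\max_i d_1(\gamma_{0,i},\gamma_{\delta,i})\le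 R(\delta)$; (U2.3) $d_2(G_0(x,y),G_\delta(x,y))\le R(\delta)$ for all $(x,y)$. **Admissible.** It is admissible if: (A1) there are $D>0$, $0<\lambda<1$ with $|\mathrm P_{f_\delta}^nh|_v\le D\lambda^n|h|_v+D|h|_1$ for all $h\in BV_m$, $\delta\in[0,\delta_0)$, $n\ge1$; (A2) for all $\delta\in[0,\delta_0)$, $G_\delta$ satisfies (H1) with rate $\alpha_\delta$, (H2), and (H3) with some common $k$, and with $\alpha_{4,\delta}:=\alpha_\delta^k\operatorname{ess\,sup}\frac1{|(f_\delta^k)'|}$ and $U_{4,\delta}:=|G_\delta|_{\mathrm{Lip}}\operatorname{ess\,sup}\frac1{|(f_\delta^k)'|}+V_I\!\left(\frac1{|(f_\delta^k)'|}\right)$ (the function $1/|(f_\delta^k)'|$ being set to $0$ outside the partition intervals) one has $\sup_\delta\alpha_{4,\delta}<1$ and $\sup_\delta U_{4,\delta}<\infty$. *)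

theory Defs
  imports "HOL-Probability.Probability"
begin

abbreviation leb01 :: "real measure" where
  "leb01 \<equiv> lebesgue_on {0..1}"

section \<open>Functions of class \<open>C\<^sup>2\<close>\<close>

text \<open>
  Derivatives are taken within \<open>S\<close>, so that they are one-sided at boundary points belonging
  to \<open>S\<close>. The sets used below are intervals and products of two intervals (all of nonempty
  interior), on which the derivative within \<open>S\<close> is unique. The \<open>C\<^sup>2\<close> norm is the largest of
  the sup norms of the function and of its partial derivatives of order at most 2.
\<close>

definition partial_deriv :: "'a::euclidean_space set \<Rightarrow> 'a \<Rightarrow> ('a \<Rightarrow> real) \<Rightarrow> 'a \<Rightarrow> real" where
  "partial_deriv S e h p = frechet_derivative h (at p within S) e"

definition C2_on :: "'a::euclidean_space set \<Rightarrow> ('a \<Rightarrow> real) \<Rightarrow> bool" where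
  "C2_on S h \<longleftrightarrow>
     h differentiable_on S \<and>
     (\<forall>e\<in>Basis. partial_deriv S e h differentiable_on S \<and>
        (\<forall>e'\<in>Basis. continuous_on S (partial_deriv S e' (partial_deriv S e h))))"

definition C2_norm :: "'a::euclidean_space set \<Rightarrow> ('a \<Rightarrow> real) \<Rightarrow> ereal" where
  "C2_norm S h =
     Sup ((\<lambda>p. ereal \<bar>h p\<bar>) ` S
        \<union> {ereal \<bar>partial_deriv S e h p\<bar> | e p. e \<in> Basis \<and> p \<in> S}
        \<union> {ereal \<bar>partial_deriv S e' (partial_deriv S e h) p\<bar> | e e' p.
              e \<in> Basis \<and> e' \<in> Basis \<and> p \<in> S})"

text \<open>Diffeomorphisms between open subsets of the line.\<close>

definition diffeo_on :: "real set \<Rightarrow> real set \<Rightarrow> (real \<Rightarrow> real) \<Rightarrow> bool" where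
  "diffeo_on S T f \<longleftrightarrow>
     bij_betw f S T \<and> f differentiable_on S \<and> inv_into S f differentiable_on T"

section \<open>Functions of bounded variation\<close>

text \<open>
  Functions with values in \<^typ>\<open>ereal\<close> are allowed because the variation of \<open>1 / \<bar>f'\<bar>\<close> is needed,
  which is infinite at a critical point; note that \<open>\<bar>\<infinity> - \<infinity>\<bar> = \<infinity>\<close> in \<^typ>\<open>ereal\<close>.
\<close>

definition variation_on :: "real set \<Rightarrow> (real \<Rightarrow> ereal) \<Rightarrow> ereal" where
  "variation_on J h =
     (SUP xs \<in> {xs. sorted_wrt (<) xs \<and> set xs \<subseteq> J}.
        \<Sum>i\<in>{1..<length xs}. \<bar>h (xs ! i) - h (xs ! (i - 1))\<bar>)"

text \<open>Elements of \<open>L\<^sup>1\<close> are represented by functions; everything below is invariant under changes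
  on null sets.\<close>

definition ess_variation :: "(real \<Rightarrow> real) \<Rightarrow> ereal" where
  "ess_variation h =
     (INF h' \<in> {h'. AE x in leb01. h' x = h x}. variation_on {0..1} (\<lambda>x. ereal (h' x)))"

definition BV :: "(real \<Rightarrow> real) set" where
  "BV = {h. integrable leb01 h \<and> ess_variation h < \<infinity>}"

definition L1_norm :: "(real \<Rightarrow> real) \<Rightarrow> ereal" where
  "L1_norm h = ereal (LINT x|leb01. \<bar>h x\<bar>)"

definition BV_norm :: "(real \<Rightarrow> real) \<Rightarrow> ereal" where
  "BV_norm h = L1_norm h + ess_variation h"

section \<open>Countable partitions into intervals, iterates and cylinders\<close>

text \<open>The intervals are \<open>(a i, b i)\<close> for \<open>i \<in> N\<close>; the index set \<open>N\<close> may be finite or infinite.\<close>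

definition interval_partition :: "nat set \<Rightarrow> (nat \<Rightarrow> real) \<Rightarrow> (nat \<Rightarrow> real) \<Rightarrow> bool" where
  "interval_partition N a b \<longleftrightarrow>
     (\<forall>i\<in>N. 0 \<le> a i \<and> a i < b i \<and> b i \<le> 1) \<and>
     disjoint_family_on (\<lambda>i. {a i<..<b i}) N \<and>
     {0..1} - (\<Union>i\<in>N. {a i<..<b i}) \<in> null_sets lebesgue"

text \<open>
  Maps are only meaningful on the union of the partition intervals. The set \<open>iterate_domain\<close> is the set
  on which the \<open>n\<close>-th iterate is defined, and \<open>cylinders\<close> is the partition belonging to the
  \<open>n\<close>-th iterate.
\<close>

definition iterate_domain ::
  "nat set \<Rightarrow> (nat \<Rightarrow> real) \<Rightarrow> (nat \<Rightarrow> real) \<Rightarrow> (real \<Rightarrow> real) \<Rightarrow> nat \<Rightarrow> real set" where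
  "iterate_domain N a b f n = {x. \<forall>j<n. (f ^^ j) x \<in> (\<Union>i\<in>N. {a i<..<b i})}"

definition cylinders ::
  "nat set \<Rightarrow> (nat \<Rightarrow> real) \<Rightarrow> (nat \<Rightarrow> real) \<Rightarrow> (real \<Rightarrow> real) \<Rightarrow> nat \<Rightarrow> real set set" where
  "cylinders N a b f n =
     {C. C \<noteq> {} \<and> (\<exists>w. (\<forall>j<n. w j \<in> N) \<and>
                       C = {x. \<forall>j<n. (f ^^ j) x \<in> {a (w j)<..<b (w j)}})}"

text \<open>Derivative of the branch of \<open>f\<close> on \<open>(a, b)\<close>, with one-sided (possibly infinite) limits at
  the endpoints.\<close>

definition branch_deriv :: "real \<Rightarrow> real \<Rightarrow> (real \<Rightarrow> real) \<Rightarrow> real \<Rightarrow> ereal" where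
  "branch_deriv a b f x =
     (if x = a then Lim (at_right a) (\<lambda>t. ereal (deriv f t))
      else if x = b then Lim (at_left b) (\<lambda>t. ereal (deriv f t))
      else ereal (deriv f x))"

text \<open>Continuous extension of a branch to the closed interval, and the corresponding preimages.\<close>

definition branch_ext :: "real \<Rightarrow> real \<Rightarrow> (real \<Rightarrow> real) \<Rightarrow> real \<Rightarrow> real" where
  "branch_ext a b f x =
     (if x = a then Lim (at_right a) f else if x = b then Lim (at_left b) f else f x)"

definition branch_preimage :: "real \<Rightarrow> real \<Rightarrow> (real \<Rightarrow> real) \<Rightarrow> real \<Rightarrow> real" where
  "branch_preimage a b f \<gamma> = inv_into {a..b} (branch_ext a b f) \<gamma>"

text \<open>The branches having a preimage of \<open>\<gamma>\<close>; endpoints are only used for \<open>\<gamma> \<in> {0, 1}\<close>.\<close>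

definition branches_over ::
  "nat set \<Rightarrow> (nat \<Rightarrow> real) \<Rightarrow> (nat \<Rightarrow> real) \<Rightarrow> (real \<Rightarrow> real) \<Rightarrow> real \<Rightarrow> nat set" where
  "branches_over N a b f \<gamma> =
     {i \<in> N. \<gamma> \<in> f ` {a i<..<b i} \<or> (\<gamma> \<in> {0, 1} \<and> \<gamma> \<in> branch_ext (a i) (b i) f ` {a i..b i})}"

text \<open>The function \<open>1 / \<bar>h'\<bar>\<close> on \<open>D\<close>, extended by \<open>0\<close>; division is in \<^typ>\<open>ereal\<close>, so it is
  infinite where the derivative vanishes.\<close>

definition recip_deriv :: "real set \<Rightarrow> (real \<Rightarrow> real) \<Rightarrow> real \<Rightarrow> ereal" where
  "recip_deriv D h x = (if x \<in> D then 1 / ereal \<bar>deriv h x\<bar> else 0)"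

abbreviation iter_recip_deriv ::
  "nat set \<Rightarrow> (nat \<Rightarrow> real) \<Rightarrow> (nat \<Rightarrow> real) \<Rightarrow> (real \<Rightarrow> real) \<Rightarrow> nat \<Rightarrow> real \<Rightarrow> ereal" where
  "iter_recip_deriv N a b f k \<equiv> recip_deriv (iterate_domain N a b f k) (f ^^ k)"

section \<open>Piecewise convex and piecewise expanding maps\<close>

definition piecewise_convex ::
  "nat set \<Rightarrow> (nat \<Rightarrow> real) \<Rightarrow> (nat \<Rightarrow> real) \<Rightarrow> (real \<Rightarrow> real) \<Rightarrow> bool" where
  "piecewise_convex N a b f \<longleftrightarrow>
     (\<forall>i\<in>N. strict_mono_on {a i<..<b i} f \<and> convex_on {a i<..<b i} f \<and>
        f differentiable_on {a i<..<b i} \<and> (f \<longlongrightarrow> 0) (at_right (a i))) \<and>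
     (\<Sum>\<^sub>\<infinity>i\<in>N. 1 / branch_deriv (a i) (b i) f (a i)) < \<infinity> \<and>
     (\<not> 0 islimpt (a ` N) \<longrightarrow>
        (\<exists>\<beta>. 0 < \<beta> \<and> \<beta> < 1 \<and> Lim (at_right 0) (\<lambda>t. ereal (deriv f t)) = ereal (1 / \<beta>)))"

definition piecewise_expanding ::
  "nat set \<Rightarrow> (nat \<Rightarrow> real) \<Rightarrow> (nat \<Rightarrow> real) \<Rightarrow> (real \<Rightarrow> real) \<Rightarrow> bool" where
  "piecewise_expanding N a b f \<longleftrightarrow>
     (\<forall>i\<in>N. f differentiable_on {a i<..<b i} \<and>
        (\<exists>g g'. homeomorphism {a i..b i} (g ` {a i..b i}) g g' \<and>
                (\<forall>x\<in>{a i<..<b i}. g x = f x))) \<and>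
     (\<exists>\<beta><1. (SUP x\<in>{0..1}. recip_deriv (\<Union>i\<in>N. {a i<..<b i}) f x) \<le> ereal \<beta>)"

definition nonsingular ::
  "nat set \<Rightarrow> (nat \<Rightarrow> real) \<Rightarrow> (nat \<Rightarrow> real) \<Rightarrow> (real \<Rightarrow> real) \<Rightarrow> bool" where
  "nonsingular N a b f \<longleftrightarrow>
     f \<in> measurable (lebesgue_on (\<Union>i\<in>N. {a i<..<b i})) leb01 \<and>
     absolutely_continuous leb01 (distr (lebesgue_on (\<Union>i\<in>N. {a i<..<b i})) leb01 f)"

text \<open>The Frobenius--Perron operator; for nonsingular \<open>f\<close> and integrable \<open>h\<close> the value exists and
  is unique up to null sets. The test functions \<open>\<phi>\<close> range over \<open>L\<^sup>\<infinity>\<close>.\<close>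

definition frobenius_perron :: "(real \<Rightarrow> real) \<Rightarrow> (real \<Rightarrow> real) \<Rightarrow> real \<Rightarrow> real" where
  "frobenius_perron f h =
     (SOME g. integrable leb01 g \<and>
        (\<forall>\<phi> \<in> borel_measurable leb01. (\<exists>B. AE x in leb01. \<bar>\<phi> x\<bar> \<le> B) \<longrightarrow>
           (LINT x|leb01. \<phi> x * g x) = (LINT x|leb01. \<phi> (f x) * h x)))"

definition mixing_measure :: "'a measure \<Rightarrow> ('a \<Rightarrow> 'a) \<Rightarrow> bool" where
  "mixing_measure M f \<longleftrightarrow>
     (\<forall>A\<in>sets M. f -` A \<inter> space M \<in> sets M \<and> emeasure M (f -` A \<inter> space M) = emeasure M A) \<and>
     (\<forall>A\<in>sets M. \<forall>B\<in>sets M.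
        (\<lambda>n. measure M ((f ^^ n) -` A \<inter> B)) \<longlonglongrightarrow> measure M A * measure M B)"

definition pre_piecewise_convex_or_expanding ::
  "nat set \<Rightarrow> (nat \<Rightarrow> real) \<Rightarrow> (nat \<Rightarrow> real) \<Rightarrow> (real \<Rightarrow> real) \<Rightarrow> bool" where
  "pre_piecewise_convex_or_expanding N a b f \<longleftrightarrow>
     (\<exists>n0\<ge>1. \<exists>M c d. interval_partition M c d \<and>
        (\<lambda>j. {c j<..<d j}) ` M = cylinders N a b f n0 \<and>
        (piecewise_convex M c d (f ^^ n0) \<or> piecewise_expanding M c d (f ^^ n0))) \<and>
     nonsingular N a b f \<and>
     (\<exists>C::real. \<forall>h\<in>BV. frobenius_perron f h \<in> BV \<and>
        BV_norm (frobenius_perron f h) \<le> ereal C * BV_norm h) \<and>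
     (\<exists>h1\<in>BV. (AE x in leb01. frobenius_perron f h1 x = h1 x) \<and>
        (AE x in leb01. 0 \<le> h1 x) \<and>
        prob_space (density leb01 (\<lambda>x. ennreal (h1 x))) \<and>
        mixing_measure (density leb01 (\<lambda>x. ennreal (h1 x))) f)"

section \<open>Fiber maps\<close>

text \<open>Second component of the \<open>k\<close>-th iterate of the skew product \<open>(x, y) \<mapsto> (f x, G x y)\<close>.\<close>

definition fiber_iter ::
  "(real \<Rightarrow> real) \<Rightarrow> (real \<Rightarrow> real \<Rightarrow> real) \<Rightarrow> nat \<Rightarrow> real \<Rightarrow> real \<Rightarrow> real" where
  "fiber_iter f G k x y = snd (((\<lambda>(x, y). (f x, G x y)) ^^ k) (x, y))"

definition H1 :: "real \<Rightarrow> (real \<Rightarrow> real \<Rightarrow> real) \<Rightarrow> bool" where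
  "H1 \<alpha> G \<longleftrightarrow>
     0 \<le> \<alpha> \<and> \<alpha> < 1 \<and>
     (AE x in leb01. \<forall>z1\<in>{0..1}. \<forall>z2\<in>{0..1}. dist (G x z1) (G x z2) \<le> \<alpha> * dist z1 z2)"

definition fiber_Lip :: "real set set \<Rightarrow> (real \<Rightarrow> real \<Rightarrow> real) \<Rightarrow> ereal" where
  "fiber_Lip Q G =
     Sup {ereal (dist (G x1 y) (G x2 y) / dist x1 x2) | J y x1 x2.
            J \<in> Q \<and> y \<in> {0..1} \<and> x1 \<in> J \<and> x2 \<in> J \<and> x1 \<noteq> x2}"

definition H2 :: "real set set \<Rightarrow> (real \<Rightarrow> real \<Rightarrow> real) \<Rightarrow> bool" where
  "H2 Q G \<longleftrightarrow> fiber_Lip Q G < \<infinity>"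

definition H3 ::
  "nat set \<Rightarrow> (nat \<Rightarrow> real) \<Rightarrow> (nat \<Rightarrow> real) \<Rightarrow> (real \<Rightarrow> real) \<Rightarrow> (real \<Rightarrow> real \<Rightarrow> real) \<Rightarrow>
     real \<Rightarrow> nat \<Rightarrow> bool" where
  "H3 N a b f G \<alpha> k \<longleftrightarrow>
     ereal (\<alpha> ^ k) * esssup leb01 (iter_recip_deriv N a b f k) < 1 \<and>
     H1 (\<alpha> ^ k) (fiber_iter f G k) \<and>
     H2 (cylinders N a b f k) (fiber_iter f G k)"

section \<open>Perturbations\<close>

text \<open>
  Families are given by \<open>f \<delta>\<close> and \<open>G \<delta>\<close>. As the maps \<open>f \<delta>\<close> and \<open>G \<delta>\<close> are defined over the
  partition intervals only, so is the comparison of the fiber maps.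
\<close>

definition R_perturbation_below ::
  "nat set \<Rightarrow> (nat \<Rightarrow> real) \<Rightarrow> (nat \<Rightarrow> real) \<Rightarrow> (real \<Rightarrow> real \<Rightarrow> real) \<Rightarrow>
     (real \<Rightarrow> real \<Rightarrow> real \<Rightarrow> real) \<Rightarrow> (real \<Rightarrow> real) \<Rightarrow> real \<Rightarrow> bool" where
  "R_perturbation_below N a b f G R \<delta>0 \<longleftrightarrow>
     (\<forall>\<delta>\<in>{0..<\<delta>0}. pre_piecewise_convex_or_expanding N a b (f \<delta>) \<and>
        (\<forall>i\<in>N. f \<delta> ` {a i<..<b i} = f 0 ` {a i<..<b i})) \<and>
     (\<forall>\<delta>\<in>{0..<\<delta>0}. 0 < R \<delta>) \<and>
     ((\<lambda>\<delta>. R \<delta> * ln \<delta>) \<longlongrightarrow> 0) (at_right 0) \<and>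
     (\<forall>\<delta>\<in>{0..<\<delta>0}.
        (\<forall>\<gamma>\<in>{0..1}.
           (\<Sum>\<^sub>\<infinity>i\<in>branches_over N a b (f 0) \<gamma>.
              \<bar>1 / branch_deriv (a i) (b i) (f \<delta>) (branch_preimage (a i) (b i) (f \<delta>) \<gamma>)
               - 1 / branch_deriv (a i) (b i) (f 0) (branch_preimage (a i) (b i) (f 0) \<gamma>)\<bar>)
           \<le> ereal (R \<delta>)) \<and>
        esssup leb01 (\<lambda>\<gamma>. SUP i\<in>branches_over N a b (f 0) \<gamma>.
           ereal (dist (branch_preimage (a i) (b i) (f 0) \<gamma>)
                       (branch_preimage (a i) (b i) (f \<delta>) \<gamma>))) \<le> ereal (R \<delta>) \<and>
        (\<forall>x\<in>(\<Union>i\<in>N. {a i<..<b i}). \<forall>y\<in>{0..1}. dist (G 0 x y) (G \<delta> x y) \<le> R \<delta>))"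

definition admissible_below ::
  "nat set \<Rightarrow> (nat \<Rightarrow> real) \<Rightarrow> (nat \<Rightarrow> real) \<Rightarrow> (real \<Rightarrow> real \<Rightarrow> real) \<Rightarrow>
     (real \<Rightarrow> real \<Rightarrow> real \<Rightarrow> real) \<Rightarrow> real \<Rightarrow> bool" where
  "admissible_below N a b f G \<delta>0 \<longleftrightarrow>
     (\<exists>D \<rho>. 0 < D \<and> 0 < \<rho> \<and> \<rho> < 1 \<and>
        (\<forall>h\<in>BV. \<forall>\<delta>\<in>{0..<\<delta>0}. \<forall>n\<ge>1.
           BV_norm ((frobenius_perron (f \<delta>) ^^ n) h)
             \<le> ereal (D * \<rho> ^ n) * BV_norm h + ereal D * L1_norm h)) \<and>
     (\<exists>\<alpha> k.
        (\<forall>\<delta>\<in>{0..<\<delta>0}.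
           H1 (\<alpha> \<delta>) (G \<delta>) \<and>
           H2 ((\<lambda>i. {a i<..<b i}) ` N) (G \<delta>) \<and>
           H3 N a b (f \<delta>) (G \<delta>) (\<alpha> \<delta>) k) \<and>
        (SUP \<delta>\<in>{0..<\<delta>0}.
           ereal (\<alpha> \<delta> ^ k) * esssup leb01 (iter_recip_deriv N a b (f \<delta>) k)) < 1 \<and>
        (SUP \<delta>\<in>{0..<\<delta>0}.
           fiber_Lip ((\<lambda>i. {a i<..<b i}) ` N) (G \<delta>) *
             esssup leb01 (iter_recip_deriv N a b (f \<delta>) k)
           + variation_on {0..1} (iter_recip_deriv N a b (f \<delta>) k)) < \<infinity>)"

text \<open>The family indexed by \<open>\<delta> \<in> [0, \<delta>1)\<close> is an admissible \<open>R(\<delta>)\<close>-perturbation of its member at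
  \<open>\<delta> = 0\<close>; both groups of conditions refer to the same \<open>\<delta>0\<close>.\<close>

definition admissible_R_perturbation ::
  "nat set \<Rightarrow> (nat \<Rightarrow> real) \<Rightarrow> (nat \<Rightarrow> real) \<Rightarrow> (real \<Rightarrow> real \<Rightarrow> real) \<Rightarrow>
     (real \<Rightarrow> real \<Rightarrow> real \<Rightarrow> real) \<Rightarrow> (real \<Rightarrow> real) \<Rightarrow> real \<Rightarrow> bool" where
  "admissible_R_perturbation N a b f G R \<delta>1 \<longleftrightarrow>
     (\<exists>\<delta>0. 0 < \<delta>0 \<and> \<delta>0 \<le> \<delta>1 \<and> \<delta>0 < 1 \<and>
        R_perturbation_below N a b f G R \<delta>0 \<and> admissible_below N a b f G \<delta>0)"

end

theory Submission
  imports Defs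
begin

text \<open>
  Since every branch maps its interval onto \<open>(0, 1)\<close> and \<open>\<bar>f''\<bar> \<le> D \<bar>f'\<bar>\<^sup>2\<close>, the logarithm of the
  derivative of an inverse branch is \<open>D\<close>-Lipschitz on \<open>(0, 1)\<close>. This bounded distortion is the source
  of all estimates: an inverse branch and its derivative extend to \<open>[0, 1]\<close>, the derivative stays
  between multiples of the length of the branch interval, and as these lengths have sum one, series over
  infinitely many branches converge uniformly. Such a map, presented by its inverse branches, is a
  \<open>full_branch_system\<close>; these are closed under composition (\<open>full_branch_compose\<close>).

  The hypotheses are stable under \<open>C\<^sup>2\<close>-small perturbations with uniform constants. For the first
  derivative, the distortion and the expansion by at least \<open>1 - \<delta>\<close> this is immediate
  (\<open>perturbed_system\<close>). For the expansion of \<open>f\<^sub>\<delta>\<^sup>2\<close> it is not, as \<open>f\<^sub>\<delta> x\<close> and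
  \<open>f\<^sub>0 x\<close> may lie in different branch intervals; but \<open>f\<^sub>\<delta> x = f\<^sub>0 x'\<close> for some \<open>x'\<close> close to \<open>x\<close> in the
  same branch interval (\<open>perturbed_square_contraction\<close>). So all maps \<open>f\<^sub>\<delta>\<close> with small \<open>\<delta>\<close> have a power,
  the same for all of them, that contracts strongly along inverse branches with bounded distortion.

  For a system whose inverse branches contract by \<open>\<theta>\<close>, full branches leave no boundary terms in the
  variation of the transferred function, and \<open>lasota_yorke\<close> bounds it by a multiple of \<open>\<theta>\<close> times the
  variation plus a multiple of the \<open>L\<^sup>1\<close> norm. Applied to a strongly contracting power, and iterated, this
  is the uniform Lasota--Yorke inequality (\<open>uniform_lasota_yorke\<close>). On positive log-Lipschitz densities
  the transfer operator of a strongly contracting power contracts, because two such densities always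
  have a common constant part of definite size (\<open>coupling\<close>); this produces an invariant density and
  exponential convergence to it. Approximating indicators by Lipschitz functions gives mixing of
  the power, and mixing of the map itself follows as the map commutes with its power
  (\<open>exists_mixing_density\<close>).

  Finally, inverse branches of \<open>f\<^sub>0\<close> and \<open>f\<^sub>\<delta>\<close>, and their derivatives, differ on the \<open>i\<close>-th interval by at
  most a constant times \<open>\<delta>\<close> times its length (\<open>perturbed_point\<close>). Summation gives the closeness
  conditions with \<open>R(\<delta>) = C \<delta>\<close>. The fiber conditions hold with \<open>k = 1\<close>: the contraction rate
  of \<open>G\<^sub>\<delta>\<close> is at most \<open>\<alpha> + \<delta>\<close>, the base contributes \<open>1 / (1 - \<delta>)\<close>, and \<open>1 / \<bar>f\<^sub>\<delta>'\<bar>\<close> has uniformly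
  bounded variation (\<open>variation_recip_deriv\<close>).
\<close>

section \<open>Variation and monotone majorants\<close>

definition list_variation :: "(real \<Rightarrow> real) \<Rightarrow> real list \<Rightarrow> real" where
  "list_variation u xs = (\<Sum>i\<in>{1..<length xs}. \<bar>u (xs ! i) - u (xs ! (i - 1))\<bar>)"

lemma variation_on_real:
  "variation_on J (\<lambda>x. ereal (u x)) =
     (SUP xs \<in> {xs. sorted_wrt (<) xs \<and> set xs \<subseteq> J}. ereal (list_variation u xs))"
  unfolding variation_on_def list_variation_def by simp

lemma list_variation_nonneg: "0 \<le> list_variation u xs"
  unfolding list_variation_def by (simp add: sum_nonneg)

lemma list_variation_snoc:
  assumes "xs \<noteq> []"
  shows "list_variation u (xs @ [y]) = list_variation u xs + \<bar>u y - u (last xs)\<bar>"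
proof -
  have l: "length xs > 0" using assms by simp
  have e: "{1..<length (xs @ [y])} = insert (length xs) {1..<length xs}"
    using l by (auto simp: Suc_le_eq)
  have "(\<Sum>i\<in>{1..<length xs}. \<bar>u ((xs @ [y]) ! i) - u ((xs @ [y]) ! (i - 1))\<bar>)
      = (\<Sum>i\<in>{1..<length xs}. \<bar>u (xs ! i) - u (xs ! (i - 1))\<bar>)"
    by (rule sum.cong) (auto simp: nth_append)
  then show ?thesis
    unfolding list_variation_def e using l assms
    by (simp add: nth_append last_conv_nth)
qed

text \<open>The increments of \<open>v\<close> along a list telescope.\<close>

lemma variation_on_le_of_majorant:
  fixes u v :: "real \<Rightarrow> real"
  assumes inc: "\<And>x y. \<lbrakk>x \<in> J; y \<in> J; x < y\<rbrakk> \<Longrightarrow> \<bar>u x - u y\<bar> \<le> v y - v x"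
    and tot: "\<And>x y. \<lbrakk>x \<in> J; y \<in> J\<rbrakk> \<Longrightarrow> v y - v x \<le> c" and c: "0 \<le> c"
  shows "variation_on J (\<lambda>x. ereal (u x)) \<le> ereal c"
  unfolding variation_on_real
proof (rule SUP_least, clarsimp)
  fix xs :: "real list" assume s: "sorted_wrt (<) xs" and J: "set xs \<subseteq> J"
  show "list_variation u xs \<le> c"
  proof (cases "xs = []")
    case True then show ?thesis using c by (simp add: list_variation_def)
  next
    case False
    have "n \<le> length xs \<Longrightarrow> n \<ge> 1 \<Longrightarrow>
        (\<Sum>i\<in>{1..<n}. v (xs ! i) - v (xs ! (i - 1))) = v (xs ! (n - 1)) - v (xs ! 0)" for n
    proof (induction n)
      case (Suc n)
      show ?case
      proof (cases "n = 0")
        case False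
        have "{1..<Suc n} = insert n {1..<n}" using False by auto
        then show ?thesis using Suc False by simp
      qed simp
    qed simp
    from this[of "length xs"] False
    have tel: "(\<Sum>i\<in>{1..<length xs}. v (xs ! i) - v (xs ! (i - 1)))
        = v (xs ! (length xs - 1)) - v (xs ! 0)"
      by (simp add: Suc_leI)
    have "list_variation u xs \<le> (\<Sum>i\<in>{1..<length xs}. v (xs ! i) - v (xs ! (i - 1)))"
      unfolding list_variation_def
    proof (rule sum_mono)
      fix i assume i: "i \<in> {1..<length xs}"
      have "xs ! (i - 1) < xs ! i"
        using s i by (auto simp: sorted_wrt_iff_nth_less)
      moreover have "xs ! (i - 1) \<in> J" "xs ! i \<in> J"
        using J i nth_mem[of "i - 1" xs] nth_mem[of i xs] by auto
      ultimately show "\<bar>u (xs ! i) - u (xs ! (i - 1))\<bar> \<le> v (xs ! i) - v (xs ! (i - 1))"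
        using inc[of "xs ! (i-1)" "xs ! i"] by (simp add: abs_minus_commute)
    qed
    also have "\<dots> \<le> c"
      unfolding tel using False J nth_mem[of 0 xs] nth_mem[of "length xs - 1" xs]
      by (intro tot) (auto simp: subset_iff)
    finally show ?thesis .
  qed
qed

text \<open>Conversely, the variation over \<open>[0, x]\<close> is a monotone majorant. Working with such a majorant
  reduces all estimates of variations below to estimates of increments between two points.\<close>

lemma variation_on_majorant:
  fixes u :: "real \<Rightarrow> real"
  assumes "variation_on {0..1} (\<lambda>x. ereal (u x)) \<le> ereal c"
  shows "\<exists>v. (\<forall>x y. 0 \<le> x \<longrightarrow> x \<le> y \<longrightarrow> y \<le> 1 \<longrightarrow> \<bar>u x - u y\<bar> \<le> v y - v x) \<and> v 1 - v 0 \<le> c"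
proof -
  define A where "A x = {xs::real list. sorted_wrt (<) xs \<and> set xs \<subseteq> {0..x}}" for x
  define v where "v x = (SUP xs\<in>A x. list_variation u xs)" for x
  have ne: "A x \<noteq> {}" for x unfolding A_def by (rule ex_in_conv[THEN iffD1], rule exI[of _ "[]"]) simp
  have le_c: "list_variation u xs \<le> c" if "xs \<in> A x" "x \<le> 1" for xs x
  proof -
    have "ereal (list_variation u xs) \<le> variation_on {0..1} (\<lambda>x. ereal (u x))"
      unfolding variation_on_real using that by (intro SUP_upper) (auto simp: A_def)
    then show ?thesis using assms by (meson ereal_less_eq(3) order_trans)
  qed
  have bdd: "bdd_above (list_variation u ` A x)" if "x \<le> 1" for x
    using le_c[OF _ that] by (auto intro!: bdd_aboveI)
  have up: "list_variation u xs \<le> v x" if "xs \<in> A x" "x \<le> 1" for xs x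
    unfolding v_def using that bdd by (intro cSUP_upper) auto
  have "\<bar>u x - u y\<bar> \<le> v y - v x" if xy: "0 \<le> x" "x \<le> y" "y \<le> 1" for x y
  proof (cases "x = y")
    case False
    then have lt: "x < y" using xy by simp
    have "list_variation u xs \<le> v y - \<bar>u x - u y\<bar>" if xs: "xs \<in> A x" for xs
    proof -
      consider "xs = []" | "xs \<noteq> []" "last xs = x" | "xs \<noteq> []" "last xs < x"
      proof (cases "xs = []")
        case False
        then have "last xs \<in> {0..x}" using xs last_in_set[of xs] unfolding A_def by blast
        then have "last xs \<le> x" by simp
        then show ?thesis using False that(2,3) by (meson le_less)
      qed (use that(1) in simp)
      then show ?thesis
      proof cases
        case 1
        have "[x, y] \<in> A y" using lt xy by (auto simp: A_def)
        from up[OF this] show ?thesis using 1 xy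
          by (simp add: list_variation_def abs_minus_commute)
      next
        case 2
        have "xs @ [y] \<in> A y" 
          using xs lt xy unfolding A_def by (auto simp: sorted_wrt_append)
        from up[OF this] show ?thesis using 2 xy
          by (simp add: list_variation_snoc abs_minus_commute)
      next
        case 3
        obtain ys l where l: "xs = ys @ [l]" using 3(1) by (cases xs rule: rev_cases) auto
        have "z < x" if "z \<in> set xs" for z
        proof -
          have "sorted_wrt (<) (ys @ [l])" "z \<in> set ys \<or> z = l"
            using xs that unfolding l A_def by auto
          then have "z \<le> l" unfolding sorted_wrt_append by auto
          then show ?thesis using 3(2) l by simp
        qed
        then have "xs @ [x] @ [y] \<in> A y"
          using xs lt xy unfolding A_def by (auto simp: sorted_wrt_append intro: less_trans)
        from up[OF this] have "list_variation u ((xs @ [x]) @ [y]) \<le> v y" using xy by simp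
        then show ?thesis using 3
          by (subst (asm) list_variation_snoc, simp, subst (asm) list_variation_snoc)
            (auto simp: abs_minus_commute)
      qed
    qed
    then have "v x \<le> v y - \<bar>u x - u y\<bar>"
      unfolding v_def[of x] by (intro cSUP_least ne)
    then show ?thesis by simp
  qed simp
  moreover have "v 1 - v 0 \<le> c"
  proof -
    have "v 1 \<le> c" unfolding v_def using le_c by (intro cSUP_least ne) auto
    moreover have "0 \<le> v 0" using up[of "[]" 0] by (simp add: A_def list_variation_def)
    ultimately show ?thesis by simp
  qed
  ultimately show ?thesis by blast
qed

lemma variation_on_nonneg: "0 \<le> variation_on J (\<lambda>x. ereal (u x))"
  unfolding variation_on_real
  by (rule SUP_upper2[of "[]"]) (auto simp: list_variation_nonneg)

lemma ess_variation_nonneg: "0 \<le> ess_variation h"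
  unfolding ess_variation_def by (intro INF_greatest variation_on_nonneg)

text \<open>By induction: an interval that lies furthest to the right can be removed, since all others end
  before it begins.\<close>

lemma sum_increments_disjoint_intervals:
  fixes v :: "real \<Rightarrow> real"
  assumes "finite F"
    and "\<And>x y. \<lbrakk>0 \<le> x; x \<le> y; y \<le> 1\<rbrakk> \<Longrightarrow> v x \<le> v y"
    and "\<And>i. i \<in> F \<Longrightarrow> 0 \<le> a i \<and> a i < b i \<and> b i \<le> t"
    and "disjoint_family_on (\<lambda>i. {a i<..<b i}) F" and "0 \<le> t" "t \<le> 1"
  shows "(\<Sum>i\<in>F. v (b i) - v (a i)) \<le> v t - v 0"
  using assms
proof (induction F arbitrary: t rule: finite_ranking_induct[where f = b])
  case (insert x S)
  show ?case
  proof (cases "x \<in> S")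
    case True
    then show ?thesis using insert by (simp add: insert_absorb)
  next
    case False
    have ax: "0 \<le> a x" "a x < b x" "b x \<le> t" using insert.prems(2) by auto
    have left: "b i \<le> a x" if "i \<in> S" for i
    proof (rule ccontr)
      assume "\<not> b i \<le> a x"
      moreover have "{a i<..<b i} \<inter> {a x<..<b x} = {}"
        using insert.prems(3) that False unfolding disjoint_family_on_def by auto
      moreover have "a i < b i" "b i \<le> b x" using insert.prems(2)[of i] insert.hyps(2) that by auto
      ultimately show False using ax by (auto simp: max_def min_def split: if_splits)
    qed
    have "(\<Sum>i\<in>S. v (b i) - v (a i)) \<le> v (a x) - v 0"
    proof (rule insert.IH)
      show "disjoint_family_on (\<lambda>i. {a i<..<b i}) S"
        using insert.prems(3) by (rule disjoint_family_on_mono[rotated]) auto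
      show "0 \<le> a i \<and> a i < b i \<and> b i \<le> a x" if "i \<in> S" for i
        using insert.prems(2)[of i] left that by auto
      show "0 \<le> a x" "a x \<le> 1" using ax insert.prems(5) by auto
    qed (use insert.prems(1) in auto)
    moreover have "v (b x) \<le> v t" using insert.prems(1)[of "b x" t] insert.prems(5) ax by simp
    ultimately show ?thesis using False insert.hyps by simp
  qed
qed (auto)

section \<open>Full-branch systems with controlled distortion\<close>

text \<open>Bounds on ratios are turned into bounds on differences, by \<open>exp s - 1 \<le> s * exp s\<close>.\<close>

lemma increment_le_of_ratio:
  fixes u v :: real
  assumes "u \<le> exp (L * t) * v" and L: "0 \<le> L" and t: "0 \<le> t" "t \<le> 1" and v: "0 \<le> v" "v \<le> M"
  shows "u - v \<le> L * exp L * M * t"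
proof -
  define s where "s = L * t"
  have s: "0 \<le> s" "s \<le> L" using L t by (auto simp: s_def mult_left_le)
  have "1 - s \<le> exp (- s)" using exp_ge_add_one_self[of "- s"] by simp
  then have "exp s * (1 - s) \<le> exp s * exp (- s)" by (intro mult_left_mono) auto
  then have es: "exp s - 1 \<le> s * exp s" by (simp add: exp_minus algebra_simps)
  have "u - v \<le> (exp s - 1) * v" using assms(1) by (simp add: s_def algebra_simps)
  also have "\<dots> \<le> (s * exp s) * M" using es s v by (intro mult_mono) auto
  also have "\<dots> \<le> (s * exp L) * M" using s v by (intro mult_right_mono mult_left_mono) auto
  also have "\<dots> = L * exp L * M * t" unfolding s_def by (simp only: ac_simps)
  finally show ?thesis .
qed

lemma continuous_on_unit_le:
  fixes u :: "real \<Rightarrow> real"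
  assumes u: "continuous_on {0..1} u" and le: "\<And>y. \<lbrakk>0 < y; y < 1\<rbrakk> \<Longrightarrow> u y \<le> r"
    and y: "0 \<le> y" "y \<le> 1"
  shows "u y \<le> r"
proof -
  have "u ` closure {0<..<1} \<subseteq> {..r}" by (rule image_closure_subset) (use u le in auto)
  moreover have "u y \<in> u ` closure {0<..<1}" using y by (intro imageI) simp
  ultimately have "u y \<in> {..r}" by blast
  then show ?thesis by simp
qed

text \<open>A map all of whose branches are onto, presented by its inverse branches \<open>\<gamma> i\<close> and the weights
  \<open>w i = \<bar>(\<gamma> i)'\<bar>\<close>, with orientation \<open>\<sigma> i\<close>. Inverse branches and weights live on the closed interval,
  where the variation is taken and where one-sided limits at endpoints are read off; differentiability is
  demanded in the interior. Weights vanish for indices outside \<open>N\<close>, so that sums over branches can be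
  series over all natural numbers.\<close>

locale full_branch_system =
  fixes N :: "nat set" and a b :: "nat \<Rightarrow> real" and f :: "real \<Rightarrow> real"
    and \<sigma> :: "nat \<Rightarrow> real" and \<gamma> w :: "nat \<Rightarrow> real \<Rightarrow> real" and \<theta> D :: real
  assumes partition: "interval_partition N a b"
    and theta_pos: "0 < \<theta>" and D_nonneg: "0 \<le> D"
    and sign: "i \<in> N \<Longrightarrow> \<sigma> i = 1 \<or> \<sigma> i = -1"
    and cont: "i \<in> N \<Longrightarrow> continuous_on {0..1} (\<gamma> i)"
    and deriv: "\<lbrakk>i \<in> N; 0 < y; y < 1\<rbrakk> \<Longrightarrow> (\<gamma> i has_real_derivative \<sigma> i * w i y) (at y)"
    and image: "i \<in> N \<Longrightarrow> \<gamma> i ` {0<..<1} = {a i<..<b i}"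
    and right_inverse: "\<lbrakk>i \<in> N; 0 < y; y < 1\<rbrakk> \<Longrightarrow> f (\<gamma> i y) = y"
    and weight_pos: "\<lbrakk>i \<in> N; 0 \<le> y; y \<le> 1\<rbrakk> \<Longrightarrow> 0 < w i y"
    and weight_le: "\<lbrakk>i \<in> N; 0 \<le> y; y \<le> 1\<rbrakk> \<Longrightarrow> w i y \<le> \<theta>"
    and distortion: "\<lbrakk>i \<in> N; 0 \<le> x; x \<le> 1; 0 \<le> y; y \<le> 1\<rbrakk>
                       \<Longrightarrow> w i x \<le> exp (D * \<bar>x - y\<bar>) * w i y"
    and weight_zero: "i \<notin> N \<Longrightarrow> w i y = 0"
begin

text \<open>Zero outside \<open>N\<close>, like the weights.\<close>

definition len :: "nat \<Rightarrow> real" where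
  "len i = (if i \<in> N then b i - a i else 0)"

lemma interval: "i \<in> N \<Longrightarrow> 0 \<le> a i \<and> a i < b i \<and> b i \<le> 1"
  using partition unfolding interval_partition_def by blast

lemma disjoint: "disjoint_family_on (\<lambda>i. {a i<..<b i}) N"
  using partition unfolding interval_partition_def by blast

lemma null_rest: "{0..1} - (\<Union>i\<in>N. {a i<..<b i}) \<in> null_sets lebesgue"
  using partition unfolding interval_partition_def by blast

lemma nonempty: "N \<noteq> {}"
proof
  assume "N = {}"
  then have "{0..1::real} \<in> null_sets lebesgue" using null_rest by simp
  then show False by (auto simp: null_sets_def)
qed

lemma len_nonneg: "0 \<le> len i"
  using interval by (force simp: len_def)

lemma sum_len_le: "finite F \<Longrightarrow> F \<subseteq> N \<Longrightarrow> (\<Sum>i\<in>F. b i - a i) \<le> 1"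
  using sum_increments_disjoint_intervals[of F "\<lambda>x. x" a b 1] interval
    disjoint_family_on_mono[OF _ disjoint, of F] by (auto simp: subset_iff)

lemma sum_lessThan_N: "(\<Sum>i<n. if i \<in> N then h i else 0) = (\<Sum>i\<in>{..<n} \<inter> N. h i :: real)"
  by (simp add: sum.inter_restrict)

lemma summable_len: "summable len" and suminf_len_le: "suminf len \<le> 1"
proof -
  have p: "sum len {..<n} \<le> 1" for n
    unfolding len_def sum_lessThan_N by (rule sum_len_le) auto
  show s: "summable len"
    by (rule summableI_nonneg_bounded[OF len_nonneg p])
  show "suminf len \<le> 1" by (rule suminf_le_const[OF s p])
qed

lemma inverse_branch_interior: "\<lbrakk>i \<in> N; 0 < y; y < 1\<rbrakk> \<Longrightarrow> a i < \<gamma> i y \<and> \<gamma> i y < b i"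
  using image by fastforce

lemma inverse_branch_range:
  assumes i: "i \<in> N" and y: "0 \<le> y" "y \<le> 1"
  shows "a i \<le> \<gamma> i y \<and> \<gamma> i y \<le> b i"
proof -
  have "- \<gamma> i y \<le> - a i"
    by (rule continuous_on_unit_le[OF continuous_on_minus[OF cont[OF i]] _ y])
      (use inverse_branch_interior[OF i] in fastforce)
  moreover have "\<gamma> i y \<le> b i"
    by (rule continuous_on_unit_le[OF cont[OF i] _ y]) (use inverse_branch_interior[OF i] in fastforce)
  ultimately show ?thesis by simp
qed

lemma inverse_branch_unit: "\<lbrakk>i \<in> N; 0 \<le> y; y \<le> 1\<rbrakk> \<Longrightarrow> 0 \<le> \<gamma> i y \<and> \<gamma> i y \<le> 1"
  using inverse_branch_range[of i y] interval[of i] by linarith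

lemma left_inverse: "\<lbrakk>i \<in> N; a i < x; x < b i\<rbrakk> \<Longrightarrow> 0 < f x \<and> f x < 1 \<and> \<gamma> i (f x) = x"
proof -
  assume i: "i \<in> N" and x: "a i < x" "x < b i"
  then have "x \<in> \<gamma> i ` {0<..<1}" using image[OF i] by simp
  then obtain y where "x = \<gamma> i y" "0 < y" "y < 1" by auto
  then show ?thesis using right_inverse[OF i] by simp
qed

lemma mean_value:
  assumes i: "i \<in> N" and xy: "0 \<le> x" "x < y" "y \<le> 1"
  obtains \<xi> where "x < \<xi>" "\<xi> < y" "\<sigma> i * (\<gamma> i y - \<gamma> i x) = (y - x) * w i \<xi>"
proof -
  have c: "continuous_on {x..y} (\<gamma> i)"
    by (rule continuous_on_subset[OF cont[OF i]]) (use xy in auto)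
  have d: "(\<gamma> i has_derivative (*) (\<sigma> i * w i z)) (at z)" if "x < z" "z < y" for z
    using deriv[of i z] i xy that by (simp add: has_field_derivative_def)
  obtain \<xi> where \<xi>: "x < \<xi>" "\<xi> < y" "\<gamma> i y - \<gamma> i x = (\<sigma> i * w i \<xi>) * (y - x)"
    using mvt[OF xy(2) c, of "\<lambda>z. (*) (\<sigma> i * w i z)"] d by metis
  have "\<sigma> i * \<sigma> i = 1" using sign[OF i] by auto
  then have "\<sigma> i * (\<gamma> i y - \<gamma> i x) = (y - x) * w i \<xi>"
    unfolding \<xi>(3) by (simp add: mult.assoc[symmetric])
  then show ?thesis using that \<xi> by blast
qed

lemma inverse_branch_increment:
  assumes i: "i \<in> N" and xy: "0 \<le> x" "x \<le> y" "y \<le> 1"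
  shows "0 \<le> \<sigma> i * (\<gamma> i y - \<gamma> i x)" "\<sigma> i * (\<gamma> i y - \<gamma> i x) \<le> \<theta> * (y - x)"
    "\<bar>\<gamma> i y - \<gamma> i x\<bar> \<le> \<theta> * (y - x)"
proof -
  have "0 \<le> \<sigma> i * (\<gamma> i y - \<gamma> i x) \<and> \<sigma> i * (\<gamma> i y - \<gamma> i x) \<le> \<theta> * (y - x)"
  proof (cases "x = y")
    case False
    then obtain \<xi> where \<xi>: "x < \<xi>" "\<xi> < y" "\<sigma> i * (\<gamma> i y - \<gamma> i x) = (y - x) * w i \<xi>"
      using mean_value[OF i xy(1) _ xy(3)] xy(2) by auto
    then show ?thesis
      using weight_pos[OF i, of \<xi>] weight_le[OF i, of \<xi>] xy False
      by (auto simp: mult.commute intro!: mult_left_mono)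
  qed simp
  then show "0 \<le> \<sigma> i * (\<gamma> i y - \<gamma> i x)" "\<sigma> i * (\<gamma> i y - \<gamma> i x) \<le> \<theta> * (y - x)"
    "\<bar>\<gamma> i y - \<gamma> i x\<bar> \<le> \<theta> * (y - x)"
    using sign[OF i] by auto
qed

lemma inverse_branch_lipschitz:
  assumes i: "i \<in> N" and "0 \<le> x" "x \<le> 1" "0 \<le> y" "y \<le> 1"
  shows "\<bar>\<gamma> i x - \<gamma> i y\<bar> \<le> \<theta> * \<bar>x - y\<bar>"
  using inverse_branch_increment(3)[OF i, of x y] inverse_branch_increment(3)[OF i, of y x] assms
  by (cases "x \<le> y") (auto simp: abs_minus_commute)

lemma inj_inverse_branch: assumes i: "i \<in> N" shows "inj_on (\<gamma> i) {0..1}"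
proof (rule linorder_inj_onI)
  fix x y :: real assume xy: "x < y" "x \<in> {0..1}" "y \<in> {0..1}"
  then obtain \<xi> where \<xi>: "x < \<xi>" "\<xi> < y" "\<sigma> i * (\<gamma> i y - \<gamma> i x) = (y - x) * w i \<xi>"
    using mean_value[OF i, of x y] by auto
  have "0 < (y - x) * w i \<xi>" using weight_pos[OF i, of \<xi>] \<xi> xy by auto
  then show "\<gamma> i x \<noteq> \<gamma> i y" using \<xi>(3) by auto
qed auto

text \<open>The mean value theorem provides a point where the weight is at most the length of the
  branch interval; bounded distortion carries this bound to all other points.\<close>

lemma weight_le_len:
  assumes y: "0 \<le> y" "y \<le> 1" shows "w i y \<le> exp D * len i"
proof (cases "i \<in> N")
  case True
  obtain \<xi> where \<xi>: "0 < \<xi>" "\<xi> < 1" "\<sigma> i * (\<gamma> i 1 - \<gamma> i 0) = w i \<xi>"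
    using mean_value[OF True, of 0 1] by auto
  have "w i \<xi> \<le> len i"
    using \<xi>(3) inverse_branch_range[OF True, of 0] inverse_branch_range[OF True, of 1] sign[OF True] True
    by (auto simp: len_def)
  have "w i y \<le> exp (D * \<bar>y - \<xi>\<bar>) * w i \<xi>" using distortion[OF True] y \<xi> by auto
  also have "\<dots> \<le> exp D * len i"
    using \<open>w i \<xi> \<le> len i\<close> weight_pos[OF True, of \<xi>] \<xi> y D_nonneg
    by (intro mult_mono) (auto simp: mult_left_le)
  finally show ?thesis .
qed (simp add: weight_zero len_def)

lemma weight_nonneg: "\<lbrakk>0 \<le> y; y \<le> 1\<rbrakk> \<Longrightarrow> 0 \<le> w i y"
  using weight_pos[of i y] weight_zero[of i y] by (cases "i \<in> N") auto

lemma weight_lipschitz: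
  assumes xy: "0 \<le> x" "x \<le> 1" "0 \<le> y" "y \<le> 1"
  shows "\<bar>w i x - w i y\<bar> \<le> D * exp (2 * D) * len i * \<bar>x - y\<bar>"
proof (cases "i \<in> N")
  case True
  have *: "w i x - w i y \<le> D * exp (2 * D) * len i * \<bar>x - y\<bar>"
    if xy: "0 \<le> x" "x \<le> 1" "0 \<le> y" "y \<le> 1" for x y
    using increment_le_of_ratio[OF distortion[OF True xy] D_nonneg _ _ weight_nonneg[OF xy(3,4)]
        weight_le_len[OF xy(3,4)]] xy unfolding mult_2 exp_add by (simp add: mult_ac)
  show ?thesis using *[OF xy] *[OF xy(3,4,1,2)] by (simp add: abs_le_iff abs_minus_commute)
qed (simp add: weight_zero len_def)

lemma continuous_weight: "continuous_on {0..1} (w i)"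
proof (rule lipschitz_on_continuous_on)
  show "(D * exp (2 * D) * len i)-lipschitz_on {0..1} (w i)"
    using D_nonneg len_nonneg[of i]
    by (auto simp: lipschitz_on_def dist_real_def intro!: weight_lipschitz)
qed

lemma summable_weight: "\<lbrakk>0 \<le> y; y \<le> 1\<rbrakk> \<Longrightarrow> summable (\<lambda>i. w i y)"
  and suminf_weight_le: "\<lbrakk>0 \<le> y; y \<le> 1\<rbrakk> \<Longrightarrow> (\<Sum>i. w i y) \<le> exp D"
proof -
  assume y: "0 \<le> y" "y \<le> 1"
  have s: "summable (\<lambda>i. exp D * len i)" by (intro summable_mult summable_len)
  show s': "summable (\<lambda>i. w i y)"
    by (rule summable_comparison_test[OF _ s])
      (use weight_le_len[OF y] weight_nonneg[OF y] in auto)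
  have "(\<Sum>i. w i y) \<le> (\<Sum>i. exp D * len i)"
    by (intro suminf_le s s') (use weight_le_len[OF y] in auto)
  also have "\<dots> \<le> exp D" using suminf_len_le by (simp add: suminf_mult[OF summable_len])
  finally show "(\<Sum>i. w i y) \<le> exp D" .
qed

lemma inj_branches:
  assumes "i \<in> N" "j \<in> N" "a i < x" "x < b i" "a j < x" "x < b j" shows "i = j"
  using disjoint assms unfolding disjoint_family_on_def by fastforce

lemma open_intervals: "(\<Union>i\<in>N. {a i<..<b i}) \<in> sets lebesgue"
  by (intro sets.countable_UN') auto

text \<open>Preimages are unions of images under the inverse branches, which are differentiable.\<close>

lemma vimage_eq: "A \<subseteq> {0<..<1} \<Longrightarrow>
    {x \<in> (\<Union>i\<in>N. {a i<..<b i}). f x \<in> A} = (\<Union>i\<in>N. \<gamma> i ` A)"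
proof (intro set_eqI iffI)
  fix x assume A: "A \<subseteq> {0<..<1}" and "x \<in> {x \<in> (\<Union>i\<in>N. {a i<..<b i}). f x \<in> A}"
  then obtain i where "i \<in> N" "a i < x" "x < b i" "f x \<in> A" by auto
  then show "x \<in> (\<Union>i\<in>N. \<gamma> i ` A)" using left_inverse[of i x] by (metis UN_iff image_eqI)
next
  fix x assume A: "A \<subseteq> {0<..<1}" and "x \<in> (\<Union>i\<in>N. \<gamma> i ` A)"
  then obtain i y where "i \<in> N" "y \<in> A" "x = \<gamma> i y" by auto
  then show "x \<in> {x \<in> (\<Union>i\<in>N. {a i<..<b i}). f x \<in> A}"
    using right_inverse[of i y] inverse_branch_interior[of i y] A by (auto intro!: bexI[of _ i])
qed

lemma differentiable_inverse_branch: "i \<in> N \<Longrightarrow> \<gamma> i differentiable_on {0<..<1}"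
  using deriv[of i] real_differentiable_def differentiable_at_withinI
  unfolding differentiable_on_def by (metis greaterThanLessThan_iff)

lemma vimage_sets:
  assumes A: "A \<in> sets lebesgue" "A \<subseteq> {0<..<1}"
  shows "{x \<in> (\<Union>i\<in>N. {a i<..<b i}). f x \<in> A} \<in> sets lebesgue"
  unfolding vimage_eq[OF A(2)]
proof (intro sets.countable_UN')
  show "(\<lambda>i. \<gamma> i ` A) ` N \<subseteq> sets lebesgue"
    using A differentiable_on_subset[OF differentiable_inverse_branch A(2)]
    by (auto intro!: differentiable_image_in_sets_lebesgue)
qed auto

lemma vimage_null:
  assumes A: "A \<in> null_sets lebesgue" "A \<subseteq> {0<..<1}"
  shows "{x \<in> (\<Union>i\<in>N. {a i<..<b i}). f x \<in> A} \<in> null_sets lebesgue"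
proof -
  have "negligible (\<gamma> i ` A)" if "i \<in> N" for i
    using A differentiable_on_subset[OF differentiable_inverse_branch[OF that] A(2)]
    by (intro negligible_differentiable_image_negligible) (auto simp: negligible_iff_null_sets)
  then show ?thesis
    unfolding vimage_eq[OF A(2)]
    by (intro null_sets_UN') (auto simp: negligible_iff_null_sets)
qed

end

text \<open>For a composition, the contraction may be much better than the product of the two bounds; it is
  computed in the interior, where the weights are reciprocal derivatives.\<close>

lemma (in full_branch_system) improve_contraction:
  assumes "0 < \<theta>'" and "\<And>i y. \<lbrakk>i \<in> N; 0 < y; y < 1\<rbrakk> \<Longrightarrow> w i y \<le> \<theta>'"
  shows "full_branch_system N a b f \<sigma> \<gamma> w \<theta>' D"
proof
  fix i and y :: real assume i: "i \<in> N" and y: "0 \<le> y" "y \<le> 1"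
  show "w i y \<le> \<theta>'" by (rule continuous_on_unit_le[OF continuous_weight assms(2)[OF i] y])
qed (use assms(1) partition D_nonneg sign cont deriv image right_inverse weight_pos distortion
      weight_zero in auto)

lemma (in full_branch_system) inverse_branch_strict:
  assumes i: "i \<in> N" and xy: "0 \<le> x" "x < y" "y \<le> 1"
  shows "0 < \<sigma> i * (\<gamma> i y - \<gamma> i x)"
proof -
  obtain \<xi> where "x < \<xi>" "\<xi> < y" "\<sigma> i * (\<gamma> i y - \<gamma> i x) = (y - x) * w i \<xi>"
    using mean_value[OF i xy] .
  then show ?thesis using weight_pos[OF i, of \<xi>] xy by auto
qed

lemma (in full_branch_system) image_subinterval:
  assumes i: "i \<in> N" and pq: "0 \<le> p" "p < q" "q \<le> 1"
  shows "\<gamma> i ` {p<..<q} = {min (\<gamma> i p) (\<gamma> i q)<..<max (\<gamma> i p) (\<gamma> i q)}"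
proof (intro set_eqI iffI)
  fix z assume "z \<in> \<gamma> i ` {p<..<q}"
  then obtain y where y: "p < y" "y < q" "z = \<gamma> i y" by auto
  then show "z \<in> {min (\<gamma> i p) (\<gamma> i q)<..<max (\<gamma> i p) (\<gamma> i q)}"
    using inverse_branch_strict[OF i, of p y] inverse_branch_strict[OF i, of y q] pq sign[OF i]
    by (auto simp: min_def max_def)
next
  fix z assume z: "z \<in> {min (\<gamma> i p) (\<gamma> i q)<..<max (\<gamma> i p) (\<gamma> i q)}"
  have c: "continuous_on {p..q} (\<gamma> i)"
    by (rule continuous_on_subset[OF cont[OF i]]) (use pq in auto)
  have "\<exists>y. p \<le> y \<and> y \<le> q \<and> \<gamma> i y = z"
    using z pq IVT'[of "\<gamma> i" p z q, OF _ _ _ c] IVT2'[of "\<gamma> i" q z p, OF _ _ _ c]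
    by (cases "\<gamma> i p \<le> \<gamma> i q") auto
  then obtain y where y: "p \<le> y" "y \<le> q" "\<gamma> i y = z" by blast
  then have "y \<noteq> p" "y \<noteq> q" using z by auto
  then show "z \<in> \<gamma> i ` {p<..<q}" using y by auto
qed

lemma (in full_branch_system) weaken_distortion:
  assumes "D \<le> D'" shows "full_branch_system N a b f \<sigma> \<gamma> w \<theta> D'"
proof
  fix i and x y :: real assume i: "i \<in> N" and xy: "0 \<le> x" "x \<le> 1" "0 \<le> y" "y \<le> 1"
  have "w i x \<le> exp (D * \<bar>x - y\<bar>) * w i y" by (rule distortion[OF i xy])
  also have "\<dots> \<le> exp (D' * \<bar>x - y\<bar>) * w i y"
    using assms weight_nonneg[of y i] xy by (intro mult_right_mono) (auto intro: mult_right_mono)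
  finally show "w i x \<le> exp (D' * \<bar>x - y\<bar>) * w i y" .
qed (use assms partition D_nonneg theta_pos sign cont deriv image right_inverse weight_pos weight_le
      weight_zero in auto)

text \<open>Endpoints of \<open>\<gamma> i\<close> applied to \<open>(c j, d j)\<close>, with \<open>n\<close> the code of \<open>(i, j)\<close>; minimum and maximum are
  needed because \<open>\<gamma> i\<close> may reverse orientation.\<close>

definition pair_left :: "(nat \<Rightarrow> real \<Rightarrow> real) \<Rightarrow> (nat \<Rightarrow> real) \<Rightarrow> (nat \<Rightarrow> real) \<Rightarrow> nat \<Rightarrow> real" where
  "pair_left \<gamma> c d n = (let (i, j) = prod_decode n in min (\<gamma> i (c j)) (\<gamma> i (d j)))"

definition pair_right :: "(nat \<Rightarrow> real \<Rightarrow> real) \<Rightarrow> (nat \<Rightarrow> real) \<Rightarrow> (nat \<Rightarrow> real) \<Rightarrow> nat \<Rightarrow> real" where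
  "pair_right \<gamma> c d n = (let (i, j) = prod_decode n in max (\<gamma> i (c j)) (\<gamma> i (d j)))"

text \<open>The branches of \<open>h \<circ> f\<close> are indexed by pairs of branches. A branch of \<open>f\<close> sees points of
  the domain of \<open>h\<close> only through a \<open>\<theta>'\<close>-contraction, hence the distortion \<open>D * \<theta>' + D'\<close>.\<close>

lemma full_branch_compose:
  assumes A: "full_branch_system N a b f \<sigma> \<gamma> w \<theta> D"
    and B: "full_branch_system M c d h \<tau> \<eta> k \<theta>' D'"
  shows "full_branch_system {n. fst (prod_decode n) \<in> N \<and> snd (prod_decode n) \<in> M}
      (pair_left \<gamma> c d) (pair_right \<gamma> c d)
      (h \<circ> f) (\<lambda>n. \<sigma> (fst (prod_decode n)) * \<tau> (snd (prod_decode n)))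
      (\<lambda>n y. \<gamma> (fst (prod_decode n)) (\<eta> (snd (prod_decode n)) y))
      (\<lambda>n y. w (fst (prod_decode n)) (\<eta> (snd (prod_decode n)) y) * k (snd (prod_decode n)) y)
      (\<theta> * \<theta>') (D * \<theta>' + D')"
    (is "full_branch_system ?N ?a ?b _ _ ?\<gamma> ?w _ _")
proof -
  interpret A: full_branch_system N a b f \<sigma> \<gamma> w \<theta> D by fact
  interpret B: full_branch_system M c d h \<tau> \<eta> k \<theta>' D' by fact
  let ?i = "\<lambda>n. fst (prod_decode n)" and ?j = "\<lambda>n. snd (prod_decode n)"
  have ends: "?a n = min (\<gamma> (?i n) (c (?j n))) (\<gamma> (?i n) (d (?j n)))"
    "?b n = max (\<gamma> (?i n) (c (?j n))) (\<gamma> (?i n) (d (?j n)))" for n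
    by (simp_all add: pair_left_def pair_right_def case_prod_beta)
  have sub: "\<gamma> (?i n) ` {c (?j n)<..<d (?j n)} = {?a n<..<?b n}" if "n \<in> ?N" for n
    using A.image_subinterval[of "?i n" "c (?j n)" "d (?j n)"] B.interval[of "?j n"] that
    unfolding ends by auto
  show ?thesis
  proof
    show "interval_partition ?N ?a ?b"
      unfolding interval_partition_def
    proof (intro conjI ballI)
      fix n assume n: "n \<in> ?N"
      have cd: "0 \<le> c (?j n)" "c (?j n) < d (?j n)" "d (?j n) \<le> 1" using B.interval[of "?j n"] n by auto
      show "0 \<le> ?a n" "?b n \<le> 1"
        using A.inverse_branch_unit[of "?i n" "c (?j n)"] A.inverse_branch_unit[of "?i n" "d (?j n)"] n cd
        by (auto simp: ends)
      have "\<gamma> (?i n) (c (?j n)) \<noteq> \<gamma> (?i n) (d (?j n))"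
        using A.inverse_branch_strict[of "?i n" "c (?j n)" "d (?j n)"] n cd by auto
      then show "?a n < ?b n" by (auto simp: ends min_def max_def)
    next
      show "disjoint_family_on (\<lambda>n. {?a n<..<?b n}) ?N"
        unfolding disjoint_family_on_def
      proof (intro ballI impI, rule ccontr)
        fix m n assume mn: "m \<in> ?N" "n \<in> ?N" "m \<noteq> n" "{?a m<..<?b m} \<inter> {?a n<..<?b n} \<noteq> {}"
        then obtain x where "x \<in> \<gamma> (?i m) ` {c (?j m)<..<d (?j m)}" "x \<in> \<gamma> (?i n) ` {c (?j n)<..<d (?j n)}"
          unfolding sub[OF mn(1)] sub[OF mn(2)] by blast
        then obtain u v where "x = \<gamma> (?i m) u" "u \<in> {c (?j m)<..<d (?j m)}"
          "x = \<gamma> (?i n) v" "v \<in> {c (?j n)<..<d (?j n)}" by blast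
        then have uv: "x = \<gamma> (?i m) u" "c (?j m) < u" "u < d (?j m)"
          "x = \<gamma> (?i n) v" "c (?j n) < v" "v < d (?j n)" by simp_all
        have u: "0 < u" "u < 1" and v: "0 < v" "v < 1"
          using uv B.interval[of "?j m"] B.interval[of "?j n"] mn by auto
        have ij: "?i m = ?i n"
          using A.inj_branches[of "?i m" "?i n" x] A.inverse_branch_interior[of "?i m" u]
            A.inverse_branch_interior[of "?i n" v] uv u v mn by auto
        then have "u = v"
          using A.right_inverse[of "?i m" u] A.right_inverse[of "?i n" v] uv u v mn by auto
        then have "?j m = ?j n" using B.inj_branches[of "?j m" "?j n" u] uv mn by auto
        with ij have "prod_decode m = prod_decode n" by (simp add: prod_eq_iff)
        then show False using mn(3) by (metis prod_decode_inverse)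
      qed
    next
      let ?E = "{0<..<1} - (\<Union>j\<in>M. {c j<..<d j})"
      have "negligible ({0..1} - (\<Union>j\<in>M. {c j<..<d j}))"
        using B.null_rest by (simp add: negligible_iff_null_sets)
      then have "negligible ?E" by (rule negligible_subset) auto
      then have "negligible {x \<in> (\<Union>i\<in>N. {a i<..<b i}). f x \<in> ?E}"
        using A.vimage_null[of ?E] by (auto simp: negligible_iff_null_sets)
      moreover have "negligible ({0..1} - (\<Union>i\<in>N. {a i<..<b i}))"
        using A.null_rest by (simp add: negligible_iff_null_sets)
      ultimately have "negligible (({0..1} - (\<Union>i\<in>N. {a i<..<b i}))
          \<union> {x \<in> (\<Union>i\<in>N. {a i<..<b i}). f x \<in> ?E})" by (rule negligible_Un[rotated])
      moreover have "{0..1} - (\<Union>n\<in>?N. {?a n<..<?b n}) \<subseteq> ({0..1} - (\<Union>i\<in>N. {a i<..<b i}))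
          \<union> {x \<in> (\<Union>i\<in>N. {a i<..<b i}). f x \<in> ?E}"
      proof
        fix x assume x: "x \<in> {0..1} - (\<Union>n\<in>?N. {?a n<..<?b n})"
        have "f x \<in> ?E" if i: "i \<in> N" "a i < x" "x < b i" for i
        proof -
          have l: "0 < f x" "f x < 1" "\<gamma> i (f x) = x" using A.left_inverse[OF i] by auto
          have "f x \<notin> {c j<..<d j}" if j: "j \<in> M" for j
          proof
            assume "f x \<in> {c j<..<d j}"
            then have "x \<in> \<gamma> i ` {c j<..<d j}" using l(3) by (metis image_eqI)
            moreover have n: "prod_encode (i, j) \<in> ?N" using i j by simp
            ultimately have "x \<in> {?a (prod_encode (i, j))<..<?b (prod_encode (i, j))}"
              using sub[OF n] by simp
            then show False using x n by blast
          qed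
          then show ?thesis using l by auto
        qed
        then show "x \<in> ({0..1} - (\<Union>i\<in>N. {a i<..<b i}))
          \<union> {x \<in> (\<Union>i\<in>N. {a i<..<b i}). f x \<in> ?E}" using x by auto
      qed
      ultimately have "negligible ({0..1} - (\<Union>n\<in>?N. {?a n<..<?b n}))" by (rule negligible_subset)
      then show "{0..1} - (\<Union>n\<in>?N. {?a n<..<?b n}) \<in> null_sets lebesgue"
        by (simp add: negligible_iff_null_sets)
    qed
  next
    show "0 < \<theta> * \<theta>'" using A.theta_pos B.theta_pos by simp
    show "0 \<le> D * \<theta>' + D'" using A.D_nonneg B.D_nonneg B.theta_pos by simp
  next
    fix n assume n: "n \<in> ?N"
    then have i: "?i n \<in> N" and j: "?j n \<in> M" by auto
    show "\<sigma> (?i n) * \<tau> (?j n) = 1 \<or> \<sigma> (?i n) * \<tau> (?j n) = -1"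
      using A.sign[OF i] B.sign[OF j] by auto
    show "continuous_on {0..1} (?\<gamma> n)"
      using B.inverse_branch_unit[OF j]
      by (intro continuous_on_compose2[OF A.cont[OF i] B.cont[OF j]]) auto
    have "?\<gamma> n ` {0<..<1} = \<gamma> (?i n) ` (\<eta> (?j n) ` {0<..<1})" by (simp add: image_image)
    then show "?\<gamma> n ` {0<..<1} = {?a n<..<?b n}"
      using sub[OF n] B.image[OF j] by (simp only:)
  next
    fix n and y :: real assume n: "n \<in> ?N" and y: "0 < y" "y < 1"
    then have i: "?i n \<in> N" and j: "?j n \<in> M" by auto
    have e: "0 < \<eta> (?j n) y" "\<eta> (?j n) y < 1"
      using B.inverse_branch_interior[OF j y] B.interval[OF j] by auto
    show "(?\<gamma> n has_real_derivative \<sigma> (?i n) * \<tau> (?j n) * ?w n y) (at y)"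
      using DERIV_chain2[OF A.deriv[OF i e] B.deriv[OF j y]] by (simp add: algebra_simps)
    show "(h \<circ> f) (?\<gamma> n y) = y"
      using A.right_inverse[OF i e] B.right_inverse[OF j y] by simp
  next
    fix n and y :: real assume n: "n \<in> ?N" and y: "0 \<le> y" "y \<le> 1"
    then have i: "?i n \<in> N" and j: "?j n \<in> M" by auto
    have e: "0 \<le> \<eta> (?j n) y" "\<eta> (?j n) y \<le> 1" using B.inverse_branch_unit[OF j y] by auto
    show "0 < ?w n y" using A.weight_pos[OF i e] B.weight_pos[OF j y] by simp
    show "?w n y \<le> \<theta> * \<theta>'"
      using A.weight_pos[OF i e] B.weight_pos[OF j y] A.weight_le[OF i e] B.weight_le[OF j y]
      by (intro mult_mono) auto
  next
    fix n and x y :: real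
    assume n: "n \<in> ?N" and x: "0 \<le> x" "x \<le> 1" and y: "0 \<le> y" "y \<le> 1"
    then have i: "?i n \<in> N" and j: "?j n \<in> M" by auto
    have e: "0 \<le> \<eta> (?j n) x" "\<eta> (?j n) x \<le> 1" "0 \<le> \<eta> (?j n) y" "\<eta> (?j n) y \<le> 1"
      using B.inverse_branch_unit[OF j] x y by auto
    have "?w n x \<le> (exp (D * \<bar>\<eta> (?j n) x - \<eta> (?j n) y\<bar>) * w (?i n) (\<eta> (?j n) y))
        * (exp (D' * \<bar>x - y\<bar>) * k (?j n) y)"
      using A.distortion[OF i e] B.distortion[OF j x y] A.weight_pos[OF i e(3,4)]
        B.weight_pos[OF j x]
      by (intro mult_mono) auto
    also have "\<dots> \<le> (exp (D * (\<theta>' * \<bar>x - y\<bar>)) * w (?i n) (\<eta> (?j n) y))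
        * (exp (D' * \<bar>x - y\<bar>) * k (?j n) y)"
      using B.inverse_branch_lipschitz[OF j x y] A.weight_pos[OF i e(3,4)] B.weight_pos[OF j y]
        A.D_nonneg
      by (intro mult_right_mono) (auto intro: mult_left_mono)
    also have "\<dots> = exp ((D * \<theta>' + D') * \<bar>x - y\<bar>) * ?w n y"
      by (simp add: exp_add algebra_simps)
    finally show "?w n x \<le> exp ((D * \<theta>' + D') * \<bar>x - y\<bar>) * ?w n y" .
  next
    fix n y assume "n \<notin> ?N"
    then show "?w n y = 0" using A.weight_zero B.weight_zero by auto
  qed
qed

text \<open>The distortion of each further factor is damped by the contraction of the preceding power, and
  the total is a geometric sum.\<close>

lemma full_branch_power:
  assumes A: "full_branch_system N a b f \<sigma> \<gamma> w \<theta> D" and "\<theta> < 1" and "1 \<le> m"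
  shows "\<exists>M c d \<tau> \<eta> k. full_branch_system M c d (f ^^ m) \<tau> \<eta> k (\<theta> ^ m) (D / (1 - \<theta>))"
proof -
  interpret A: full_branch_system N a b f \<sigma> \<gamma> w \<theta> D by fact
  have "\<exists>M c d \<tau> \<eta> k. full_branch_system M c d (f ^^ m) \<tau> \<eta> k (\<theta> ^ m) (D * (\<Sum>l<m. \<theta> ^ l))"
    using \<open>1 \<le> m\<close>
  proof (induction m rule: dec_induct)
    case base
    then show ?case using A by (simp, blast)
  next
    case (step n)
    then obtain M c d \<tau> \<eta> k
      where B: "full_branch_system M c d (f ^^ n) \<tau> \<eta> k (\<theta> ^ n) (D * (\<Sum>l<n. \<theta> ^ l))" by blast
    have e: "f ^^ n \<circ> f = f ^^ Suc n" by (simp add: funpow_Suc_right del: funpow.simps)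
    have e': "D * \<theta> ^ n + D * (\<Sum>l<n. \<theta> ^ l) = D * (\<Sum>l<Suc n. \<theta> ^ l)"
      by (simp add: algebra_simps)
    show ?case using full_branch_compose[OF A B] unfolding e e' power_Suc by blast
  qed
  moreover have "D * (\<Sum>l<m. \<theta> ^ l) \<le> D / (1 - \<theta>)"
  proof -
    have "(\<Sum>l<m. \<theta> ^ l) = (1 - \<theta> ^ m) / (1 - \<theta>)" using \<open>\<theta> < 1\<close> by (simp add: sum_gp_strict)
    also have "\<dots> \<le> 1 / (1 - \<theta>)" using A.theta_pos \<open>\<theta> < 1\<close> by (intro divide_right_mono) auto
    finally show ?thesis using A.D_nonneg mult_left_mono by fastforce
  qed
  ultimately show ?thesis using full_branch_system.weaken_distortion by blast
qed

section \<open>The transfer operator\<close>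

lemma AE_leb01_iff: "(AE x in leb01. P x) \<longleftrightarrow> {x\<in>{0..1}. \<not> P x} \<in> null_sets lebesgue"
proof -
  have "(AE x in leb01. P x) \<longleftrightarrow> (AE x in lebesgue. x \<in> {0..1} \<longrightarrow> P x)"
    by (simp add: AE_restrict_space_iff)
  also have "\<dots> \<longleftrightarrow> negligible {x\<in>{0..1}. \<not> P x}"
  proof -
    have "(\<exists>n\<in>null_sets lebesgue. S \<subseteq> n) \<longleftrightarrow> negligible S" for S :: "real set"
      unfolding negligible_iff_null_sets[symmetric, of S]
      by (metis negligible_iff_null_sets negligible_subset order_refl)
    moreover have "{x. \<not> (x \<in> {0..1} \<longrightarrow> P x)} = {x\<in>{0..1}. \<not> P x}" by auto
    ultimately show ?thesis by (simp add: eventually_ae_filter)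
  qed
  finally show ?thesis by (simp add: negligible_iff_null_sets)
qed

text \<open>The property that determines \<open>frobenius_perron f h\<close> up to null sets. As a relation it
  composes along compositions of maps, whatever representatives are chosen.\<close>

definition is_transfer :: "(real \<Rightarrow> real) \<Rightarrow> (real \<Rightarrow> real) \<Rightarrow> (real \<Rightarrow> real) \<Rightarrow> bool" where
  "is_transfer f h k \<longleftrightarrow> integrable leb01 k \<and>
     (\<forall>\<phi> \<in> borel_measurable leb01. (\<exists>B. AE x in leb01. \<bar>\<phi> x\<bar> \<le> B) \<longrightarrow>
        (LINT x|leb01. \<phi> x * k x) = (LINT x|leb01. \<phi> (f x) * h x))"

context full_branch_system
begin

lemma AE_interval: "AE x in leb01. x \<in> (\<Union>i\<in>N. {a i<..<b i})"
  using null_rest unfolding AE_leb01_iff by (simp add: set_diff_eq)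

lemma AE_comp:
  assumes "AE x in leb01. P x" shows "AE x in leb01. P (f x)"
proof -
  have "negligible {x\<in>{0..1}. \<not> P x}" using assms unfolding AE_leb01_iff negligible_iff_null_sets .
  then have "negligible {x\<in>{0<..<1}. \<not> P x}" by (rule negligible_subset) auto
  then have "{x \<in> (\<Union>i\<in>N. {a i<..<b i}). f x \<in> {x\<in>{0<..<1}. \<not> P x}} \<in> null_sets lebesgue"
    by (intro vimage_null) (auto simp: negligible_iff_null_sets)
  then have "AE x in leb01. x \<in> (\<Union>i\<in>N. {a i<..<b i}) \<longrightarrow> P (f x)"
    unfolding AE_leb01_iff negligible_iff_null_sets[symmetric]
    by (rule negligible_subset) (use left_inverse in auto)
  then show ?thesis using AE_interval by eventually_elim simp
qed

text \<open>Composition on the right preserves measurability for the completed \<open>\<sigma>\<close>-algebra because the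
  inverse branches map Lebesgue sets to Lebesgue sets.\<close>

lemma comp_measurable:
  fixes \<phi> :: "real \<Rightarrow> real"
  assumes \<phi>: "\<phi> \<in> borel_measurable leb01" shows "(\<lambda>x. \<phi> (f x)) \<in> borel_measurable leb01"
proof (rule measurableI)
  fix B :: "real set" assume B: "B \<in> sets borel"
  have "\<phi> -` B \<inter> {0..1} \<in> sets lebesgue"
    using measurable_sets[OF \<phi> B] by (simp add: sets_restrict_space_iff)
  then have "(\<phi> -` B \<inter> {0..1}) \<inter> {0<..<1} \<in> sets lebesgue" by (rule sets.Int) simp
  then have s: "{x \<in> (\<Union>i\<in>N. {a i<..<b i}). f x \<in> (\<phi> -` B \<inter> {0..1}) \<inter> {0<..<1}} \<in> sets lebesgue"
    by (rule vimage_sets) auto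
  have "negligible ({x. \<phi> (f x) \<in> B} \<inter> ({0..1} - (\<Union>i\<in>N. {a i<..<b i})))"
    using null_rest by (intro negligible_Int) (auto simp: negligible_iff_null_sets)
  then have n: "{x. \<phi> (f x) \<in> B} \<inter> ({0..1} - (\<Union>i\<in>N. {a i<..<b i})) \<in> sets lebesgue"
    by (rule negligible_imp_sets)
  have "(\<lambda>x. \<phi> (f x)) -` B \<inter> space leb01 =
     ({x. \<phi> (f x) \<in> B} \<inter> ({0..1} - (\<Union>i\<in>N. {a i<..<b i}))) \<union>
     {x \<in> (\<Union>i\<in>N. {a i<..<b i}). f x \<in> (\<phi> -` B \<inter> {0..1}) \<inter> {0<..<1}}"
    using left_inverse interval by (fastforce simp: less_imp_le)
  also have "\<dots> \<in> sets lebesgue" by (intro sets.Un n s)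
  finally show "(\<lambda>x. \<phi> (f x)) -` B \<inter> space leb01 \<in> sets leb01"
    by (simp add: sets_restrict_space_iff)
qed simp

end

lemma integrable_leb01_iff:
  fixes u :: "real \<Rightarrow> real" shows "integrable leb01 u \<longleftrightarrow> u absolutely_integrable_on {0..1}"
  by (simp add: integrable_restrict_space set_integrable_def)

lemma integral_leb01:
  fixes u :: "real \<Rightarrow> real" assumes "integrable leb01 u"
  shows "(LINT x|leb01. u x) = integral {0..1} u"
  using lebesgue_integral_eq_integral[OF assms] by simp

lemma absolutely_integrable_on_unit_open:
  fixes u :: "real \<Rightarrow> real"
  shows "u absolutely_integrable_on {0<..<1} \<longleftrightarrow> u absolutely_integrable_on {0..1}"
proof (rule absolutely_integrable_spike_set_eq)
  show "negligible {x \<in> {0<..<1} - {0..1}. u x \<noteq> 0}" by (rule negligible_subset[of "{}"]) auto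
  show "negligible {x \<in> {0..1} - {0<..<1}. u x \<noteq> 0}" by (rule negligible_subset[of "{0, 1}"]) auto
qed

lemma leb01_measurable_AE:
  fixes u v :: "real \<Rightarrow> real"
  assumes u: "u \<in> borel_measurable leb01" and uv: "AE x in leb01. u x = v x"
  shows "v \<in> borel_measurable leb01"
proof -
  have "(\<lambda>x. if x \<in> {0..1} then u x else 0) \<in> borel_measurable lebesgue"
    using u by (subst borel_measurable_if) auto
  moreover have "AE x in lebesgue. (if x \<in> {0..1} then u x else 0) = (if x \<in> {0..1} then v x else 0)"
    using uv by (subst (asm) AE_restrict_space_iff) (auto elim: AE_mp)
  ultimately have "(\<lambda>x. if x \<in> {0..1} then v x else 0) \<in> borel_measurable lebesgue"
    by (rule borel_measurable_AE)
  then show ?thesis by (subst (asm) borel_measurable_if) auto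
qed

lemma emeasure_leb01 [simp]: "emeasure leb01 {0..1} = 1"
  by (simp add: emeasure_restrict_space)

lemma finite_measure_leb01: "finite_measure leb01"
  by (rule finite_measureI) (simp add: emeasure_restrict_space)

lemma integrable_leb01_bounded:
  fixes u :: "real \<Rightarrow> real"
  assumes "u \<in> borel_measurable leb01" "AE x in leb01. \<bar>u x\<bar> \<le> B"
  shows "integrable leb01 u"
  using finite_measure.integrable_const_bound[OF finite_measure_leb01, of u B] assms by simp

lemma measure_leb01 [simp]: "measure leb01 {0..1} = 1"
  by (simp add: measure_def)

lemma LINT_leb01_const [simp]: "(LINT x|leb01. c) = (c::real)"
  by simp

lemma AE_leb01_mem: "AE x in leb01. x \<in> {0..1}"
  by (rule AE_I2) simp

lemma abs_LINT_leb01_le: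
  fixes u :: "real \<Rightarrow> real"
  assumes "u \<in> borel_measurable leb01" "AE x in leb01. \<bar>u x\<bar> \<le> B"
  shows "(LINT x|leb01. \<bar>u x\<bar>) \<le> B"
proof -
  have "integrable leb01 u" by (rule integrable_leb01_bounded[OF assms])
  then have "(LINT x|leb01. \<bar>u x\<bar>) \<le> (LINT x|leb01. B)"
    using assms(2) finite_measure_leb01
    by (intro integral_mono_AE) (auto intro: finite_measure.integrable_const)
  then show ?thesis by simp
qed

context full_branch_system
begin

lemma branch_change_of_variables:
  assumes i: "i \<in> N" and u: "integrable leb01 u"
  shows "integrable leb01 (\<lambda>y. u (\<gamma> i y) * w i y)"
    and "(LINT y|leb01. u (\<gamma> i y) * w i y) = (LINT x|leb01. indicator {a i<..<b i} x * u x)"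
proof -
  let ?I = "{a i<..<b i}" and ?F = "\<lambda>y. \<bar>\<sigma> i * w i y\<bar> * u (\<gamma> i y)"
  have I: "?I \<subseteq> {0..1}" using interval[OF i] by auto
  have uI: "u absolutely_integrable_on ?I"
    using set_integrable_subset[OF u[unfolded integrable_leb01_iff] _ I] by simp
  have sub: "{0<..<1} \<subseteq> {0..1::real}" by auto
  have cov: "?F absolutely_integrable_on {0<..<1} \<and> integral {0<..<1} ?F = integral ?I u"
    using has_absolute_integral_change_of_variables_1'[of "{0<..<1}" "\<gamma> i" "\<lambda>y. \<sigma> i * w i y" u
        "integral ?I u"] deriv[OF i] inj_on_subset[OF inj_inverse_branch[OF i] sub] uI
    unfolding image[OF i] by (auto simp: has_field_derivative_at_within)
  have F: "?F y = u (\<gamma> i y) * w i y" if "y \<in> {0..1}" for y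
    using sign[OF i] weight_nonneg[of y i] that by (auto simp: abs_mult)
  have iF: "integrable leb01 ?F"
    using cov absolutely_integrable_on_unit_open[of ?F] by (simp add: integrable_leb01_iff)
  moreover have "integrable leb01 ?F \<longleftrightarrow> integrable leb01 (\<lambda>y. u (\<gamma> i y) * w i y)"
    by (rule Bochner_Integration.integrable_cong) (use F in auto)
  ultimately show "integrable leb01 (\<lambda>y. u (\<gamma> i y) * w i y)" by blast
  have "(LINT y|leb01. u (\<gamma> i y) * w i y) = (LINT y|leb01. ?F y)"
    by (rule Bochner_Integration.integral_cong[OF refl], rule F[symmetric]) simp
  also have "\<dots> = integral {0..1} ?F" by (rule integral_leb01[OF iF])
  also have "\<dots> = integral {0<..<1} ?F"
    using integral_open_interval_real[of 0 1 ?F] by simp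
  also have "\<dots> = (LINT x:?I|lebesgue. u x)"
    using cov set_lebesgue_integral_eq_integral(2)[OF uI] by simp
  also have "\<dots> = (LINT x|leb01. indicator ?I x * u x)"
    unfolding set_lebesgue_integral_def
    by (subst integral_restrict_space, simp, rule Bochner_Integration.integral_cong)
      (use I in \<open>auto simp: indicator_def\<close>)
  finally show "(LINT y|leb01. u (\<gamma> i y) * w i y) = (LINT x|leb01. indicator ?I x * u x)" .
qed

text \<open>The series over inverse branches; for bounded \<open>h\<close> it converges at every point of \<open>[0, 1]\<close>,
  so that it is a definite representative whose variation can be estimated.\<close>

definition transfer :: "(real \<Rightarrow> real) \<Rightarrow> real \<Rightarrow> real" where
  "transfer h y = (\<Sum>i. h (\<gamma> i y) * w i y)"

lemma transfer_term_le:
  assumes "\<forall>x\<in>{0..1}. \<bar>h x\<bar> \<le> B" and y: "0 \<le> y" "y \<le> 1"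
  shows "\<bar>h (\<gamma> i y) * w i y\<bar> \<le> B * w i y"
proof (cases "i \<in> N")
  case True
  then show ?thesis
    using bspec[OF assms(1), of "\<gamma> i y"] inverse_branch_unit[OF True y] weight_nonneg[OF y, of i]
    by (auto simp: abs_mult intro: mult_right_mono)
qed (simp add: weight_zero)

lemma transfer_summable:
  assumes "\<forall>x\<in>{0..1}. \<bar>h x\<bar> \<le> B" and y: "0 \<le> y" "y \<le> 1"
  shows "summable (\<lambda>i. h (\<gamma> i y) * w i y)"
  by (rule summable_comparison_test[OF _ summable_mult[OF summable_weight[OF y], of B]])
    (use transfer_term_le[OF assms] in auto)

lemma transfer_abs_le:
  assumes h: "\<forall>x\<in>{0..1}. \<bar>h x\<bar> \<le> B" and y: "0 \<le> y" "y \<le> 1"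
  shows "\<bar>transfer h y\<bar> \<le> B * exp D"
proof -
  have s: "summable (\<lambda>i. \<bar>h (\<gamma> i y) * w i y\<bar>)"
    by (rule summable_comparison_test[OF _ summable_mult[OF summable_weight[OF y], of B]])
      (use transfer_term_le[OF h y] in auto)
  have B: "0 \<le> B" using bspec[OF h, of 0] by simp
  have "\<bar>transfer h y\<bar> \<le> (\<Sum>i. \<bar>h (\<gamma> i y) * w i y\<bar>)"
    unfolding transfer_def by (rule summable_rabs[OF s])
  also have "\<dots> \<le> (\<Sum>i. B * w i y)"
    by (rule suminf_le[OF transfer_term_le[OF h y] s summable_mult[OF summable_weight[OF y]]])
  also have "\<dots> = B * (\<Sum>i. w i y)" by (rule suminf_mult[OF summable_weight[OF y]])
  also have "\<dots> \<le> B * exp D" using suminf_weight_le[OF y] B by (rule mult_left_mono)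
  finally show ?thesis .
qed

lemma transfer_cong:
  assumes "\<And>x. \<lbrakk>0 \<le> x; x \<le> 1\<rbrakk> \<Longrightarrow> h x = h' x" and y: "0 \<le> y" "y \<le> 1"
  shows "transfer h y = transfer h' y"
  unfolding transfer_def
proof (rule arg_cong[where f = suminf], rule ext)
  fix i show "h (\<gamma> i y) * w i y = h' (\<gamma> i y) * w i y"
    using assms(1)[of "\<gamma> i y"] inverse_branch_unit[OF _ y, of i] weight_zero[of i y]
    by (cases "i \<in> N") auto
qed

text \<open>Both sides of the defining identity are sums over the branches, and they agree branch by
  branch after substituting \<open>x = \<gamma> i y\<close>.\<close>

lemma is_transfer_transfer:
  assumes hm: "h \<in> borel_measurable leb01" and hB: "\<forall>x\<in>{0..1}. \<bar>h x\<bar> \<le> B"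
  shows "is_transfer f h (transfer h)"
proof -
  have B: "0 \<le> B" using bspec[OF hB, of 0] by simp
  have *: "integrable leb01 (\<lambda>y. \<phi> y * transfer h y) \<and>
      (LINT y|leb01. \<phi> y * transfer h y) = (LINT x|leb01. \<phi> (f x) * h x)"
    if \<phi>m: "\<phi> \<in> borel_measurable leb01" and \<phi>C: "AE x in leb01. \<bar>\<phi> x\<bar> \<le> C" for \<phi> C
  proof -
    define u where "u x = \<phi> (f x) * h x" for x
    define F where "F i y = u (\<gamma> i y) * w i y" for i y
    have um: "u \<in> borel_measurable leb01"
      unfolding u_def using comp_measurable[OF \<phi>m] hm by measurable
    have uB: "AE x in leb01. \<bar>u x\<bar> \<le> C * B"
      using AE_comp[OF \<phi>C] AE_leb01_mem
    proof eventually_elim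
      case (elim x)
      then show ?case using bspec[OF hB, of x] unfolding u_def abs_mult by (intro mult_mono) auto
    qed
    have u: "integrable leb01 u" by (rule integrable_leb01_bounded[OF um uB])
    have Fi: "integrable leb01 (F i)" for i
      using branch_change_of_variables(1)[OF _ u, of i] unfolding F_def
      by (cases "i \<in> N") (auto simp: weight_zero)
    have Feq: "AE y in leb01. \<forall>i. F i y = \<phi> y * (h (\<gamma> i y) * w i y)"
    proof -
      have "AE y in leb01. y \<noteq> 0 \<and> y \<noteq> 1 \<and> y \<in> {0..1}"
        unfolding AE_leb01_iff negligible_iff_null_sets[symmetric]
        by (rule negligible_subset[of "{0, 1}"]) auto
      then show ?thesis
      proof eventually_elim
        case (elim y)
        show ?case
        proof
          fix i show "F i y = \<phi> y * (h (\<gamma> i y) * w i y)"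
            using right_inverse[of i y] elim by (cases "i \<in> N") (auto simp: F_def u_def weight_zero)
        qed
      qed
    qed
    have Fle: "AE y in leb01. \<forall>i. \<bar>F i y\<bar> \<le> (C * (B * exp D)) * len i"
      using Feq \<phi>C AE_leb01_mem
    proof eventually_elim
      case (elim y)
      have C: "0 \<le> C" using elim(2) by linarith
      show ?case
      proof
        fix i
        have "\<bar>h (\<gamma> i y) * w i y\<bar> \<le> B * (exp D * len i)"
          using transfer_term_le[OF hB, of y i] weight_le_len[of y i] elim(3)
            mult_left_mono[OF weight_le_len[of y i] B] by auto
        then have "\<bar>\<phi> y\<bar> * \<bar>h (\<gamma> i y) * w i y\<bar> \<le> C * (B * (exp D * len i))"
          using elim(2) C by (intro mult_mono) auto
        then show "\<bar>F i y\<bar> \<le> (C * (B * exp D)) * len i"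
          using elim(1) by (simp add: abs_mult mult.assoc)
      qed
    qed
    have sm: "summable (\<lambda>i. (C * (B * exp D)) * len i)" by (intro summable_mult summable_len)
    have S1: "AE y in leb01. summable (\<lambda>i. norm (F i y))"
      using Fle by eventually_elim (rule summable_comparison_test[OF _ sm], auto)
    have S2: "summable (\<lambda>i. (LINT y|leb01. norm (F i y)))"
    proof (rule summable_comparison_test[OF _ sm], intro exI allI impI)
      fix i
      have "(LINT y|leb01. \<bar>F i y\<bar>) \<le> (C * (B * exp D)) * len i"
        by (rule abs_LINT_leb01_le) (use Fi[of i] Fle in auto)
      then show "norm (LINT y|leb01. norm (F i y)) \<le> (C * (B * exp D)) * len i"
        by simp
    qed
    have T: "AE y in leb01. (\<Sum>i. F i y) = \<phi> y * transfer h y"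
      using Feq AE_leb01_mem
    proof eventually_elim
      case (elim y)
      have "(\<Sum>i. F i y) = (\<Sum>i. \<phi> y * (h (\<gamma> i y) * w i y))" using elim(1) by simp
      also have "\<dots> = \<phi> y * transfer h y"
        unfolding transfer_def
        by (rule suminf_mult[OF transfer_summable[OF hB]]) (use elim(2) in auto)
      finally show ?case .
    qed
    note s1 = integrable_suminf[OF Fi S1 S2] and s2 = sums_integral[OF Fi S1 S2]
    have T': "(\<lambda>y. \<phi> y * transfer h y) \<in> borel_measurable leb01"
      by (rule leb01_measurable_AE[OF borel_measurable_integrable[OF s1] T])
    have iT: "integrable leb01 (\<lambda>y. \<phi> y * transfer h y)"
      by (rule integrable_cong_AE_imp[OF s1 T' T])
    have "(LINT y|leb01. \<phi> y * transfer h y) = (LINT y|leb01. (\<Sum>i. F i y))"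
      by (rule integral_cong_AE[OF T' borel_measurable_integrable[OF s1]])
        (use T in eventually_elim, simp)
    also have "\<dots> = (\<Sum>i. LINT y|leb01. F i y)" using s2 by (simp add: sums_iff)
    also have "\<dots> = (\<Sum>i. LINT x|leb01. (if i \<in> N then indicator {a i<..<b i} x else 0) * u x)"
    proof (rule arg_cong[where f = suminf], rule ext)
      fix i show "(LINT y|leb01. F i y)
          = (LINT x|leb01. (if i \<in> N then indicator {a i<..<b i} x else 0) * u x)"
        using branch_change_of_variables(2)[OF _ u, of i] unfolding F_def
        by (cases "i \<in> N") (auto simp: weight_zero)
    qed
    also have "\<dots> = (LINT x|leb01. (\<Sum>i. (if i \<in> N then indicator {a i<..<b i} x else 0) * u x))"
    proof (rule integral_suminf[symmetric])
      let ?g = "\<lambda>i x. (if i \<in> N then indicator {a i<..<b i} x else 0) * u x"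
      show ig: "integrable leb01 (?g i)" for i
      proof (cases "i \<in> N")
        case True
        then have "{a i<..<b i} \<in> sets leb01"
          using interval[OF True] by (subst sets_restrict_space_iff) auto
        from integrable_mult_indicator[OF this u] True show ?thesis by simp
      qed simp
      have single: "?g i x = 0" if "j \<in> N" "x \<in> {a j<..<b j}" "i \<notin> {j}" for i j x
        using that inj_branches[of i j x] by (auto simp: indicator_def)
      show "AE x in leb01. summable (\<lambda>i. norm (?g i x))"
        using AE_interval
      proof eventually_elim
        case (elim x)
        then obtain j where "j \<in> N" "x \<in> {a j<..<b j}" by blast
        then show ?case by (intro summable_finite[of "{j}"]) (auto simp: single)
      qed
      show "summable (\<lambda>i. LINT x|leb01. norm (?g i x))"
      proof (rule summableI_nonneg_bounded)
        fix n
        have "(\<Sum>i<n. LINT x|leb01. norm (?g i x)) = (LINT x|leb01. (\<Sum>i<n. norm (?g i x)))"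
          using ig by (intro Bochner_Integration.integral_sum[symmetric]) auto
        also have "\<dots> \<le> (LINT x|leb01. \<bar>u x\<bar>)"
        proof (rule integral_mono_AE)
          show "AE x in leb01. (\<Sum>i<n. norm (?g i x)) \<le> \<bar>u x\<bar>"
            using AE_interval
          proof eventually_elim
            case (elim x)
            then obtain j where j: "j \<in> N" "x \<in> {a j<..<b j}" by blast
            have "(\<Sum>i<n. norm (?g i x)) = (\<Sum>i\<in>{..<n} \<inter> {j}. norm (?g i x))"
              by (rule sum.mono_neutral_right) (use single[OF j] in auto)
            also have "\<dots> \<le> (\<Sum>i\<in>{j}. norm (?g i x))" by (rule sum_mono2) auto
            also have "\<dots> = \<bar>u x\<bar>" using j by (auto simp: indicator_def)
            finally show ?case .
          qed
        qed (use ig u in auto)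
        finally show "(\<Sum>i<n. LINT x|leb01. norm (?g i x)) \<le> (LINT x|leb01. \<bar>u x\<bar>)" .
      qed simp
    qed
    also have "\<dots> = (LINT x|leb01. u x)"
    proof -
      let ?g = "\<lambda>i x. (if i \<in> N then indicator {a i<..<b i} x else 0) * u x"
      have g: "AE x in leb01. u x = (\<Sum>i. ?g i x)"
        using AE_interval
      proof eventually_elim
        case (elim x)
        then obtain j where j: "j \<in> N" "x \<in> {a j<..<b j}" by blast
        have "(\<Sum>i. ?g i x) = (\<Sum>i\<in>{j}. ?g i x)"
        proof (rule suminf_finite)
          fix i assume "i \<notin> {j}"
          then show "?g i x = 0" using j inj_branches[of i j x] by (auto simp: indicator_def)
        qed simp
        then show ?case using j by (auto simp: indicator_def)
      qed
      show ?thesis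
        by (rule integral_cong_AE[OF leb01_measurable_AE[OF um g] um])
          (use g in eventually_elim, simp)
    qed
    finally show ?thesis using iT by (simp add: u_def)
  qed
  have "AE x in leb01. \<bar>1::real\<bar> \<le> 1" by simp
  from *[OF _ this] have "integrable leb01 (transfer h)" by simp
  with * show ?thesis unfolding is_transfer_def by blast
qed

end

lemma is_transferD:
  assumes "is_transfer f h k" "\<phi> \<in> borel_measurable leb01" "AE x in leb01. \<bar>\<phi> x\<bar> \<le> B"
  shows "(LINT x|leb01. \<phi> x * k x) = (LINT x|leb01. \<phi> (f x) * h x)"
  using assms unfolding is_transfer_def by fast

lemma integrable_bounded_mult:
  fixes \<phi> k :: "real \<Rightarrow> real"
  assumes m: "\<phi> \<in> borel_measurable M" and bd: "AE x in M. \<bar>\<phi> x\<bar> \<le> B" and k: "integrable M k"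
  shows "integrable M (\<lambda>x. \<phi> x * k x)"
proof (rule Bochner_Integration.integrable_bound[OF integrable_mult_right[OF k, of B]])
  show "(\<lambda>x. \<phi> x * k x) \<in> borel_measurable M"
    using m borel_measurable_integrable[OF k] by (rule borel_measurable_times)
  show "AE x in M. norm (\<phi> x * k x) \<le> norm (B * k x)"
    using bd
  proof eventually_elim
    case (elim x)
    then have "\<bar>\<phi> x\<bar> * \<bar>k x\<bar> \<le> \<bar>B\<bar> * \<bar>k x\<bar>" by (intro mult_right_mono) auto
    then show ?case by (simp add: abs_mult)
  qed
qed

text \<open>The sign of the difference is an admissible test function.\<close>

lemma is_transfer_unique:
  assumes "is_transfer f h k" "is_transfer f h k'"
  shows "AE x in leb01. k x = k' x"
proof -
  define \<phi> where "\<phi> x = sgn (k x - k' x)" for x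
  have k: "integrable leb01 k" "integrable leb01 k'" using assms by (auto simp: is_transfer_def)
  note [measurable] = borel_measurable_integrable[OF k(1)] borel_measurable_integrable[OF k(2)]
  have m: "\<phi> \<in> borel_measurable leb01" unfolding \<phi>_def by measurable
  have bd: "AE x in leb01. \<bar>\<phi> x\<bar> \<le> 1" by (rule AE_I2) (auto simp: \<phi>_def sgn_if)
  note i = integrable_bounded_mult[OF m bd k(1)] integrable_bounded_mult[OF m bd k(2)]
  have "(LINT x|leb01. \<bar>k x - k' x\<bar>) = (LINT x|leb01. \<phi> x * k x - \<phi> x * k' x)"
    by (rule Bochner_Integration.integral_cong) (auto simp: \<phi>_def sgn_if)
  also have "\<dots> = (LINT x|leb01. \<phi> x * k x) - (LINT x|leb01. \<phi> x * k' x)"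
    by (rule Bochner_Integration.integral_diff[OF i])
  also have "\<dots> = 0" using is_transferD[OF assms(1) m bd] is_transferD[OF assms(2) m bd] by simp
  finally have "AE x in leb01. \<bar>k x - k' x\<bar> = 0"
    using k by (subst (asm) integral_nonneg_eq_0_iff_AE) auto
  then show ?thesis by eventually_elim simp
qed

lemma is_transfer_cong_right:
  assumes "is_transfer f h k" and "AE x in leb01. k x = k' x"
  shows "is_transfer f h k'"
proof -
  have k: "integrable leb01 k" using assms(1) by (simp add: is_transfer_def)
  have k': "k' \<in> borel_measurable leb01"
    by (rule leb01_measurable_AE[OF borel_measurable_integrable[OF k] assms(2)])
  have "(LINT x|leb01. \<phi> x * k' x) = (LINT x|leb01. \<phi> x * k x)" if "\<phi> \<in> borel_measurable leb01" for \<phi>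
    using that k k' assms(2) by (intro integral_cong_AE) auto
  moreover have "integrable leb01 k'" by (rule integrable_cong_AE_imp[OF k k' assms(2)])
  ultimately show ?thesis using assms(1) unfolding is_transfer_def by simp
qed

lemma is_transfer_integral:
  assumes "is_transfer f h k" shows "(LINT x|leb01. k x) = (LINT x|leb01. h x)"
proof -
  have "(LINT x|leb01. 1 * k x) = (LINT x|leb01. 1 * h x)"
    by (rule is_transferD[OF assms, of "\<lambda>_. 1" 1]) auto
  then show ?thesis by simp
qed

context full_branch_system
begin

lemma is_transfer_cong_left:
  assumes t: "is_transfer f h k" and h: "integrable leb01 h" and e: "AE x in leb01. h x = h' x"
  shows "is_transfer f h' k"
proof -
  have h': "h' \<in> borel_measurable leb01"
    by (rule leb01_measurable_AE[OF borel_measurable_integrable[OF h] e])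
  have "(LINT x|leb01. \<phi> (f x) * h' x) = (LINT x|leb01. \<phi> (f x) * h x)"
    if "\<phi> \<in> borel_measurable leb01" for \<phi>
  proof (rule integral_cong_AE)
    show "AE x in leb01. \<phi> (f x) * h' x = \<phi> (f x) * h x" using e by eventually_elim simp
  qed (use comp_measurable[OF that] h h' in auto)
  then show ?thesis using t unfolding is_transfer_def by simp
qed

lemma is_transfer_compose:
  assumes t: "is_transfer e h k" and t': "is_transfer f k l"
  shows "is_transfer (f \<circ> e) h l"
  unfolding is_transfer_def
proof (intro conjI ballI impI)
  show "integrable leb01 l" using t' by (simp add: is_transfer_def)
  fix \<phi> :: "real \<Rightarrow> real"
  assume m: "\<phi> \<in> borel_measurable leb01" and "\<exists>B. AE x in leb01. \<bar>\<phi> x\<bar> \<le> B"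
  then obtain B where B: "AE x in leb01. \<bar>\<phi> x\<bar> \<le> B" by blast
  have "(LINT x|leb01. \<phi> x * l x) = (LINT x|leb01. \<phi> (f x) * k x)"
    by (rule is_transferD[OF t' m B])
  also have "\<dots> = (LINT x|leb01. \<phi> (f (e x)) * h x)"
    by (rule is_transferD[OF t comp_measurable[OF m] AE_comp[OF B]])
  finally show "(LINT x|leb01. \<phi> x * l x) = (LINT x|leb01. \<phi> ((f \<circ> e) x) * h x)" by simp
qed

lemma is_transfer_L1_le:
  assumes t: "is_transfer f h k" and h: "integrable leb01 h"
  shows "(LINT x|leb01. \<bar>k x\<bar>) \<le> (LINT x|leb01. \<bar>h x\<bar>)"
proof -
  have k: "integrable leb01 k" using t by (simp add: is_transfer_def)
  then have m: "(\<lambda>x. sgn (k x)) \<in> borel_measurable leb01" by measurable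
  have bd: "AE x in leb01. \<bar>sgn (k x)\<bar> \<le> 1" by (rule AE_I2) (auto simp: sgn_if)
  have "(LINT x|leb01. \<bar>k x\<bar>) = (LINT x|leb01. sgn (k x) * k x)"
    by (rule Bochner_Integration.integral_cong) (auto simp: sgn_if)
  also have "\<dots> = (LINT x|leb01. sgn (k (f x)) * h x)"
    by (rule is_transferD[OF t m bd])
  also have "\<dots> \<le> (LINT x|leb01. \<bar>h x\<bar>)"
  proof (rule integral_mono)
    show "integrable leb01 (\<lambda>x. sgn (k (f x)) * h x)"
      by (rule integrable_bounded_mult[OF comp_measurable[OF m] AE_comp[OF bd] h])
  qed (use h in \<open>auto simp: sgn_if\<close>)
  finally show ?thesis .
qed

end

section \<open>The Lasota--Yorke inequality\<close>

text \<open>For functions in \<open>BV\<close> the essential variation as a real number, so that estimates can be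
  carried out in real arithmetic.\<close>

definition evar :: "(real \<Rightarrow> real) \<Rightarrow> real" where
  "evar h = real_of_ereal (ess_variation h)"

lemma BV_evar: "h \<in> BV \<Longrightarrow> ess_variation h = ereal (evar h)" and evar_nonneg: "0 \<le> evar h"
  using ess_variation_nonneg[of h] unfolding BV_def evar_def
  by (auto simp: ereal_real real_of_ereal_pos)

lemma BV_norm_eq: "h \<in> BV \<Longrightarrow> BV_norm h = ereal ((LINT x|leb01. \<bar>h x\<bar>) + evar h)"
  unfolding BV_norm_def L1_norm_def by (simp add: BV_evar)

text \<open>A function of finite variation is bounded, so functions in \<open>BV\<close> may be treated as bounded
  functions.\<close>

lemma BV_representative:
  assumes h: "h \<in> BV" and c: "evar h < c"
  obtains h' B where "AE x in leb01. h x = h' x" "variation_on {0..1} (\<lambda>x. ereal (h' x)) \<le> ereal c"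
    "h' \<in> borel_measurable leb01" "\<forall>x\<in>{0..1}. \<bar>h' x\<bar> \<le> B"
proof -
  have "ess_variation h < ereal c" using BV_evar[OF h] c by simp
  then obtain h' where h': "AE x in leb01. h' x = h x"
      "variation_on {0..1} (\<lambda>x. ereal (h' x)) < ereal c"
    unfolding ess_variation_def by (auto simp: INF_less_iff)
  obtain v where "\<forall>x y. 0 \<le> x \<longrightarrow> x \<le> y \<longrightarrow> y \<le> 1 \<longrightarrow> \<bar>h' x - h' y\<bar> \<le> v y - v x"
      "v 1 - v 0 \<le> c"
    using variation_on_majorant[OF less_imp_le[OF h'(2)]] by blast
  then have v: "\<And>x y. \<lbrakk>0 \<le> x; x \<le> y; y \<le> 1\<rbrakk> \<Longrightarrow> \<bar>h' x - h' y\<bar> \<le> v y - v x" "v 1 - v 0 \<le> c"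
    by blast+
  have "\<forall>x\<in>{0..1}. \<bar>h' x\<bar> \<le> \<bar>h' 0\<bar> + c"
  proof
    fix x :: real assume "x \<in> {0..1}"
    then show "\<bar>h' x\<bar> \<le> \<bar>h' 0\<bar> + c" using v(1)[of 0 x] v(1)[of x 1] v(2) by auto
  qed
  moreover have e: "AE x in leb01. h x = h' x" using h'(1) by eventually_elim simp
  moreover have "h' \<in> borel_measurable leb01"
    using h by (intro leb01_measurable_AE[OF _ e]) (auto simp: BV_def)
  ultimately show ?thesis using that h'(2) by (meson less_imp_le)
qed

context full_branch_system
begin

lemma len_le_theta:
  assumes i: "i \<in> N" shows "len i \<le> \<theta>"
proof (rule ccontr)
  assume "\<not> len i \<le> \<theta>"
  then have gt: "\<theta> < b i - a i" using i by (simp add: len_def)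
  define e where "e = (b i - a i - \<theta>) / 4"
  have e: "0 < e" "b i - a i = \<theta> + 4 * e" using gt by (auto simp: e_def field_simps)
  have "a i + e \<in> \<gamma> i ` {0<..<1}" "b i - e \<in> \<gamma> i ` {0<..<1}"
    unfolding image[OF i] using e theta_pos by auto
  then obtain x y where "x \<in> {0<..<1}" "y \<in> {0<..<1}" "a i + e = \<gamma> i x" "b i - e = \<gamma> i y"
    by blast
  then have xy: "0 < x" "x < 1" "0 < y" "y < 1" "\<gamma> i x = a i + e" "\<gamma> i y = b i - e" by auto
  have "\<bar>\<gamma> i y - \<gamma> i x\<bar> \<le> \<theta> * \<bar>y - x\<bar>" by (rule inverse_branch_lipschitz[OF i]) (use xy in auto)
  also have "\<dots> \<le> \<theta>" using theta_pos xy by (intro mult_left_le) auto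
  finally show False using xy e by auto
qed

lemma sum_branch_integrals_le:
  fixes h :: "real \<Rightarrow> real"
  assumes h: "integrable leb01 h" and F: "finite F" "F \<subseteq> N"
  shows "(\<Sum>i\<in>F. LINT x|leb01. indicator {a i<..<b i} x * \<bar>h x\<bar>) \<le> (LINT x|leb01. \<bar>h x\<bar>)"
proof -
  have i: "integrable leb01 (\<lambda>x. indicator {a i<..<b i} x * \<bar>h x\<bar>)" if "i \<in> F" for i
  proof -
    have "{a i<..<b i} \<in> sets leb01"
      using interval[of i] F that by (subst sets_restrict_space_iff) auto
    from integrable_mult_indicator[OF this integrable_abs[OF h]] show ?thesis by simp
  qed
  have "(\<Sum>i\<in>F. LINT x|leb01. indicator {a i<..<b i} x * \<bar>h x\<bar>)
      = (LINT x|leb01. (\<Sum>i\<in>F. indicator {a i<..<b i} x * \<bar>h x\<bar>))"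
    by (rule Bochner_Integration.integral_sum[symmetric]) (rule i)
  also have "\<dots> \<le> (LINT x|leb01. \<bar>h x\<bar>)"
  proof (rule integral_mono)
    fix x
    have "(\<Sum>i\<in>F. indicator {a i<..<b i} x) = (indicator (\<Union>i\<in>F. {a i<..<b i}) x :: real)"
      using disjoint_family_on_mono[OF F(2) disjoint] F(1) by (simp add: indicator_UN_disjoint)
    then show "(\<Sum>i\<in>F. indicator {a i<..<b i} x * \<bar>h x\<bar>) \<le> \<bar>h x\<bar>"
      unfolding sum_distrib_right[symmetric] by (simp add: indicator_def)
  qed (use i h in auto)
  finally show ?thesis .
qed

text \<open>On a branch interval, a function exceeds its mean by at most its variation there.\<close>

lemma len_times_abs_le:
  assumes h: "integrable leb01 h" and i: "i \<in> N" and x: "a i \<le> x" "x \<le> b i"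
    and v: "\<And>x y. \<lbrakk>0 \<le> x; x \<le> y; y \<le> 1\<rbrakk> \<Longrightarrow> \<bar>h x - h y\<bar> \<le> v y - v x"
  shows "len i * \<bar>h x\<bar> \<le> (LINT t|leb01. indicator {a i<..<b i} t * \<bar>h t\<bar>) + len i * (v (b i) - v (a i))"
proof -
  let ?I = "{a i<..<b i}"
  have I: "?I \<in> sets leb01" using interval[OF i] by (subst sets_restrict_space_iff) auto
  have m: "measure leb01 ?I = len i"
    using interval[OF i] i I
    by (subst measure_restrict_space) (auto simp: len_def)
  let ?c = "\<bar>h x\<bar> - (v (b i) - v (a i))"
  have le: "?c \<le> \<bar>h t\<bar>" if "t \<in> ?I" for t
    using v[of "a i" "min x t"] v[of "min x t" "max x t"] v[of "max x t" "b i"] that x interval[OF i]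
    by (cases "x \<le> t") auto
  have "?I \<inter> {0..1} = ?I" using interval[OF i] by auto
  then have "len i * ?c = (LINT t|leb01. indicator ?I t * ?c)"
    using m I by simp
  also have "\<dots> \<le> (LINT t|leb01. indicator ?I t * \<bar>h t\<bar>)"
  proof (rule integral_mono)
    show "integrable leb01 (\<lambda>t. indicator ?I t * \<bar>h t\<bar>)"
      using integrable_mult_indicator[OF I integrable_abs[OF h]] by simp
    show "integrable leb01 (\<lambda>t. indicator ?I t * ?c)"
      using I finite_measure.emeasure_finite[OF finite_measure_leb01]
      by (auto intro!: integrable_mult_left integrable_real_indicator simp: less_top)
    show "indicator ?I t * ?c \<le> indicator ?I t * \<bar>h t\<bar>" for t
      using le[of t] by (auto simp: indicator_def)
  qed
  finally show ?thesis by (simp add: algebra_simps)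
qed

text \<open>Along the \<open>i\<close>-th inverse branch the product \<open>h (\<gamma> i y) * w i y\<close> varies for two reasons. The
  variation of \<open>h\<close> on the branch interval enters with the factor \<open>w i \<le> \<theta>\<close>. The variation of \<open>w i\<close> is at
  most a multiple of the length of the interval and enters with the factor \<open>sup \<bar>h\<bar>\<close>; by
  \<open>len_times_abs_le\<close> the product of these two is controlled by the integral and the variation of \<open>h\<close> on
  the interval, the latter with a small factor \<open>len i \<le> \<theta>\<close> again.\<close>

lemma variation_transfer:
  assumes hm: "h \<in> borel_measurable leb01" and hB: "\<forall>x\<in>{0..1}. \<bar>h x\<bar> \<le> B"
    and V: "variation_on {0..1} (\<lambda>x. ereal (h x)) \<le> ereal V"
  shows "variation_on {0..1} (\<lambda>x. ereal (transfer h x))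
    \<le> ereal (\<theta> * (1 + D * exp (2 * D)) * V + D * exp (2 * D) * (LINT x|leb01. \<bar>h x\<bar>))"
proof -
  define K where "K = D * exp (2 * D)"
  have K: "0 \<le> K" using D_nonneg by (simp add: K_def)
  have h: "integrable leb01 h"
    using hB by (intro integrable_leb01_bounded[OF hm AE_I2]) auto
  obtain v where "\<forall>x y. 0 \<le> x \<longrightarrow> x \<le> y \<longrightarrow> y \<le> 1 \<longrightarrow> \<bar>h x - h y\<bar> \<le> v y - v x"
      "v 1 - v 0 \<le> V"
    using variation_on_majorant[OF V] by blast
  then have v: "\<And>x y. \<lbrakk>0 \<le> x; x \<le> y; y \<le> 1\<rbrakk> \<Longrightarrow> \<bar>h x - h y\<bar> \<le> v y - v x" "v 1 - v 0 \<le> V"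
    by blast+
  have vm: "v x \<le> v y" if "0 \<le> x" "x \<le> y" "y \<le> 1" for x y using v(1)[OF that] by simp
  define m where "m i = (LINT t|leb01. indicator {a i<..<b i} t * \<bar>h t\<bar>)
      + len i * (v (b i) - v (a i))" for i
  \<comment> \<open>\<open>p i\<close> is a monotone majorant for the \<open>i\<close>-th term, normalised to vanish at \<open>0\<close>, and \<open>q i\<close> bounds
    its total increment.\<close>
  define p where "p i y = (if i \<in> N then \<theta> * (\<sigma> i * (v (\<gamma> i y) - v (\<gamma> i 0))) + K * m i * y else 0)"
    for i y
  define q where "q i = (if i \<in> N then \<theta> * (v (b i) - v (a i)) + K * m i else 0)" for i
  have m0: "0 \<le> m i" if "i \<in> N" for i
    using vm[of "a i" "b i"] interval[OF that] len_nonneg[of i] unfolding m_def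
    by (intro add_nonneg_nonneg integral_nonneg_AE AE_I2) auto
  have inc: "\<bar>h (\<gamma> i y) * w i y - h (\<gamma> i x) * w i x\<bar> \<le> p i y - p i x"
    if xy: "0 \<le> x" "x \<le> y" "y \<le> 1" for i x y
  proof (cases "i \<in> N")
    case True
    have r: "a i \<le> \<gamma> i x" "\<gamma> i x \<le> b i" "0 \<le> \<gamma> i x" "\<gamma> i x \<le> 1" "0 \<le> \<gamma> i y" "\<gamma> i y \<le> 1"
      using inverse_branch_range[OF True, of x] inverse_branch_unit[OF True, of x]
        inverse_branch_unit[OF True, of y] xy by auto
    have s: "\<bar>h (\<gamma> i y) - h (\<gamma> i x)\<bar> \<le> \<sigma> i * (v (\<gamma> i y) - v (\<gamma> i x))"
      using inverse_branch_increment(1)[OF True xy] sign[OF True] v(1)[of "\<gamma> i x" "\<gamma> i y"]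
        v(1)[of "\<gamma> i y" "\<gamma> i x"] r by (auto simp: abs_minus_commute)
    have "\<bar>h (\<gamma> i y) * w i y - h (\<gamma> i x) * w i x\<bar>
        = \<bar>(h (\<gamma> i y) - h (\<gamma> i x)) * w i y + h (\<gamma> i x) * (w i y - w i x)\<bar>"
      by (simp add: algebra_simps)
    also have "\<dots> \<le> \<bar>h (\<gamma> i y) - h (\<gamma> i x)\<bar> * w i y + \<bar>h (\<gamma> i x)\<bar> * \<bar>w i y - w i x\<bar>"
      using abs_triangle_ineq[of "(h (\<gamma> i y) - h (\<gamma> i x)) * w i y" "h (\<gamma> i x) * (w i y - w i x)"]
        weight_nonneg[of y i] xy by (simp add: abs_mult)
    also have "\<dots> \<le> (\<sigma> i * (v (\<gamma> i y) - v (\<gamma> i x))) * \<theta> + \<bar>h (\<gamma> i x)\<bar> * (K * len i * (y - x))"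
      using s weight_le[OF True, of y] weight_nonneg[of y i] weight_lipschitz[of y x i] xy
      by (intro add_mono mult_mono mult_left_mono) (auto simp: K_def)
    also have "\<bar>h (\<gamma> i x)\<bar> * (K * len i * (y - x)) = K * (len i * \<bar>h (\<gamma> i x)\<bar>) * (y - x)"
      by simp
    also have "\<dots> \<le> K * m i * (y - x)"
      using len_times_abs_le[OF h True r(1,2) v(1)] K xy unfolding m_def
      by (intro mult_right_mono mult_left_mono) auto
    finally show ?thesis using True by (simp add: p_def algebra_simps)
  qed (simp add: p_def weight_zero)
  have p1: "p i 1 \<le> q i" for i
  proof (cases "i \<in> N")
    case True
    have r: "a i \<le> \<gamma> i 0" "\<gamma> i 0 \<le> b i" "a i \<le> \<gamma> i 1" "\<gamma> i 1 \<le> b i"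
      using inverse_branch_range[OF True] by auto
    have "\<sigma> i * (v (\<gamma> i 1) - v (\<gamma> i 0)) \<le> v (b i) - v (a i)"
      using sign[OF True] r interval[OF True] vm[of "\<gamma> i 0" "b i"] vm[of "\<gamma> i 1" "b i"]
        vm[of "a i" "\<gamma> i 0"] vm[of "a i" "\<gamma> i 1"] by auto
    then show ?thesis using True theta_pos by (simp add: p_def q_def)
  qed (simp add: p_def q_def)
  have pm: "p i x \<le> p i y" if "0 \<le> x" "x \<le> y" "y \<le> 1" for i x y
    using inc[OF that, of i] by simp
  have p0: "p i 0 = 0" for i by (simp add: p_def)
  have q: "sum q {..<n} \<le> \<theta> * (1 + K) * V + K * (LINT x|leb01. \<bar>h x\<bar>)" for n
  proof -
    let ?F = "{..<n} \<inter> N"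
    have F: "finite ?F" "?F \<subseteq> N" by auto
    have sv: "(\<Sum>i\<in>?F. v (b i) - v (a i)) \<le> V"
      using sum_increments_disjoint_intervals[of ?F v a b 1] vm interval v(2)
        disjoint_family_on_mono[OF F(2) disjoint] by force
    have sl: "(\<Sum>i\<in>?F. len i * (v (b i) - v (a i))) \<le> \<theta> * V"
    proof -
      have "len i \<le> \<theta>" if "i \<in> N" for i
        by (rule len_le_theta[OF that])
      then have "(\<Sum>i\<in>?F. len i * (v (b i) - v (a i))) \<le> (\<Sum>i\<in>?F. \<theta> * (v (b i) - v (a i)))"
        using vm interval by (intro sum_mono mult_right_mono) force+
      also have "\<dots> \<le> \<theta> * V"
        unfolding sum_distrib_left[symmetric] using sv theta_pos by (intro mult_left_mono) auto
      finally show ?thesis .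
    qed
    have "sum q {..<n} = (\<Sum>i\<in>?F. \<theta> * (v (b i) - v (a i)) + K * m i)"
      unfolding q_def by (rule sum_lessThan_N)
    also have "\<dots> = \<theta> * (\<Sum>i\<in>?F. v (b i) - v (a i))
        + K * ((\<Sum>i\<in>?F. LINT t|leb01. indicator {a i<..<b i} t * \<bar>h t\<bar>)
               + (\<Sum>i\<in>?F. len i * (v (b i) - v (a i))))"
      by (simp only: m_def sum.distrib sum_distrib_left[symmetric])
    also have "\<dots> \<le> \<theta> * V + K * ((LINT x|leb01. \<bar>h x\<bar>) + \<theta> * V)"
      using sv sl sum_branch_integrals_le[OF h F] K theta_pos
      by (intro add_mono mult_left_mono) auto
    finally show ?thesis by (simp add: algebra_simps)
  qed
  define C where "C = \<theta> * (1 + K) * V + K * (LINT x|leb01. \<bar>h x\<bar>)"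
  have C0: "0 \<le> C" using q[of 0] by (simp add: C_def)
  have pq: "0 \<le> p i y" "p i y \<le> q i" if "0 \<le> y" "y \<le> 1" for i y
    using pm[of 0 y i] pm[of y 1 i] p1[of i] p0[of i] that by auto
  have q0: "0 \<le> q i" for i using pq[of 0 i] by simp
  have sq: "summable q" by (rule summableI_nonneg_bounded[OF q0 q])
  have sp: "summable (\<lambda>i. p i y)" if "0 \<le> y" "y \<le> 1" for y
    by (rule summable_comparison_test[OF _ sq]) (use pq[OF that] in auto)
  have "variation_on {0..1} (\<lambda>x. ereal (transfer h x)) \<le> ereal C"
  proof (rule variation_on_le_of_majorant[where v = "\<lambda>y. (\<Sum>i. p i y)"])
    fix x y :: real assume x: "x \<in> {0..1}" and y: "y \<in> {0..1}"
    have "(\<Sum>i. p i y) - (\<Sum>i. p i x) \<le> (\<Sum>i. q i) - (\<Sum>i. 0)"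
      using x y pq sp sq by (intro diff_mono suminf_le) auto
    also have "\<dots> \<le> C" using suminf_le_const[OF sq q] by (simp add: C_def)
    finally show "(\<Sum>i. p i y) - (\<Sum>i. p i x) \<le> C" .
    assume lt: "x < y"
    have s: "summable (\<lambda>i. h (\<gamma> i x) * w i x)" "summable (\<lambda>i. h (\<gamma> i y) * w i y)"
      using transfer_summable[OF hB] x y by auto
    have sp': "summable (\<lambda>i. p i y - p i x)" using sp x y by (intro summable_diff) auto
    have sa: "summable (\<lambda>i. \<bar>h (\<gamma> i y) * w i y - h (\<gamma> i x) * w i x\<bar>)"
      by (rule summable_comparison_test[OF _ sp']) (use inc[of x y] x y lt in auto)
    have "\<bar>transfer h x - transfer h y\<bar> = \<bar>\<Sum>i. h (\<gamma> i y) * w i y - h (\<gamma> i x) * w i x\<bar>"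
      unfolding transfer_def using suminf_diff[OF s(2) s(1)] by (simp add: abs_minus_commute)
    also have "\<dots> \<le> (\<Sum>i. \<bar>h (\<gamma> i y) * w i y - h (\<gamma> i x) * w i x\<bar>)"
      by (rule summable_rabs[OF sa])
    also have "\<dots> \<le> (\<Sum>i. p i y - p i x)"
      by (rule suminf_le[OF _ sa sp']) (use inc x y lt in auto)
    also have "\<dots> = (\<Sum>i. p i y) - (\<Sum>i. p i x)"
      using sp x y by (intro suminf_diff[symmetric]) auto
    finally show "\<bar>transfer h x - transfer h y\<bar> \<le> (\<Sum>i. p i y) - (\<Sum>i. p i x)" .
  qed (rule C0)
  then show ?thesis by (simp add: C_def K_def)
qed

text \<open>The essential variation is an infimum over representatives, so each representative of \<open>h\<close> yields
  the representative \<open>transfer h'\<close> of \<open>k\<close>.\<close>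

lemma lasota_yorke:
  assumes h: "h \<in> BV" and t: "is_transfer f h k"
  shows "k \<in> BV" and "evar k \<le> \<theta> * (1 + D * exp (2 * D)) * evar h
      + D * exp (2 * D) * (LINT x|leb01. \<bar>h x\<bar>)"
proof -
  let ?A = "\<theta> * (1 + D * exp (2 * D))" and ?C = "D * exp (2 * D) * (LINT x|leb01. \<bar>h x\<bar>)"
  have hi: "integrable leb01 h" using h by (simp add: BV_def)
  have k: "integrable leb01 k" using t by (simp add: is_transfer_def)
  have le: "ess_variation k \<le> ereal (?A * c + ?C)" if c: "evar h < c" for c
  proof -
    obtain h' B where h': "AE x in leb01. h x = h' x"
        "variation_on {0..1} (\<lambda>x. ereal (h' x)) \<le> ereal c"
        "h' \<in> borel_measurable leb01" "\<forall>x\<in>{0..1}. \<bar>h' x\<bar> \<le> B"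
      using BV_representative[OF h c] .
    have "AE x in leb01. transfer h' x = k x"
      using is_transfer_unique[OF is_transfer_transfer[OF h'(3,4)] is_transfer_cong_left[OF t hi h'(1)]] .
    then have "ess_variation k \<le> variation_on {0..1} (\<lambda>x. ereal (transfer h' x))"
      unfolding ess_variation_def by (intro INF_lower) simp
    also have "\<dots> \<le> ereal (?A * c + D * exp (2 * D) * (LINT x|leb01. \<bar>h' x\<bar>))"
      by (rule variation_transfer[OF h'(3,4,2)])
    also have "(LINT x|leb01. \<bar>h' x\<bar>) = (LINT x|leb01. \<bar>h x\<bar>)"
      using h'(1) by (intro integral_cong_AE) (use h'(3) hi in auto)
    finally show ?thesis .
  qed
  have "ess_variation k < \<infinity>" using le[of "evar h + 1"] by (auto simp: less_top intro: le_less_trans)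
  then show kB: "k \<in> BV" using k by (simp add: BV_def)
  show "evar k \<le> ?A * evar h + ?C"
  proof (rule field_le_epsilon)
    fix e :: real assume e: "0 < e"
    have A: "0 < ?A" using theta_pos D_nonneg by (intro mult_pos_pos add_pos_nonneg) auto
    have "evar k \<le> ?A * (evar h + e / ?A) + ?C"
      using le[of "evar h + e / ?A"] e A BV_evar[OF kB] by (metis divide_pos_pos ereal_less_eq(3) less_add_same_cancel1)
    also have "\<dots> = ?A * evar h + ?C + e"
    proof -
      have "x * (e / x) = e" if "0 < x" for x using that by simp
      from this[OF A] have "?A * (e / ?A) = e" .
      then show ?thesis by (simp only: distrib_left)
    qed
    finally show "evar k \<le> ?A * evar h + ?C + e" .
  qed
qed

lemma frobenius_perron_transfer:
  assumes h: "h \<in> BV" shows "is_transfer f h (frobenius_perron f h)"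
proof -
  obtain h' B where h': "AE x in leb01. h x = h' x"
        "variation_on {0..1} (\<lambda>x. ereal (h' x)) \<le> ereal (evar h + 1)"
        "h' \<in> borel_measurable leb01" "\<forall>x\<in>{0..1}. \<bar>h' x\<bar> \<le> B"
    using BV_representative[OF h, of "evar h + 1"] by auto
  have "integrable leb01 h'" using h'(4) by (intro integrable_leb01_bounded[OF h'(3) AE_I2]) auto
  moreover have "AE x in leb01. h' x = h x" using h'(1) by eventually_elim simp
  ultimately have "is_transfer f h (transfer h')"
    using is_transfer_cong_left[OF is_transfer_transfer[OF h'(3,4)]] by blast
  then have "is_transfer f h (SOME k. is_transfer f h k)" by (rule someI[of "is_transfer f h"])
  then show ?thesis unfolding frobenius_perron_def is_transfer_def .
qed

lemma frobenius_perron_iterate: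
  assumes h: "h \<in> BV"
  shows "(frobenius_perron f ^^ n) h \<in> BV \<and> is_transfer (f ^^ n) h ((frobenius_perron f ^^ n) h)"
proof (induction n)
  case 0 then show ?case using h by (auto simp: is_transfer_def BV_def)
next
  case (Suc n)
  have t: "is_transfer f ((frobenius_perron f ^^ n) h) ((frobenius_perron f ^^ Suc n) h)"
    using frobenius_perron_transfer Suc by simp
  have "is_transfer (f ^^ Suc n) h ((frobenius_perron f ^^ Suc n) h)"
    unfolding funpow.simps(2)[of n f] using is_transfer_compose[OF _ t] Suc by blast
  then show ?case using lasota_yorke(1)[OF _ t] Suc by blast
qed

end

section \<open>Positive log-Lipschitz functions and exponential decay\<close>

text \<open>Positive functions on \<open>[0, 1]\<close> whose logarithm is \<open>L\<close>-Lipschitz.\<close>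

definition log_lipschitz :: "real \<Rightarrow> (real \<Rightarrow> real) \<Rightarrow> bool" where
  "log_lipschitz L h \<longleftrightarrow> (\<forall>x\<in>{0..1}. 0 < h x) \<and>
     (\<forall>x\<in>{0..1}. \<forall>y\<in>{0..1}. h x \<le> exp (L * \<bar>x - y\<bar>) * h y)"

lemma log_lipschitzD:
  assumes "log_lipschitz L h" "0 \<le> x" "x \<le> 1" "0 \<le> y" "y \<le> 1"
  shows "0 < h x" "h x \<le> exp (L * \<bar>x - y\<bar>) * h y"
  using assms unfolding log_lipschitz_def by auto

lemma log_lipschitz_mono: "log_lipschitz L h \<Longrightarrow> L \<le> L' \<Longrightarrow> log_lipschitz L' h"
  unfolding log_lipschitz_def
  by (meson atLeastAtMost_iff exp_le_cancel_iff abs_ge_zero less_imp_le mult_right_mono order_trans)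

lemma log_lipschitz_scale: "log_lipschitz L h \<Longrightarrow> 0 < r \<Longrightarrow> log_lipschitz L (\<lambda>x. r * h x)"
  unfolding log_lipschitz_def by (auto simp: mult.left_commute[of _ r])

lemma log_lipschitz_mult:
  assumes "log_lipschitz L h" "log_lipschitz L' h'"
  shows "log_lipschitz (L + L') (\<lambda>x. h x * h' x)"
  unfolding log_lipschitz_def
proof (intro conjI ballI)
  fix x y :: real assume x: "x \<in> {0..1}" and y: "y \<in> {0..1}"
  show "0 < h x * h' x" using assms x unfolding log_lipschitz_def by simp
  have "h x * h' x \<le> (exp (L * \<bar>x - y\<bar>) * h y) * (exp (L' * \<bar>x - y\<bar>) * h' y)"
    using log_lipschitzD[OF assms(1), of x y] log_lipschitzD[OF assms(2), of x y]
      log_lipschitzD(1)[OF assms(1), of y y] x y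
    by (intro mult_mono) auto
  then show "h x * h' x \<le> exp ((L + L') * \<bar>x - y\<bar>) * (h y * h' y)"
    by (simp add: distrib_right exp_add ac_simps)
qed

lemma log_lipschitz_le:
  assumes "log_lipschitz L h" "0 \<le> L" "0 \<le> x" "x \<le> 1" "0 \<le> y" "y \<le> 1"
  shows "h x \<le> exp L * h y"
proof -
  have "h x \<le> exp (L * \<bar>x - y\<bar>) * h y" by (rule log_lipschitzD(2)[OF assms(1,3-6)])
  also have "\<dots> \<le> exp L * h y"
    using log_lipschitzD(1)[OF assms(1,5,6) assms(5,6)] assms by (intro mult_right_mono) (auto simp: mult_left_le)
  finally show ?thesis .
qed

lemma log_lipschitz_increment:
  assumes h: "log_lipschitz L h" and L: "0 \<le> L" and xy: "0 \<le> x" "x \<le> 1" "0 \<le> y" "y \<le> 1"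
  shows "\<bar>h x - h y\<bar> \<le> L * exp (2 * L) * h 0 * \<bar>x - y\<bar>"
proof -
  have *: "h x - h y \<le> L * exp (2 * L) * h 0 * \<bar>x - y\<bar>"
    if xy: "0 \<le> x" "x \<le> 1" "0 \<le> y" "y \<le> 1" for x y
    using increment_le_of_ratio[OF log_lipschitzD(2)[OF h xy] L, of "exp L * h 0"]
      log_lipschitz_le[OF h L xy(3,4), of 0] log_lipschitzD(1)[OF h xy(3,4,3,4)] xy
    unfolding mult_2 exp_add by (simp add: mult_ac)
  show ?thesis using *[OF xy] *[OF xy(3,4,1,2)] by (simp add: abs_le_iff abs_minus_commute)
qed

lemma log_lipschitz_measurable:
  assumes h: "log_lipschitz L h" and L: "0 \<le> L" shows "h \<in> borel_measurable leb01"
proof -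
  have "(L * exp (2 * L) * h 0)-lipschitz_on {0..1} h"
    using L log_lipschitzD(1)[OF h, of 0 0] log_lipschitz_increment[OF h L]
    by (auto simp: lipschitz_on_def dist_real_def)
  then have "continuous_on {0..1} h" by (rule lipschitz_on_continuous_on)
  then show ?thesis by (rule continuous_imp_measurable_on_sets_lebesgue) simp
qed

lemma log_lipschitz_bounded:
  assumes "log_lipschitz L h" "0 \<le> L" shows "\<forall>x\<in>{0..1}. \<bar>h x\<bar> \<le> exp L * h 0"
  using log_lipschitz_le[OF assms, of _ 0] log_lipschitzD(1)[OF assms(1)]
  by (auto simp: abs_of_pos)

lemma log_lipschitz_integrable:
  assumes "log_lipschitz L h" "0 \<le> L" shows "integrable leb01 h"
  using log_lipschitz_bounded[OF assms]
  by (intro integrable_leb01_bounded[OF log_lipschitz_measurable[OF assms] AE_I2]) auto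

lemma log_lipschitz_density_bounds:
  assumes h: "log_lipschitz L h" "0 \<le> L" and i: "(LINT x|leb01. h x) = 1" and x: "0 \<le> x" "x \<le> 1"
  shows "h x \<le> exp L" "exp (- L) \<le> h x"
proof -
  note hi = log_lipschitz_integrable[OF h]
  have "(LINT y|leb01. h x) \<le> (LINT y|leb01. exp L * h y)"
    using log_lipschitz_le[OF h x] hi finite_measure_leb01
    by (intro integral_mono) (auto intro: finite_measure.integrable_const)
  then show "h x \<le> exp L" using i by simp
  have "(LINT y|leb01. h y) \<le> (LINT y|leb01. exp L * h x)"
    using log_lipschitz_le[OF h _ _ x] hi finite_measure_leb01
    by (intro integral_mono) (auto intro: finite_measure.integrable_const)
  then show "exp (- L) \<le> h x" using i by (simp add: exp_minus field_simps)
qed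

lemma log_lipschitz_BV:
  assumes h: "log_lipschitz L h" "0 \<le> L" shows "h \<in> BV"
proof -
  define C where "C = L * exp (2 * L) * h 0"
  have C: "0 \<le> C" using h(2) log_lipschitzD(1)[OF h(1), of 0 0] by (simp add: C_def)
  have "variation_on {0..1} (\<lambda>x. ereal (h x)) \<le> ereal C"
  proof (rule variation_on_le_of_majorant[where v = "\<lambda>x. C * x"])
    fix x y :: real assume xy: "x \<in> {0..1}" "y \<in> {0..1}"
    show "C * y - C * x \<le> C" using C xy mult_left_mono[of "y - x" 1 C] by (simp add: right_diff_distrib)
    assume "x < y"
    then show "\<bar>h x - h y\<bar> \<le> C * y - C * x"
      using log_lipschitz_increment[OF h, of x y] xy by (simp add: C_def right_diff_distrib)
  qed (rule C)
  moreover have "ess_variation h \<le> variation_on {0..1} (\<lambda>x. ereal (h x))"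
    unfolding ess_variation_def by (intro INF_lower) simp
  ultimately have "ess_variation h < \<infinity>" by (auto simp: less_top intro: le_less_trans)
  then show ?thesis using log_lipschitz_integrable[OF h] by (simp add: BV_def)
qed

text \<open>Subtracting half of the lower bound of a function costs a factor of two in the
  log-Lipschitz constant.\<close>

lemma log_lipschitz_minus_const:
  assumes h: "log_lipschitz L h" "0 \<le> L" and c: "0 < c" "\<And>x. \<lbrakk>0 \<le> x; x \<le> 1\<rbrakk> \<Longrightarrow> 2 * c \<le> h x"
  shows "log_lipschitz (2 * L) (\<lambda>x. h x - c)"
  unfolding log_lipschitz_def
proof (intro conjI ballI)
  fix x y :: real assume x: "x \<in> {0..1}" and y: "y \<in> {0..1}"
  show "0 < h x - c" using c(1) c(2)[of x] x by auto
  define E where "E = exp (L * \<bar>x - y\<bar>)"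
  have E: "1 \<le> E" using h(2) by (simp add: E_def)
  have E2: "exp (2 * L * \<bar>x - y\<bar>) = E * E" by (simp add: E_def exp_add[symmetric])
  have "E * (2 * c) \<le> E * h y" using c(2)[of y] y E by (intro mult_left_mono) auto
  moreover have "c * 1 \<le> c * E" using c(1) E by (intro mult_left_mono) auto
  ultimately have "c * (E + 1) \<le> E * h y" by (simp add: algebra_simps)
  then have "(E - 1) * (c * (E + 1)) \<le> (E - 1) * (E * h y)" using E by (intro mult_left_mono) auto
  moreover have "h x \<le> E * h y" unfolding E_def using log_lipschitzD(2)[OF h(1)] x y by simp
  ultimately show "h x - c \<le> exp (2 * L * \<bar>x - y\<bar>) * (h y - c)"
    unfolding E2 by (simp add: algebra_simps)
qed

context full_branch_system
begin

text \<open>Every summand has this property: precomposition with an inverse branch multiplies the constant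
  of \<open>h\<close> by \<open>\<theta>\<close>, and multiplication by the weight adds \<open>D\<close>.\<close>

lemma transfer_log_lipschitz:
  assumes h: "log_lipschitz L h" and L: "0 \<le> L"
  shows "log_lipschitz (\<theta> * L + D) (transfer h)"
  unfolding log_lipschitz_def
proof (intro conjI ballI)
  fix x y :: real assume x: "x \<in> {0..1}" and y: "y \<in> {0..1}"
  note s = transfer_summable[OF log_lipschitz_bounded[OF h L]]
  have pos: "0 < h (\<gamma> i x) * w i x" if "i \<in> N" "x \<in> {0..1}" for i x
    using log_lipschitzD(1)[OF h, of "\<gamma> i x" 0] inverse_branch_unit[of i x] weight_pos[of i x] that by auto
  have nn: "0 \<le> h (\<gamma> i x) * w i x" if "x \<in> {0..1}" for i x
    using pos[of i x] weight_zero[of i x] that by (cases "i \<in> N") auto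
  obtain i where "i \<in> N" using nonempty by blast
  then show "0 < transfer h x"
    unfolding transfer_def using s pos[of i x] nn x by (intro suminf_pos2[of _ i]) auto
  let ?E = "exp ((\<theta> * L + D) * \<bar>x - y\<bar>)"
  have "h (\<gamma> i x) * w i x \<le> ?E * (h (\<gamma> i y) * w i y)" for i
  proof (cases "i \<in> N")
    case True
    have u: "0 \<le> \<gamma> i x" "\<gamma> i x \<le> 1" "0 \<le> \<gamma> i y" "\<gamma> i y \<le> 1"
      using inverse_branch_unit[OF True] x y by auto
    have "h (\<gamma> i x) \<le> exp (L * \<bar>\<gamma> i x - \<gamma> i y\<bar>) * h (\<gamma> i y)" by (rule log_lipschitzD(2)[OF h u])
    also have "\<dots> \<le> exp (L * (\<theta> * \<bar>x - y\<bar>)) * h (\<gamma> i y)"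
      using inverse_branch_lipschitz[OF True, of x y] x y L log_lipschitzD(1)[OF h u(3,4) u(3,4)]
      by (intro mult_right_mono) (auto intro: mult_left_mono)
    finally have "h (\<gamma> i x) * w i x
        \<le> (exp (L * (\<theta> * \<bar>x - y\<bar>)) * h (\<gamma> i y)) * (exp (D * \<bar>x - y\<bar>) * w i y)"
      using distortion[OF True, of x y] x y weight_nonneg[of x i] log_lipschitzD(1)[OF h u(3,4) u(3,4)]
      by (intro mult_mono) auto
    also have "\<dots> = ?E * (h (\<gamma> i y) * w i y)"
    proof -
      have "(\<theta> * L + D) * \<bar>x - y\<bar> = L * (\<theta> * \<bar>x - y\<bar>) + D * \<bar>x - y\<bar>" by (simp add: algebra_simps)
      then show ?thesis by (simp add: exp_add)
    qed
    finally show ?thesis .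
  qed (simp add: weight_zero)
  then have "transfer h x \<le> (\<Sum>i. ?E * (h (\<gamma> i y) * w i y))"
    unfolding transfer_def using s x y by (intro suminf_le summable_mult) auto
  also have "\<dots> = ?E * transfer h y"
    unfolding transfer_def using s y by (intro suminf_mult) auto
  finally show "transfer h x \<le> ?E * transfer h y" .
qed

lemma log_lipschitz_is_transfer:
  "log_lipschitz L h \<Longrightarrow> 0 \<le> L \<Longrightarrow> is_transfer f h (transfer h)"
  by (rule is_transfer_transfer[OF log_lipschitz_measurable log_lipschitz_bounded])

lemma transfer_diff:
  assumes "\<forall>x\<in>{0..1}. \<bar>h x\<bar> \<le> B" "\<forall>x\<in>{0..1}. \<bar>h' x\<bar> \<le> B'" "0 \<le> x" "x \<le> 1"
  shows "transfer (\<lambda>x. h x - h' x) x = transfer h x - transfer h' x"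
  unfolding transfer_def left_diff_distrib
  using transfer_summable[OF assms(1,3,4)] transfer_summable[OF assms(2,3,4)]
  by (intro suminf_diff[symmetric])

lemma transfer_mult:
  assumes "\<forall>x\<in>{0..1}. \<bar>h x\<bar> \<le> B" "0 \<le> x" "x \<le> 1"
  shows "transfer (\<lambda>x. r * h x) x = r * transfer h x"
  unfolding transfer_def mult.assoc
  by (rule suminf_mult[OF transfer_summable[OF assms]])

lemma transfer_power_fixed:
  assumes "\<And>x. \<lbrakk>0 \<le> x; x \<le> 1\<rbrakk> \<Longrightarrow> transfer h x = h x" and "0 \<le> x" "x \<le> 1"
  shows "(transfer ^^ n) h x = h x"
  using assms(2,3)
proof (induction n arbitrary: x)
  case (Suc n)
  then have "transfer ((transfer ^^ n) h) x = transfer h x" by (intro transfer_cong) auto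
  then show ?case using assms(1) Suc by simp
qed simp

lemma transfer_power_log_lipschitz:
  assumes h: "log_lipschitz L h" "0 \<le> L"
  shows "\<exists>L'\<ge>0. log_lipschitz L' ((transfer ^^ n) h)"
proof (induction n)
  case 0 then show ?case using h by auto
next
  case (Suc n)
  then obtain L' where L': "0 \<le> L'" "log_lipschitz L' ((transfer ^^ n) h)" by blast
  have "0 \<le> \<theta> * L' + D" using L' theta_pos D_nonneg by simp
  then show ?case using transfer_log_lipschitz[OF L'(2,1)] by auto
qed

lemma is_transfer_power:
  assumes h: "log_lipschitz L h" "0 \<le> L"
  shows "is_transfer (f ^^ n) h ((transfer ^^ n) h)"
proof (induction n)
  case 0 then show ?case using log_lipschitz_integrable[OF h] by (simp add: is_transfer_def)
next
  case (Suc n)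
  obtain L' where L': "0 \<le> L'" "log_lipschitz L' ((transfer ^^ n) h)"
    using transfer_power_log_lipschitz[OF h] by blast
  show ?case
    using is_transfer_compose[OF Suc log_lipschitz_is_transfer[OF L'(2,1)]] by (simp add: comp_def)
qed

end

text \<open>The bound \<open>1/4\<close> leaves room for doubling the log-Lipschitz constant: with \<open>L = 2 * D + 1\<close> one has
  \<open>\<theta> * (2 * L) + D \<le> L\<close>.\<close>

locale strongly_contracting_system = full_branch_system +
  assumes theta_le: "\<theta> \<le> 1/4"
begin

definition L :: real where "L = 2 * D + 1"
text \<open>Half of the lower bound that a density with log-Lipschitz constant \<open>L\<close> satisfies.\<close>

definition c :: real where "c = exp (- L) / 2"

definition densities :: "(real \<Rightarrow> real) set" where
  "densities = {h. log_lipschitz L h \<and> (LINT x|leb01. h x) = 1}"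

lemma L_nonneg: "0 \<le> L" using D_nonneg by (simp add: L_def)

lemma c_pos: "0 < c" and c_le: "c \<le> 1/2"
  using L_nonneg by (auto simp: c_def)

lemma transfer_densities:
  assumes h: "h \<in> densities" shows "transfer h \<in> densities"
proof -
  have h': "log_lipschitz L h" "(LINT x|leb01. h x) = 1" using h by (auto simp: densities_def)
  have "\<theta> * L + D \<le> 1/4 * L + D" using theta_le L_nonneg by (intro add_mono mult_right_mono) auto
  also have "\<dots> \<le> L" using D_nonneg by (simp add: L_def)
  finally have "\<theta> * L + D \<le> L" .
  then have "log_lipschitz L (transfer h)"
    by (rule log_lipschitz_mono[OF transfer_log_lipschitz[OF h'(1) L_nonneg]])
  moreover have "(LINT x|leb01. transfer h x) = 1"
    using is_transfer_integral[OF log_lipschitz_is_transfer[OF h'(1) L_nonneg]] h'(2) by simp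
  ultimately show ?thesis by (simp add: densities_def)
qed

lemma densities_bounds:
  assumes "h \<in> densities" "0 \<le> x" "x \<le> 1" shows "h x \<le> exp L" "2 * c \<le> h x" "0 < h x"
proof -
  show "h x \<le> exp L" "2 * c \<le> h x"
    using log_lipschitz_density_bounds[OF _ L_nonneg _ assms(2,3), of h] assms(1)
    by (auto simp: densities_def c_def)
  then show "0 < h x" using c_pos by simp
qed

lemma densities_abs_le: "h \<in> densities \<Longrightarrow> \<forall>x\<in>{0..1}. \<bar>h x\<bar> \<le> exp L"
  using densities_bounds by (auto simp: abs_of_pos)

text \<open>Two densities share the constant part \<open>c\<close>; what remains of each is, after one application of
  the operator, again a multiple of a density with the same log-Lipschitz constant.\<close>

lemma coupling:
  assumes h1: "h1 \<in> densities" and h2: "h2 \<in> densities"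
  shows "\<exists>k1\<in>densities. \<exists>k2\<in>densities. \<forall>x\<in>{0..1}. transfer h1 x - transfer h2 x = (1 - c) * (k1 x - k2 x)"
proof -
  define k where "k h x = inverse (1 - c) * transfer (\<lambda>t. h t - c) x" for h x
  have c1: "0 < 1 - c" using c_le by simp
  have kd: "k h \<in> densities" if h: "h \<in> densities" for h
  proof -
    have h': "log_lipschitz L h" "(LINT x|leb01. h x) = 1" using h by (auto simp: densities_def)
    have m: "log_lipschitz (2 * L) (\<lambda>t. h t - c)"
      using densities_bounds(2)[OF h] by (intro log_lipschitz_minus_const[OF h'(1) L_nonneg c_pos])
    have L2: "0 \<le> 2 * L" using L_nonneg by simp
    have "\<theta> * (2 * L) + D \<le> 1/4 * (2 * L) + D" using theta_le L_nonneg by (intro add_mono mult_right_mono) auto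
    also have "\<dots> \<le> L" using D_nonneg by (simp add: L_def)
    finally have "\<theta> * (2 * L) + D \<le> L" .
    then have "log_lipschitz L (k h)"
      unfolding k_def using c1
      by (intro log_lipschitz_scale log_lipschitz_mono[OF transfer_log_lipschitz[OF m L2]]) auto
    moreover have "(LINT x|leb01. k h x) = 1"
    proof -
      have "(LINT x|leb01. transfer (\<lambda>t. h t - c) x) = (LINT x|leb01. h x - c)"
        by (rule is_transfer_integral[OF log_lipschitz_is_transfer[OF m L2]])
      also have "\<dots> = 1 - c"
        using log_lipschitz_integrable[OF h'(1) L_nonneg] h'(2) finite_measure_leb01
        by (subst Bochner_Integration.integral_diff) (auto intro: finite_measure.integrable_const)
      finally show ?thesis unfolding k_def using c1 by simp
    qed
    ultimately show ?thesis by (simp add: densities_def)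
  qed
  have "transfer h1 x - transfer h2 x = (1 - c) * (k h1 x - k h2 x)" if x: "x \<in> {0..1}" for x
  proof -
    have b: "\<forall>x\<in>{0..1}. \<bar>c::real\<bar> \<le> \<bar>c\<bar>" by simp
    have "(1 - c) * (k h1 x - k h2 x) = transfer (\<lambda>t. h1 t - c) x - transfer (\<lambda>t. h2 t - c) x"
      using c1 by (simp add: k_def right_diff_distrib mult.assoc[symmetric])
    also have "\<dots> = transfer h1 x - transfer h2 x"
      using transfer_diff[OF densities_abs_le[OF h1] b, of x]
        transfer_diff[OF densities_abs_le[OF h2] b, of x] x by simp
    finally show ?thesis by simp
  qed
  then show ?thesis using kd[OF h1] kd[OF h2] by blast
qed

lemma transfer_power_densities: "h \<in> densities \<Longrightarrow> (transfer ^^ n) h \<in> densities"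
  by (induction n) (auto intro: transfer_densities)

text \<open>Each application of the operator splits off a factor \<open>1 - c\<close>, and densities take values in
  \<open>[0, exp L]\<close>.\<close>

lemma decay:
  assumes h1: "h1 \<in> densities" and h2: "h2 \<in> densities" and x: "0 \<le> x" "x \<le> 1"
  shows "\<bar>(transfer ^^ n) h1 x - (transfer ^^ n) h2 x\<bar> \<le> (1 - c) ^ n * exp L"
proof -
  have "\<exists>k1\<in>densities. \<exists>k2\<in>densities. \<forall>x\<in>{0..1}.
      (transfer ^^ n) h1 x - (transfer ^^ n) h2 x = (1 - c) ^ n * (k1 x - k2 x)"
  proof (induction n)
    case 0 then show ?case using h1 h2 by auto
  next
    case (Suc n)
    then obtain k1 k2 where k: "k1 \<in> densities" "k2 \<in> densities"
      "\<And>x. x \<in> {0..1} \<Longrightarrow> (transfer ^^ n) h1 x - (transfer ^^ n) h2 x = (1 - c) ^ n * (k1 x - k2 x)"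
      by blast
    obtain l1 l2 where l: "l1 \<in> densities" "l2 \<in> densities"
      "\<And>x. x \<in> {0..1} \<Longrightarrow> transfer k1 x - transfer k2 x = (1 - c) * (l1 x - l2 x)"
      using coupling[OF k(1,2)] by blast
    have b: "\<forall>x\<in>{0..1}. \<bar>k1 x - k2 x\<bar> \<le> exp L + exp L"
      using densities_abs_le[OF k(1)] densities_abs_le[OF k(2)] by fastforce
    have "(transfer ^^ Suc n) h1 x - (transfer ^^ Suc n) h2 x = (1 - c) ^ Suc n * (l1 x - l2 x)"
      if x: "x \<in> {0..1}" for x
    proof -
      have x': "0 \<le> x" "x \<le> 1" using x by auto
      have "(transfer ^^ Suc n) h1 x - (transfer ^^ Suc n) h2 x
          = transfer (\<lambda>x. (transfer ^^ n) h1 x - (transfer ^^ n) h2 x) x"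
        using transfer_diff[OF densities_abs_le[OF transfer_power_densities[OF h1]]
            densities_abs_le[OF transfer_power_densities[OF h2]] x'] by simp
      also have "\<dots> = transfer (\<lambda>x. (1 - c) ^ n * (k1 x - k2 x)) x"
        by (rule transfer_cong[OF _ x']) (use k(3) in auto)
      also have "\<dots> = (1 - c) ^ n * (transfer k1 x - transfer k2 x)"
        using transfer_mult[OF b x'] transfer_diff[OF densities_abs_le[OF k(1)] densities_abs_le[OF k(2)] x']
        by simp
      also have "\<dots> = (1 - c) ^ Suc n * (l1 x - l2 x)" using l(3)[OF x] by simp
      finally show ?thesis .
    qed
    then show ?case using l(1,2) by blast
  qed
  then obtain k1 k2 where k: "k1 \<in> densities" "k2 \<in> densities"
      "(transfer ^^ n) h1 x - (transfer ^^ n) h2 x = (1 - c) ^ n * (k1 x - k2 x)"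
    using x by force
  have "\<bar>k1 x - k2 x\<bar> \<le> exp L"
    using densities_bounds[OF k(1) x] densities_bounds[OF k(2) x] by linarith
  then show ?thesis unfolding k(3) abs_mult using c_le
    by (intro mult_mono) (auto simp: power_abs)
qed

lemma one_minus_c_power: "(\<lambda>n. (1 - c) ^ n * exp L) \<longlonglongrightarrow> 0"
proof -
  have "(\<lambda>n. (1 - c) ^ n) \<longlonglongrightarrow> 0" using c_pos c_le by (intro LIMSEQ_realpow_zero) auto
  then show ?thesis by (rule tendsto_mult_left_zero)
qed

text \<open>The iterates of the constant function \<open>1\<close> converge uniformly, as \<open>transfer\<^sup>n\<^sup>+\<^sup>m 1\<close> and \<open>transfer\<^sup>n 1\<close>
  are the \<open>n\<close>-th iterates of two densities.\<close>

lemma fixed_density: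
  obtains h where "h \<in> densities" "\<And>x. \<lbrakk>0 \<le> x; x \<le> 1\<rbrakk> \<Longrightarrow> transfer h x = h x"
proof -
  define g where "g n = (transfer ^^ n) (\<lambda>_. 1)" for n
  have one: "(\<lambda>_. 1) \<in> densities"
    using L_nonneg by (auto simp: densities_def log_lipschitz_def)
  have gd: "g n \<in> densities" for n unfolding g_def by (rule transfer_power_densities[OF one])
  have cauchy: "\<bar>g (n + m) x - g n x\<bar> \<le> (1 - c) ^ n * exp L" if "0 \<le> x" "x \<le> 1" for n m x
    using decay[OF gd[of m] one that, of n] by (simp add: g_def funpow_add)
  define h where "h x = lim (\<lambda>n. g n x)" for x
  have lim: "(\<lambda>n. g n x) \<longlonglongrightarrow> h x" if x: "0 \<le> x" "x \<le> 1" for x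
  proof -
    have "Cauchy (\<lambda>n. g n x)"
    proof (rule metric_CauchyI)
      fix e :: real assume "0 < e"
      then obtain M where M: "(1 - c) ^ M * exp L < e / 2"
        using order_tendstoD(2)[OF one_minus_c_power, of "e / 2"] by (auto simp: eventually_sequentially)
      have "dist (g m x) (g n x) < e" if "m \<ge> M" "n \<ge> M" for m n
        using cauchy[OF x, of M "m - M"] cauchy[OF x, of M "n - M"] M that
        by (auto simp: dist_real_def abs_le_iff abs_less_iff)
      then show "\<exists>M. \<forall>m\<ge>M. \<forall>n\<ge>M. dist (g m x) (g n x) < e" by blast
    qed
    then show ?thesis unfolding h_def by (simp add: Cauchy_convergent_iff convergent_LIMSEQ_iff)
  qed
  have close: "\<bar>g n x - h x\<bar> \<le> (1 - c) ^ n * exp L" if x: "0 \<le> x" "x \<le> 1" for n x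
  proof -
    have "(\<lambda>m. g (n + m) x) \<longlonglongrightarrow> h x"
      using LIMSEQ_ignore_initial_segment[OF lim[OF x], of n] by (simp add: add.commute)
    then have "(\<lambda>m. \<bar>g (n + m) x - g n x\<bar>) \<longlonglongrightarrow> \<bar>h x - g n x\<bar>" by (intro tendsto_intros)
    then have "\<bar>h x - g n x\<bar> \<le> (1 - c) ^ n * exp L"
      by (rule tendsto_upperbound) (use cauchy[OF x] in auto)
    then show ?thesis by (simp add: abs_minus_commute)
  qed
  have glip: "log_lipschitz L (g n)" for n using gd by (simp add: densities_def)
  have hl: "log_lipschitz L h"
    unfolding log_lipschitz_def
  proof (intro conjI ballI)
    fix x y :: real assume x: "x \<in> {0..1}" and y: "y \<in> {0..1}"
    have "2 * c \<le> h x"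
      by (rule tendsto_lowerbound[OF lim]) (use x densities_bounds(2)[OF gd] in auto)
    then show "0 < h x" using c_pos by simp
    have t: "(\<lambda>n. exp (L * \<bar>x - y\<bar>) * g n y) \<longlonglongrightarrow> exp (L * \<bar>x - y\<bar>) * h y"
      using lim y by (intro tendsto_intros) auto
    show "h x \<le> exp (L * \<bar>x - y\<bar>) * h y"
      by (rule tendsto_le[OF _ t lim]) (use x y log_lipschitzD(2)[OF glip] in auto)
  qed
  have hb: "\<forall>x\<in>{0..1}. \<bar>h x\<bar> \<le> exp L * h 0" by (rule log_lipschitz_bounded[OF hl L_nonneg])
  have fixp: "transfer h x = h x" if x: "0 \<le> x" "x \<le> 1" for x
  proof -
    have "\<bar>transfer h x - g (Suc n) x\<bar> \<le> (1 - c) ^ n * exp L * exp D" for n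
    proof -
      have "transfer h x - g (Suc n) x = transfer (\<lambda>x. h x - g n x) x"
        using transfer_diff[OF hb densities_abs_le[OF gd] x] by (simp add: g_def)
      moreover have "\<forall>x\<in>{0..1}. \<bar>h x - g n x\<bar> \<le> (1 - c) ^ n * exp L"
        using close by (auto simp: abs_minus_commute)
      ultimately show ?thesis using transfer_abs_le[of "\<lambda>x. h x - g n x" _ x] x by simp
    qed
    then have ev: "\<forall>\<^sub>F n in sequentially. norm (transfer h x - g (Suc n) x) \<le> (1 - c) ^ n * exp L * exp D"
      by simp
    have "(\<lambda>n. (1 - c) ^ n * exp L * exp D) \<longlonglongrightarrow> 0"
      by (rule tendsto_mult_left_zero[OF one_minus_c_power])
    then have lim0: "(\<lambda>n. transfer h x - g (Suc n) x) \<longlonglongrightarrow> 0"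
      by (rule Lim_null_comparison[OF ev])
    have "(\<lambda>n. transfer h x - g (Suc n) x) \<longlonglongrightarrow> transfer h x - h x"
      using LIMSEQ_Suc[OF lim[OF x]] by (intro tendsto_intros)
    from LIMSEQ_unique[OF lim0 this] show ?thesis by simp
  qed
  have "(LINT x|leb01. h x) = 1"
  proof -
    have "\<bar>(LINT x|leb01. h x) - 1\<bar> \<le> (1 - c) ^ n * exp L" for n
    proof -
      have i: "integrable leb01 h" "integrable leb01 (g n)"
        using log_lipschitz_integrable[OF hl L_nonneg] log_lipschitz_integrable[OF glip L_nonneg] by auto
      have "(LINT x|leb01. h x) - 1 = (LINT x|leb01. h x - g n x)"
        using i gd[of n] by (simp add: densities_def)
      then have "\<bar>(LINT x|leb01. h x) - 1\<bar> \<le> (LINT x|leb01. \<bar>h x - g n x\<bar>)"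
        by (simp only: integral_abs_bound)
      also have "\<dots> \<le> (1 - c) ^ n * exp L"
        using i close by (intro abs_LINT_leb01_le AE_I2) (auto simp: abs_minus_commute)
      finally show ?thesis .
    qed
    then have "(\<lambda>n. (LINT x|leb01. h x) - 1) \<longlonglongrightarrow> 0"
      by (intro Lim_null_comparison[OF _ one_minus_c_power]) auto
    then show ?thesis by (simp add: LIMSEQ_const_iff)
  qed
  then have "h \<in> densities" using hl by (simp add: densities_def)
  then show ?thesis using that fixp by blast
qed

text \<open>Whatever log-Lipschitz constant one starts with, the contraction brings it below \<open>L\<close>.\<close>

lemma eventually_log_lipschitz:
  assumes h: "log_lipschitz L' h" "0 \<le> L'"
  shows "\<exists>n. log_lipschitz L ((transfer ^^ n) h)"
proof -
  have *: "log_lipschitz (max L ((3/4) ^ n * L')) ((transfer ^^ n) h)" for n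
  proof (induction n)
    case 0 then show ?case using log_lipschitz_mono[OF h(1), of "max L L'"] by simp
  next
    case (Suc n)
    let ?M = "max L ((3/4) ^ n * L')"
    have M: "0 \<le> ?M" using L_nonneg by simp
    have "\<theta> * ?M + D \<le> 1/4 * ?M + 1/2 * ?M"
      using theta_le M L_def D_nonneg by (intro add_mono mult_right_mono) auto
    also have "\<dots> \<le> max L ((3/4) ^ Suc n * L')" using L_nonneg by (auto simp: max_def)
    finally show ?case using log_lipschitz_mono[OF transfer_log_lipschitz[OF Suc M]] by simp
  qed
  have "(\<lambda>n. (3/4) ^ n * L') \<longlonglongrightarrow> 0"
    by (intro tendsto_mult_left_zero LIMSEQ_realpow_zero) auto
  moreover have "0 < L" using D_nonneg by (simp add: L_def)
  ultimately obtain n where "(3/4) ^ n * L' < L"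
    using order_tendstoD(2) by (fastforce simp: eventually_sequentially)
  then show ?thesis using *[of n] by (auto simp: max_def split: if_splits)
qed

lemma convergence_to_equilibrium:
  assumes h: "h \<in> densities" and fixp: "\<And>x. \<lbrakk>0 \<le> x; x \<le> 1\<rbrakk> \<Longrightarrow> transfer h x = h x"
    and k: "log_lipschitz L' k" "0 \<le> L'" and e: "0 < e"
  shows "\<exists>n0. \<forall>n\<ge>n0. \<forall>x\<in>{0..1}. \<bar>(transfer ^^ n) k x - (LINT t|leb01. k t) * h x\<bar> \<le> e"
proof -
  obtain m where m: "log_lipschitz L ((transfer ^^ m) k)" using eventually_log_lipschitz[OF k] by blast
  define K where "K = (LINT t|leb01. k t)"
  have Km: "(LINT x|leb01. (transfer ^^ m) k x) = K"
    unfolding K_def by (rule is_transfer_integral[OF is_transfer_power[OF k]])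
  have K: "0 < K"
  proof -
    have "exp (- L') * k 0 \<le> k x" if "0 \<le> x" "x \<le> 1" for x
      using log_lipschitz_le[OF k, of 0 x] that by (simp add: exp_minus field_simps)
    then have "(LINT x|leb01. exp (- L') * k 0) \<le> K"
      unfolding K_def using log_lipschitz_integrable[OF k] finite_measure_leb01
      by (intro integral_mono) (auto intro: finite_measure.integrable_const)
    moreover have "0 < exp (- L') * k 0" using log_lipschitzD(1)[OF k(1), of 0 0] by simp
    ultimately show ?thesis by simp
  qed
  define g where "g x = inverse K * (transfer ^^ m) k x" for x
  have "g = (\<lambda>x. inverse K * (transfer ^^ m) k x)" by (simp add: g_def fun_eq_iff)
  then have g: "g \<in> densities"
    using log_lipschitz_scale[OF m, of "inverse K"] K Km by (simp add: densities_def)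
  have hn: "(transfer ^^ n) h x = h x" if "0 \<le> x" "x \<le> 1" for n x
    by (rule transfer_power_fixed) (use fixp that in auto)
  have gn: "(transfer ^^ n) g x = inverse K * (transfer ^^ (n + m)) k x" if "0 \<le> x" "x \<le> 1" for n x
    using that
  proof (induction n arbitrary: x)
    case (Suc n)
    obtain M where M: "0 \<le> M" "log_lipschitz M ((transfer ^^ (n + m)) k)"
      using transfer_power_log_lipschitz[OF k] by blast
    have "transfer ((transfer ^^ n) g) x = transfer (\<lambda>x. inverse K * (transfer ^^ (n + m)) k x) x"
      using Suc by (intro transfer_cong) auto
    also have "\<dots> = inverse K * (transfer ^^ (Suc n + m)) k x"
      using transfer_mult[OF log_lipschitz_bounded[OF M(2,1)], of x] Suc by simp
    finally show ?case by simp
  qed (simp add: g_def)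
  have ek: "0 < e / K" using e K by simp
  obtain n1 where n1: "\<And>n. n \<ge> n1 \<Longrightarrow> (1 - c) ^ n * exp L < e / K"
    using order_tendstoD(2)[OF one_minus_c_power ek] by (auto simp: eventually_sequentially)
  have "\<bar>(transfer ^^ n) k x - K * h x\<bar> \<le> e" if n: "n \<ge> n1 + m" and x: "x \<in> {0..1}" for n x
  proof -
    obtain n' where n': "n = n' + m" "n' \<ge> n1" using n by (metis le_add_diff_inverse2 add_leD2 le_diff_conv2 add.commute add_le_imp_le_diff)
    have x': "0 \<le> x" "x \<le> 1" using x by auto
    have "\<bar>inverse K * (transfer ^^ n) k x - h x\<bar> \<le> e / K"
      using decay[OF g h x', of n'] n1[OF n'(2)] gn[OF x', of n'] hn[OF x', of n'] n'(1) by simp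
    then have "K * \<bar>inverse K * (transfer ^^ n) k x - h x\<bar> \<le> K * (e / K)" using K by (intro mult_left_mono) auto
    moreover have "K * \<bar>inverse K * (transfer ^^ n) k x - h x\<bar> = \<bar>(transfer ^^ n) k x - K * h x\<bar>"
    proof -
      have "K * \<bar>z\<bar> = \<bar>K * z\<bar>" for z using K by (simp add: abs_mult)
      then show ?thesis using K by (simp add: right_diff_distrib mult.assoc[symmetric])
    qed
    ultimately show ?thesis using K by simp
  qed
  then show ?thesis unfolding K_def by blast
qed

end

section \<open>Mixing\<close>

lemma abs_indicator_diff_le: "0 \<le> t \<and> t \<le> 1 \<Longrightarrow> \<bar>indicator B x - t\<bar> \<le> (1::real)"
  by (auto simp: indicator_def)

text \<open>By inner regularity \<open>B\<close> may be replaced by a closed subset, whose indicator is the limit of the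
  functions \<open>max 0 (1 - n * infdist x T)\<close>.\<close>

lemma lipschitz_approximation_of_indicator:
  assumes B: "B \<in> sets leb01" and e: "0 < (e::real)"
  shows "\<exists>\<psi> K. (\<forall>x. 0 \<le> \<psi> x \<and> \<psi> x \<le> (1::real)) \<and> 0 \<le> K \<and> (\<forall>x y. \<bar>\<psi> x - \<psi> y\<bar> \<le> K * \<bar>x - y\<bar>) \<and>
    (LINT x|leb01. \<bar>indicator B x - \<psi> x\<bar>) < e"
proof -
  have B': "B \<in> sets lebesgue" "B \<subseteq> {0..1}" using B by (auto simp: sets_restrict_space_iff)
  obtain T where T: "closed T" "T \<subseteq> B" "B - T \<in> lmeasurable" "emeasure lebesgue (B - T) < ennreal (e / 2)"
    using sets_lebesgue_inner_closed[OF B'(1), of "e / 2"] e by auto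
  have TS: "T \<in> sets leb01" using T(1,2) B' by (auto simp: sets_restrict_space_iff)
  have mBT: "measure leb01 (B - T) < e / 2"
  proof -
    have "measure leb01 (B - T) = measure lebesgue (B - T)"
      using B' T by (subst measure_restrict_space) auto
    also have "\<dots> < e / 2"
      using T(3,4) e by (simp add: emeasure_eq_measure2 ennreal_less_iff)
    finally show ?thesis .
  qed
  \<comment> \<open>The distance to the empty set is \<open>0\<close> by convention, hence the case distinction.\<close>
  define \<psi> where "\<psi> n x = (if T = {} then 0 else max 0 (1 - real n * infdist x T))" for n x
  have b: "0 \<le> \<psi> n x \<and> \<psi> n x \<le> 1" for n x by (auto simp: \<psi>_def infdist_nonneg)
  have l: "\<bar>\<psi> n x - \<psi> n y\<bar> \<le> real n * \<bar>x - y\<bar>" for n x y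
  proof -
    have "real n * \<bar>infdist x T - infdist y T\<bar> \<le> real n * \<bar>x - y\<bar>"
      using infdist_triangle_abs[of x T y] by (intro mult_left_mono) (auto simp: dist_real_def)
    then have "\<bar>real n * infdist x T - real n * infdist y T\<bar> \<le> real n * \<bar>x - y\<bar>"
      by (simp add: right_diff_distrib[symmetric] abs_mult)
    then show ?thesis by (auto simp: \<psi>_def max_def)
  qed
  have m: "\<psi> n \<in> borel_measurable leb01" for n
  proof -
    have "(real n)-lipschitz_on {0..1} (\<psi> n)"
      using l by (auto simp: lipschitz_on_def dist_real_def)
    then have "continuous_on {0..1} (\<psi> n)" by (rule lipschitz_on_continuous_on)
    then show ?thesis by (rule continuous_imp_measurable_on_sets_lebesgue) simp
  qed
  have lim: "(\<lambda>n. \<psi> n x) \<longlonglongrightarrow> indicator T x" for x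
  proof (cases "x \<in> T \<or> T = {}")
    case True
    then show ?thesis by (cases "T = {}") (auto simp: \<psi>_def[abs_def] infdist_zero)
  next
    case False
    then have d: "0 < infdist x T" using T(1) infdist_pos_not_in_closed by blast
    obtain n0 where n0: "1 < real n0 * infdist x T" using reals_Archimedean3[OF d] by blast
    have "\<psi> n x = 0" if "n0 \<le> n" for n
    proof -
      have "real n0 * infdist x T \<le> real n * infdist x T" using that d by (intro mult_right_mono) auto
      then show ?thesis using n0 by (simp add: \<psi>_def max_def)
    qed
    then have "eventually (\<lambda>n. \<psi> n x = 0) sequentially" by (auto simp: eventually_sequentially)
    then show ?thesis using False by (simp add: tendsto_eventually)
  qed
  have "(\<lambda>n. LINT x|leb01. \<bar>indicator T x - \<psi> n x\<bar>) \<longlonglongrightarrow> (LINT x|leb01. 0)"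
  proof (rule integral_dominated_convergence[where w = "\<lambda>_. 1"])
    show "AE x in leb01. (\<lambda>n. \<bar>indicator T x - \<psi> n x\<bar>) \<longlonglongrightarrow> 0"
    proof (rule AE_I2)
      fix x show "(\<lambda>n. \<bar>indicator T x - \<psi> n x\<bar>) \<longlonglongrightarrow> 0"
        using tendsto_rabs[OF tendsto_diff[OF tendsto_const lim[of x], of "indicator T x"]] by simp
    qed
    show "AE x in leb01. norm \<bar>indicator T x - \<psi> n x\<bar> \<le> 1" for n
      using abs_indicator_diff_le[OF b] by (intro AE_I2) simp
    show "integrable leb01 (\<lambda>_. 1::real)" by (rule finite_measure.integrable_const[OF finite_measure_leb01])
    show "(\<lambda>x. \<bar>indicator T x - \<psi> n x\<bar>) \<in> borel_measurable leb01" for n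
      using m[of n] TS by measurable
  qed simp
  then obtain n where n: "(LINT x|leb01. \<bar>indicator T x - \<psi> n x\<bar>) < e / 2"
    using order_tendstoD(2)[of _ 0 sequentially "e / 2"] e by (auto simp: eventually_sequentially)
  have BT: "B - T \<in> sets leb01" using B TS by auto
  have iB: "integrable leb01 (indicator (B - T) :: real \<Rightarrow> real)"
    using BT finite_measure.emeasure_finite[OF finite_measure_leb01, of "B - T"]
    by (intro integrable_real_indicator) (auto simp: less_top)
  have i1: "integrable leb01 (\<lambda>x. \<bar>indicator T x - \<psi> n x\<bar>)"
    using m[of n] TS abs_indicator_diff_le[OF b] by (intro integrable_leb01_bounded[of _ 1] AE_I2) auto
  have i2: "integrable leb01 (\<lambda>x. \<bar>indicator B x - \<psi> n x\<bar>)"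
    using m[of n] B abs_indicator_diff_le[OF b] by (intro integrable_leb01_bounded[of _ 1] AE_I2) auto
  have "(LINT x|leb01. \<bar>indicator B x - \<psi> n x\<bar>)
      \<le> (LINT x|leb01. indicator (B - T) x + \<bar>indicator T x - \<psi> n x\<bar>)"
  proof (rule integral_mono[OF i2 Bochner_Integration.integrable_add[OF iB i1]])
    fix x show "\<bar>indicator B x - \<psi> n x\<bar> \<le> indicator (B - T) x + \<bar>indicator T x - \<psi> n x\<bar>"
      using b[of n x] T(2) by (auto simp: indicator_def)
  qed
  also have "\<dots> = measure leb01 (B - T) + (LINT x|leb01. \<bar>indicator T x - \<psi> n x\<bar>)"
    using i1 iB BT T(2) B'(2) by (subst Bochner_Integration.integral_add) (auto simp: Int_absorb2 subset_iff)
  also have "\<dots> < e" using mBT n by simp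
  finally have "(LINT x|leb01. \<bar>indicator B x - \<psi> n x\<bar>) < e" .
  then show ?thesis using b l by (intro exI[of _ "\<psi> n"] exI[of _ "real n"]) auto
qed

context strongly_contracting_system
begin

text \<open>By duality the iterates of \<open>f\<close> are moved to iterates of the operator applied to \<open>k\<close>, which
  converge uniformly.\<close>

lemma correlation_lipschitz:
  assumes h: "h \<in> densities" and fixp: "\<And>x. \<lbrakk>0 \<le> x; x \<le> 1\<rbrakk> \<Longrightarrow> transfer h x = h x"
    and k: "log_lipschitz L' k" "0 \<le> L'"
    and \<phi>: "\<phi> \<in> borel_measurable leb01" "AE x in leb01. \<bar>\<phi> x\<bar> \<le> C"
  shows "(\<lambda>n. LINT x|leb01. \<phi> ((f ^^ n) x) * k x)
    \<longlonglongrightarrow> (LINT x|leb01. k x) * (LINT x|leb01. \<phi> x * h x)"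
proof (rule LIMSEQ_I)
  fix r :: real assume r: "0 < r"
  define K where "K = (LINT x|leb01. k x)"
  define e where "e = r / (2 * (\<bar>C\<bar> + 1))"
  have e: "0 < e" using r by (simp add: e_def)
  obtain n0 where n0: "\<And>n x. n \<ge> n0 \<Longrightarrow> x \<in> {0..1} \<Longrightarrow> \<bar>(transfer ^^ n) k x - K * h x\<bar> \<le> e"
    using convergence_to_equilibrium[OF h fixp k e] unfolding K_def by blast
  have hi: "integrable leb01 h" using h log_lipschitz_integrable[OF _ L_nonneg] by (auto simp: densities_def)
  have "norm ((LINT x|leb01. \<phi> ((f ^^ n) x) * k x) - K * (LINT x|leb01. \<phi> x * h x)) < r"
    if n: "n \<ge> n0" for n
  proof -
    have T: "is_transfer (f ^^ n) k ((transfer ^^ n) k)" by (rule is_transfer_power[OF k])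
    then have Ti: "integrable leb01 ((transfer ^^ n) k)" by (simp add: is_transfer_def)
    note i1 = integrable_bounded_mult[OF \<phi> Ti] and i2 = integrable_bounded_mult[OF \<phi> hi]
    have i3: "integrable leb01 (\<lambda>x. \<phi> x * ((transfer ^^ n) k x - K * h x))"
      by (rule integrable_bounded_mult[OF \<phi>]) (use Ti hi in auto)
    have "(LINT x|leb01. \<phi> ((f ^^ n) x) * k x) - K * (LINT x|leb01. \<phi> x * h x)
        = (LINT x|leb01. \<phi> x * (transfer ^^ n) k x) - (LINT x|leb01. K * (\<phi> x * h x))"
      using is_transferD[OF T \<phi>] by simp
    also have "\<dots> = (LINT x|leb01. \<phi> x * ((transfer ^^ n) k x - K * h x))"
      using i1 i2 by (subst Bochner_Integration.integral_diff[symmetric]) (auto simp: algebra_simps)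
    finally have "\<bar>(LINT x|leb01. \<phi> ((f ^^ n) x) * k x) - K * (LINT x|leb01. \<phi> x * h x)\<bar>
        \<le> (LINT x|leb01. \<bar>\<phi> x * ((transfer ^^ n) k x - K * h x)\<bar>)"
      by (simp only: integral_abs_bound)
    also have "\<dots> \<le> \<bar>C\<bar> * e"
    proof (rule abs_LINT_leb01_le)
      show "AE x in leb01. \<bar>\<phi> x * ((transfer ^^ n) k x - K * h x)\<bar> \<le> \<bar>C\<bar> * e"
        using \<phi>(2) AE_leb01_mem
      proof eventually_elim
        case (elim x)
        then show ?case using n0[OF n, of x] unfolding abs_mult by (intro mult_mono) auto
      qed
    qed (use i3 in auto)
    also have "\<dots> < r"
    proof -
      have "\<bar>C\<bar> * e < 2 * (\<bar>C\<bar> + 1) * e" using e by (intro mult_strict_right_mono) auto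
      also have "\<dots> = r" by (simp add: e_def)
      finally show ?thesis .
    qed
    finally show ?thesis by simp
  qed
  then show "\<exists>n0. \<forall>n\<ge>n0. norm ((LINT x|leb01. \<phi> ((f ^^ n) x) * k x)
      - (LINT x|leb01. k x) * (LINT x|leb01. \<phi> x * h x)) < r"
    unfolding K_def by blast
qed

lemma comp_measurable_power: "\<phi> \<in> borel_measurable leb01 \<Longrightarrow> (\<lambda>x. \<phi> ((f ^^ n) x)) \<in> borel_measurable leb01"
  for \<phi> :: "real \<Rightarrow> real"
proof (induction n)
  case (Suc n)
  then show ?case using comp_measurable[OF Suc.IH] by (simp add: funpow_swap1)
qed simp

lemma AE_comp_power: "AE x in leb01. P x \<Longrightarrow> AE x in leb01. P ((f ^^ n) x)"
proof (induction n)
  case (Suc n)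
  then show ?case using AE_comp[OF Suc.IH] by (simp add: funpow_swap1)
qed simp

text \<open>Indicators are approximated by Lipschitz functions \<open>\<psi>\<close>; the two functions
  \<open>(\<psi> + 1) h\<close> and \<open>h\<close> are log-Lipschitz, and so decay applies to their difference \<open>\<psi> h\<close>.\<close>

lemma correlation_decay:
  assumes h: "h \<in> densities" and fixp: "\<And>x. \<lbrakk>0 \<le> x; x \<le> 1\<rbrakk> \<Longrightarrow> transfer h x = h x"
    and \<phi>: "\<phi> \<in> borel_measurable leb01" "AE x in leb01. \<bar>\<phi> x\<bar> \<le> C" and B: "B \<in> sets leb01"
  shows "(\<lambda>n. LINT x|leb01. \<phi> ((f ^^ n) x) * (indicator B x * h x))
    \<longlonglongrightarrow> (LINT x|leb01. indicator B x * h x) * (LINT x|leb01. \<phi> x * h x)"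
proof (rule LIMSEQ_I)
  fix r :: real assume r: "0 < r"
  have hl: "log_lipschitz L h" using h by (simp add: densities_def)
  note hi = log_lipschitz_integrable[OF hl L_nonneg]
  have hm: "h \<in> borel_measurable leb01" using hi by simp
  have hb: "AE x in leb01. \<bar>h x\<bar> \<le> exp L" using densities_abs_le[OF h] by (intro AE_I2) auto
  have C: "0 \<le> \<bar>C\<bar>" by simp
  define e where "e = r / (4 * (\<bar>C\<bar> + 1) * exp L)"
  have e: "0 < e" using r by (simp add: e_def)
  obtain \<psi> K where \<psi>: "\<And>x. 0 \<le> \<psi> x \<and> \<psi> x \<le> 1" "0 \<le> K" "\<And>x y. \<bar>\<psi> x - \<psi> y\<bar> \<le> K * \<bar>x - y\<bar>"
      "(LINT x|leb01. \<bar>indicator B x - \<psi> x\<bar>) < e"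
    using lipschitz_approximation_of_indicator[OF B e] by blast
  have pl: "log_lipschitz K (\<lambda>x. \<psi> x + 1)"
    unfolding log_lipschitz_def
  proof (intro conjI ballI)
    fix x y :: real
    show "0 < \<psi> x + 1" using \<psi>(1)[of x] by simp
    have "\<psi> x + 1 \<le> \<psi> y + 1 + K * \<bar>x - y\<bar>" using \<psi>(3)[of x y] by simp
    also have "\<dots> \<le> (1 + K * \<bar>x - y\<bar>) * (\<psi> y + 1)"
      using \<psi>(1)[of y] \<psi>(2) by (simp add: algebra_simps)
    also have "\<dots> \<le> exp (K * \<bar>x - y\<bar>) * (\<psi> y + 1)"
      using \<psi>(1)[of y] exp_ge_add_one_self[of "K * \<bar>x - y\<bar>"] by (intro mult_right_mono) auto
    finally show "\<psi> x + 1 \<le> exp (K * \<bar>x - y\<bar>) * (\<psi> y + 1)" .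
  qed
  have \<psi>m: "\<psi> \<in> borel_measurable leb01"
  proof -
    have "(\<lambda>x. (\<psi> x + 1) - 1) \<in> borel_measurable leb01"
      using log_lipschitz_measurable[OF pl \<psi>(2)] by (intro borel_measurable_diff) auto
    then show ?thesis by simp
  qed
  have ph: "log_lipschitz (K + L) (\<lambda>x. (\<psi> x + 1) * h x)" by (rule log_lipschitz_mult[OF pl hl])
  have KL: "0 \<le> K + L" using \<psi>(2) L_nonneg by simp
  note i1 = log_lipschitz_integrable[OF ph KL]
  have i2: "integrable leb01 (\<lambda>x. \<psi> x * h x)"
    using \<psi>(1) by (intro integrable_bounded_mult[OF \<psi>m _ hi, of 1] AE_I2) auto
  have i3: "integrable leb01 (\<lambda>x. indicator B x * h x)"
    using integrable_mult_indicator[OF B hi] by simp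
  note \<phi>n = comp_measurable_power[OF \<phi>(1)] AE_comp_power[OF \<phi>(2)]
  have eq: "(LINT x|leb01. \<phi> ((f ^^ n) x) * ((\<psi> x + 1) * h x)) - (LINT x|leb01. \<phi> ((f ^^ n) x) * h x)
      = (LINT x|leb01. \<phi> ((f ^^ n) x) * (\<psi> x * h x))" for n
    using integrable_bounded_mult[OF \<phi>n i1, of n] integrable_bounded_mult[OF \<phi>n hi, of n]
    by (subst Bochner_Integration.integral_diff[symmetric]) (auto simp: algebra_simps)
  have eq0: "(LINT x|leb01. (\<psi> x + 1) * h x) - (LINT x|leb01. h x) = (LINT x|leb01. \<psi> x * h x)"
    using i1 hi by (subst Bochner_Integration.integral_diff[symmetric]) (auto simp: algebra_simps)
  define J where "J = (LINT x|leb01. \<phi> x * h x)"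
  have "(\<lambda>n. LINT x|leb01. \<phi> ((f ^^ n) x) * (\<psi> x * h x)) \<longlonglongrightarrow> (LINT x|leb01. \<psi> x * h x) * J"
    using tendsto_diff[OF correlation_lipschitz[OF h fixp ph KL \<phi>] correlation_lipschitz[OF h fixp hl L_nonneg \<phi>]]
    unfolding eq left_diff_distrib[symmetric] eq0 J_def .
  from LIMSEQ_D[OF this, of "r / 2"] r obtain n0 where n0: "\<forall>n\<ge>n0.
      norm ((LINT x|leb01. \<phi> ((f ^^ n) x) * (\<psi> x * h x)) - (LINT x|leb01. \<psi> x * h x) * J) < r / 2"
    by auto
  have diff: "(LINT x|leb01. \<bar>indicator B x * h x - \<psi> x * h x\<bar>) \<le> exp L * e"
  proof -
    have "(LINT x|leb01. \<bar>indicator B x * h x - \<psi> x * h x\<bar>)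
        \<le> (LINT x|leb01. exp L * \<bar>indicator B x - \<psi> x\<bar>)"
    proof (rule integral_mono_AE)
      show "AE x in leb01. \<bar>indicator B x * h x - \<psi> x * h x\<bar> \<le> exp L * \<bar>indicator B x - \<psi> x\<bar>"
        using hb
      proof eventually_elim
        case (elim x)
        then have "\<bar>h x\<bar> * \<bar>indicator B x - \<psi> x\<bar> \<le> exp L * \<bar>indicator B x - \<psi> x\<bar>"
          by (intro mult_right_mono) auto
        moreover have "indicator B x * h x - \<psi> x * h x = h x * (indicator B x - \<psi> x)"
          by (simp add: right_diff_distrib mult.commute)
        ultimately show ?case by (simp add: abs_mult)
      qed
      show "integrable leb01 (\<lambda>x. exp L * \<bar>indicator B x - \<psi> x\<bar>)"
        using B \<psi>m abs_indicator_diff_le[OF \<psi>(1)[rule_format]]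
        by (intro integrable_mult_right integrable_leb01_bounded[of _ 1] AE_I2) auto
    qed (use i2 i3 in auto)
    also have "\<dots> \<le> exp L * e" using \<psi>(4) by (simp add: less_imp_le)
    finally show ?thesis .
  qed
  have close: "\<bar>(LINT x|leb01. \<eta> x * (indicator B x * h x)) - (LINT x|leb01. \<eta> x * (\<psi> x * h x))\<bar>
      \<le> M * (exp L * e)" if \<eta>: "\<eta> \<in> borel_measurable leb01" "AE x in leb01. \<bar>\<eta> x\<bar> \<le> M" "0 \<le> M" for \<eta> M
  proof -
    note j = integrable_bounded_mult[OF \<eta>(1,2) i3] integrable_bounded_mult[OF \<eta>(1,2) i2]
    have "(LINT x|leb01. \<eta> x * (indicator B x * h x)) - (LINT x|leb01. \<eta> x * (\<psi> x * h x))
       = (LINT x|leb01. \<eta> x * (indicator B x * h x) - \<eta> x * (\<psi> x * h x))"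
      using j by simp
    then have "\<bar>(LINT x|leb01. \<eta> x * (indicator B x * h x)) - (LINT x|leb01. \<eta> x * (\<psi> x * h x))\<bar>
        \<le> (LINT x|leb01. \<bar>\<eta> x * (indicator B x * h x) - \<eta> x * (\<psi> x * h x)\<bar>)"
      by (simp only: integral_abs_bound)
    also have "\<dots> \<le> (LINT x|leb01. M * \<bar>indicator B x * h x - \<psi> x * h x\<bar>)"
    proof (rule integral_mono_AE)
      show "AE x in leb01. \<bar>\<eta> x * (indicator B x * h x) - \<eta> x * (\<psi> x * h x)\<bar>
          \<le> M * \<bar>indicator B x * h x - \<psi> x * h x\<bar>"
        using \<eta>(2) unfolding right_diff_distrib[symmetric] abs_mult
        by eventually_elim (rule mult_right_mono, auto)
    qed (use i2 i3 j in auto)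
    also have "\<dots> = M * (LINT x|leb01. \<bar>indicator B x * h x - \<psi> x * h x\<bar>)" by simp
    also have "\<dots> \<le> M * (exp L * e)" using diff \<eta>(3) by (rule mult_left_mono)
    finally show ?thesis .
  qed
  have J: "\<bar>J\<bar> \<le> \<bar>C\<bar>"
  proof -
    have "\<bar>J\<bar> \<le> (LINT x|leb01. \<bar>\<phi> x * h x\<bar>)" unfolding J_def by (rule integral_abs_bound)
    also have "\<dots> \<le> (LINT x|leb01. \<bar>C\<bar> * h x)"
    proof (rule integral_mono_AE)
      show "AE x in leb01. \<bar>\<phi> x * h x\<bar> \<le> \<bar>C\<bar> * h x"
        using \<phi>(2) AE_leb01_mem
      proof eventually_elim
        case (elim x)
        have "0 < h x" using densities_bounds(3)[OF h] elim(2) by auto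
        then show ?case using elim(1) by (auto simp: abs_mult intro!: mult_right_mono)
      qed
    qed (use integrable_bounded_mult[OF \<phi> hi] hi in auto)
    also have "\<dots> = \<bar>C\<bar>" using h by (simp add: densities_def)
    finally show ?thesis .
  qed
  have small: "2 * (\<bar>C\<bar> * (exp L * e)) < r / 2"
  proof -
    have "\<bar>C\<bar> * (exp L * e) < (\<bar>C\<bar> + 1) * (exp L * e)" using e by (intro mult_strict_right_mono) auto
    also have "\<dots> = r / 4"
    proof -
      have "x * (y * (r / (4 * x * y))) = r / 4" if "x > 0" "y > 0" for x y
        using that by (simp add: field_simps)
      from this[of "\<bar>C\<bar> + 1" "exp L"] show ?thesis by (simp add: e_def)
    qed
    finally show ?thesis by simp
  qed
  have "norm ((LINT x|leb01. \<phi> ((f ^^ n) x) * (indicator B x * h x))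
      - (LINT x|leb01. indicator B x * h x) * J) < r" if n: "n \<ge> n0" for n
  proof -
    have "AE x in leb01. \<bar>\<phi> ((f ^^ n) x)\<bar> \<le> \<bar>C\<bar>" using \<phi>n(2)[of n] by eventually_elim simp
    from close[OF \<phi>n(1) this C]
    have 1: "\<bar>(LINT x|leb01. \<phi> ((f ^^ n) x) * (indicator B x * h x))
        - (LINT x|leb01. \<phi> ((f ^^ n) x) * (\<psi> x * h x))\<bar> \<le> \<bar>C\<bar> * (exp L * e)" .
    have 2: "\<bar>(LINT x|leb01. indicator B x * h x) - (LINT x|leb01. \<psi> x * h x)\<bar> \<le> exp L * e"
      using close[of "\<lambda>_. 1" 1] by simp
    have "\<bar>(LINT x|leb01. indicator B x * h x) * J - (LINT x|leb01. \<psi> x * h x) * J\<bar> \<le> (exp L * e) * \<bar>C\<bar>"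
      unfolding left_diff_distrib[symmetric] abs_mult using 2 J e by (intro mult_mono) auto
    then have 3: "\<bar>(LINT x|leb01. indicator B x * h x) * J - (LINT x|leb01. \<psi> x * h x) * J\<bar>
        \<le> \<bar>C\<bar> * (exp L * e)" by (simp only: mult.commute)
    have 4: "\<bar>(LINT x|leb01. \<phi> ((f ^^ n) x) * (\<psi> x * h x)) - (LINT x|leb01. \<psi> x * h x) * J\<bar> < r / 2"
      using n0 n by simp
    show ?thesis unfolding real_norm_def using 1 3 4 small by linarith
  qed
  then show "\<exists>n0. \<forall>n\<ge>n0. norm ((LINT x|leb01. \<phi> ((f ^^ n) x) * (indicator B x * h x))
      - (LINT x|leb01. indicator B x * h x) * (LINT x|leb01. \<phi> x * h x)) < r"
    unfolding J_def by blast
qed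

end

lemma LIMSEQ_of_residue_classes:
  fixes I :: "nat \<Rightarrow> real"
  assumes p: "1 \<le> p" and r: "\<And>r. r < p \<Longrightarrow> (\<lambda>q. I (p * q + r)) \<longlonglongrightarrow> l"
  shows "I \<longlonglongrightarrow> l"
proof (rule LIMSEQ_I)
  fix e :: real assume "0 < e"
  then have "\<forall>r<p. \<exists>q0. \<forall>q\<ge>q0. norm (I (p * q + r) - l) < e" using LIMSEQ_D[OF r] by blast
  then obtain q0 where q0: "\<And>r q. \<lbrakk>r < p; q \<ge> q0 r\<rbrakk> \<Longrightarrow> norm (I (p * q + r) - l) < e" by metis
  define Q where "Q = Max (q0 ` {..<p})"
  have "norm (I n - l) < e" if n: "n \<ge> p * Q" for n
  proof -
    have "n mod p < p" using p by simp
    moreover have "q0 (n mod p) \<le> n div p"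
    proof -
      have "q0 (n mod p) \<le> Q" unfolding Q_def using p by (intro Max_ge) auto
      also have "Q \<le> n div p" using n p by (metis div_le_mono div_mult_self1_is_m less_eq_Suc_le One_nat_def)
      finally show ?thesis .
    qed
    ultimately have "norm (I (p * (n div p) + n mod p) - l) < e" by (rule q0)
    then show ?thesis by simp
  qed
  then show "\<exists>n0. \<forall>n\<ge>n0. norm (I n - l) < e" by blast
qed

text \<open>Mixing of \<open>f\<close> is deduced from decay of correlations for a power \<open>f\<^sup>p\<close> with strong contraction.
  The fixed density of \<open>f\<^sup>p\<close> is the only one that \<open>f\<^sup>p\<close> has, hence it is also fixed by \<open>f\<close>, as \<open>f\<close>
  commutes with \<open>f\<^sup>p\<close>.\<close>

lemma exists_mixing_density:
  assumes F: "full_branch_system N a b f \<sigma> \<gamma> w \<theta> D" and p: "1 \<le> p"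
    and S: "strongly_contracting_system N' a' b' (f ^^ p) \<sigma>' \<gamma>' w' \<theta>' D'"
  shows "\<exists>h\<in>BV. (AE x in leb01. frobenius_perron f h x = h x) \<and> (AE x in leb01. 0 \<le> h x) \<and>
    prob_space (density leb01 (\<lambda>x. ennreal (h x))) \<and>
    mixing_measure (density leb01 (\<lambda>x. ennreal (h x))) f"
proof -
  interpret F: full_branch_system N a b f \<sigma> \<gamma> w \<theta> D by fact
  interpret S: strongly_contracting_system N' a' b' "f ^^ p" \<sigma>' \<gamma>' w' \<theta>' D' by fact
  obtain h where h: "h \<in> S.densities" "\<And>x. \<lbrakk>0 \<le> x; x \<le> 1\<rbrakk> \<Longrightarrow> S.transfer h x = h x"
    using S.fixed_density by blast
  have hl: "log_lipschitz S.L h" and h1: "(LINT x|leb01. h x) = 1" using h(1) by (auto simp: S.densities_def)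
  note L0 = S.L_nonneg
  have hi: "integrable leb01 h" by (rule log_lipschitz_integrable[OF hl L0])
  have hm: "h \<in> borel_measurable leb01" using hi by simp
  have hBV: "h \<in> BV" by (rule log_lipschitz_BV[OF hl L0])
  have hnn: "AE x in leb01. 0 \<le> h x"
    using S.densities_bounds(3)[OF h(1)] by (intro AE_I2) (auto simp: less_imp_le)
  define k where "k = F.transfer h"
  define L' where "L' = \<theta> * S.L + D"
  have L': "0 \<le> L'" using L0 F.theta_pos F.D_nonneg by (simp add: L'_def)
  have kl: "log_lipschitz L' k" unfolding k_def L'_def by (rule F.transfer_log_lipschitz[OF hl L0])
  have fk: "is_transfer f h k" unfolding k_def by (rule F.log_lipschitz_is_transfer[OF hl L0])
  have k1: "(LINT x|leb01. k x) = 1" using is_transfer_integral[OF fk] h1 by simp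
  have Tn: "AE x in leb01. (S.transfer ^^ n) k x = k x" for n
  proof -
    have "AE x in leb01. (S.transfer ^^ n) h x = h x"
      by (intro AE_I2 S.transfer_power_fixed) (use h(2) in auto)
    then have "is_transfer ((f ^^ p) ^^ n) h h" by (rule is_transfer_cong_right[OF S.is_transfer_power[OF hl L0]])
    then have A: "is_transfer (f \<circ> (f ^^ p) ^^ n) h k" by (rule F.is_transfer_compose[OF _ fk])
    have B: "is_transfer ((f ^^ p) ^^ n \<circ> f) h ((S.transfer ^^ n) k)"
    proof (induction n)
      case 0
      then show ?case using fk by simp
    next
      case (Suc n)
      obtain M where M: "0 \<le> M" "log_lipschitz M ((S.transfer ^^ n) k)"
        using S.transfer_power_log_lipschitz[OF kl L'] by blast
      show ?case
        using S.is_transfer_compose[OF Suc S.log_lipschitz_is_transfer[OF M(2,1)]]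
        by (simp add: comp_def)
    qed
    have "f \<circ> (f ^^ p) ^^ n = (f ^^ p) ^^ n \<circ> f"
      by (simp add: funpow_mult fun_eq_iff funpow_swap1)
    then show ?thesis using is_transfer_unique[OF B] A by simp
  qed
  have kh: "AE x in leb01. k x = h x"
  proof -
    have "AE x in leb01. \<forall>n. (S.transfer ^^ n) k x = k x" using Tn by (simp add: AE_all_countable)
    then show ?thesis using AE_leb01_mem
    proof eventually_elim
      case (elim x)
      have "\<bar>k x - h x\<bar> \<le> e" if "0 < e" for e
        using S.convergence_to_equilibrium[OF h kl L' that] elim k1 by (metis mult_1 order_refl)
      then have "\<bar>k x - h x\<bar> \<le> 0" using field_le_epsilon[of "\<bar>k x - h x\<bar>" 0] by simp
      then show ?case by simp
    qed
  qed
  have fh: "is_transfer f h h" by (rule is_transfer_cong_right[OF fk kh])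
  have FP: "AE x in leb01. frobenius_perron f h x = h x"
    by (rule is_transfer_unique[OF F.frobenius_perron_transfer[OF hBV] fh])
  let ?M = "density leb01 (\<lambda>x. ennreal (h x))"
  have em: "emeasure ?M A = ennreal (LINT x|leb01. indicator A x * h x)" if A: "A \<in> sets leb01" for A
  proof -
    have "emeasure ?M A = (\<integral>\<^sup>+ x. ennreal (h x) * indicator A x \<partial>leb01)"
      using A hm by (intro emeasure_density) auto
    also have "\<dots> = (\<integral>\<^sup>+ x. ennreal (indicator A x * h x) \<partial>leb01)"
      by (intro nn_integral_cong) (auto simp: indicator_def)
    also have "\<dots> = ennreal (LINT x|leb01. indicator A x * h x)"
      using integrable_mult_indicator[OF A hi] hnn
      by (intro nn_integral_eq_integral) (auto simp: indicator_def)
    finally show ?thesis .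
  qed
  have nn: "0 \<le> (LINT x|leb01. indicator A x * h x)" for A
    using hnn by (intro integral_nonneg_AE) (auto simp: indicator_def)
  have me: "measure ?M A = (LINT x|leb01. indicator A x * h x)" if A: "A \<in> sets leb01" for A
    using em[OF A] nn by (simp add: measure_def)
  have prob: "prob_space ?M"
  proof
    have "emeasure ?M {0..1} = ennreal (LINT x|leb01. indicator {0..1} x * h x)"
      by (rule em) (metis sets.top space_lebesgue_on)
    also have "(LINT x|leb01. indicator {0..1} x * h x) = (LINT x|leb01. h x)"
      by (rule Bochner_Integration.integral_cong) auto
    finally show "emeasure ?M (space ?M) = 1" using h1 by simp
  qed
  have vim: "(\<lambda>x. indicator A (f x) :: real) \<in> borel_measurable leb01" if "A \<in> sets leb01" for A
    using that by (intro F.comp_measurable) auto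
  have meas: "f -` A \<inter> {0..1} \<in> sets leb01" if A: "A \<in> sets leb01" for A
  proof -
    have "(\<lambda>x. indicator A (f x) :: real) -` {1} \<inter> space leb01 \<in> sets leb01"
      by (rule measurable_sets[OF vim[OF A]]) simp
    moreover have "(\<lambda>x. indicator A (f x) :: real) -` {1} \<inter> space leb01 = f -` A \<inter> {0..1}"
      by (auto simp: indicator_def split: if_splits)
    ultimately show ?thesis by simp
  qed
  have one: "AE x in leb01. \<bar>indicator A x :: real\<bar> \<le> 1" for A by (intro AE_I2) (auto simp: indicator_def)
  have inv: "(LINT x|leb01. \<phi> (f x) * h x) = (LINT x|leb01. \<phi> x * h x)"
    if "\<phi> \<in> borel_measurable leb01" "AE x in leb01. \<bar>\<phi> x\<bar> \<le> 1" for \<phi>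
    using is_transferD[OF fh that] by simp
  have mix: "mixing_measure ?M f"
    unfolding mixing_measure_def
  proof (intro conjI ballI)
    fix A assume "A \<in> sets ?M"
    then have A: "A \<in> sets leb01" by simp
    show "f -` A \<inter> space ?M \<in> sets ?M" using meas[OF A] by simp
    have "emeasure ?M (f -` A \<inter> {0..1}) = ennreal (LINT x|leb01. indicator (f -` A \<inter> {0..1}) x * h x)"
      by (rule em[OF meas[OF A]])
    also have "(LINT x|leb01. indicator (f -` A \<inter> {0..1}) x * h x) = (LINT x|leb01. indicator A (f x) * h x)"
      by (rule Bochner_Integration.integral_cong) (auto simp: indicator_def)
    also have "\<dots> = (LINT x|leb01. indicator A x * h x)"
      using A by (intro inv one) auto
    finally show "emeasure ?M (f -` A \<inter> space ?M) = emeasure ?M A" using em[OF A] by simp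
  next
    fix A B assume "A \<in> sets ?M" "B \<in> sets ?M"
    then have A: "A \<in> sets leb01" and B: "B \<in> sets leb01" by auto
    have B01: "B \<subseteq> {0..1}" using sets.sets_into_space[OF B] by simp
    define \<phi> where "\<phi> r x = (indicator A ((f ^^ r) x) :: real)" for r x
    have \<phi>m: "\<phi> r \<in> borel_measurable leb01" for r
    proof (induction r)
      case 0 then show ?case using A unfolding \<phi>_def by simp
    next
      case (Suc r)
      then show ?case using F.comp_measurable[OF Suc] by (simp add: \<phi>_def funpow_swap1)
    qed
    have \<phi>1: "AE x in leb01. \<bar>\<phi> r x\<bar> \<le> 1" for r by (intro AE_I2) (auto simp: \<phi>_def indicator_def)
    have \<phi>h: "(LINT x|leb01. \<phi> r x * h x) = measure ?M A" for r
    proof (induction r)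
      case 0 then show ?case using me[OF A] by (simp add: \<phi>_def)
    next
      case (Suc r)
      have "(LINT x|leb01. \<phi> (Suc r) x * h x) = (LINT x|leb01. \<phi> r (f x) * h x)"
        by (simp add: \<phi>_def funpow_swap1)
      then show ?case using inv[OF \<phi>m \<phi>1] Suc by simp
    qed
    have "(f ^^ n) -` A \<inter> B \<in> sets leb01" for n
    proof -
      have "\<phi> n -` {1} \<inter> space leb01 \<in> sets leb01" by (rule measurable_sets[OF \<phi>m]) simp
      then have "(\<phi> n -` {1} \<inter> space leb01) \<inter> B \<in> sets leb01" using B by (rule sets.Int)
      moreover have "(\<phi> n -` {1} \<inter> space leb01) \<inter> B = (f ^^ n) -` A \<inter> B"
        using B01 by (auto simp: \<phi>_def indicator_def split: if_splits)
      ultimately show ?thesis by simp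
    qed
    then have "measure ?M ((f ^^ n) -` A \<inter> B) = (LINT x|leb01. indicator ((f ^^ n) -` A \<inter> B) x * h x)" for n
      by (rule me)
    moreover have "(LINT x|leb01. indicator ((f ^^ n) -` A \<inter> B) x * h x)
        = (LINT x|leb01. \<phi> n x * (indicator B x * h x))" for n
      by (rule Bochner_Integration.integral_cong) (auto simp: \<phi>_def indicator_def)
    ultimately have eq: "measure ?M ((f ^^ n) -` A \<inter> B) = (LINT x|leb01. \<phi> n x * (indicator B x * h x))" for n
      by simp
    show "(\<lambda>n. measure ?M ((f ^^ n) -` A \<inter> B)) \<longlonglongrightarrow> measure ?M A * measure ?M B"
      unfolding eq
    proof (rule LIMSEQ_of_residue_classes[OF p])
      fix r
      have e: "\<phi> (p * q + r) x = \<phi> r (((f ^^ p) ^^ q) x)" for q x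
      proof -
        have "f ^^ (p * q + r) = f ^^ r \<circ> (f ^^ p) ^^ q"
          by (simp add: funpow_mult funpow_add[symmetric] add.commute mult.commute)
        then show ?thesis by (simp add: \<phi>_def)
      qed
      show "(\<lambda>q. LINT x|leb01. \<phi> (p * q + r) x * (indicator B x * h x)) \<longlonglongrightarrow> measure ?M A * measure ?M B"
        using S.correlation_decay[OF h \<phi>m \<phi>1 B, of r] unfolding e \<phi>h me[OF B, symmetric]
        by (simp add: mult.commute)
    qed
  qed
  show ?thesis using hBV FP hnn prob mix by blast
qed

section \<open>Uniform Lasota--Yorke constants\<close>

text \<open>Every \<open>p\<close> steps halve \<open>V\<close> up to a multiple of \<open>l\<close>, and the fewer than \<open>p\<close> remaining steps cost a
  bounded factor; \<open>root p (1/2)\<close> is the rate per step that halves in \<open>p\<close> steps.\<close>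

lemma lasota_yorke_recursion:
  fixes V :: "nat \<Rightarrow> real"
  assumes p: "1 \<le> p" and A: "1 \<le> A" and B: "0 \<le> B" "0 \<le> B'" and l: "0 \<le> l"
    and V: "\<And>n. 0 \<le> V n" and step: "\<And>n. V (Suc n) \<le> A * V n + B * l"
    and contract: "\<And>n. V (n + p) \<le> V n / 2 + B' * l"
  shows "V n \<le> 2 * A ^ p * root p (1/2) ^ n * V 0 + (real p * A ^ p * B + 2 * B') * l"
proof -
  let ?\<rho> = "root p (1/2)"
  have \<rho>p: "?\<rho> ^ p = 1/2" using p by (intro real_root_pow_pos2) auto
  have \<rho>: "0 < ?\<rho>" "?\<rho> \<le> 1" using p by auto
  have r: "V r \<le> A ^ r * V 0 + real r * A ^ r * B * l" for r
  proof (induction r)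
    case (Suc r)
    have "B * l * 1 \<le> B * l * A ^ Suc r" using A B l by (intro mult_left_mono one_le_power) auto
    moreover have "A * V r \<le> A * (A ^ r * V 0 + real r * A ^ r * B * l)"
      using Suc A by (intro mult_left_mono) auto
    ultimately show ?case using step[of r] by (simp add: algebra_simps)
  qed simp
  have q: "V (q * p + r) \<le> (1/2) ^ q * V r + 2 * B' * l" for q r
  proof (induction q)
    case 0
    then show ?case using B l by simp
  next
    case (Suc q)
    have "V (Suc q * p + r) \<le> V (q * p + r) / 2 + B' * l"
      using contract[of "q * p + r"] by (simp add: algebra_simps)
    then show ?case using Suc by simp
  qed
  define s where "s = n mod p"
  have s: "s \<le> p" using p by (simp add: s_def less_imp_le)
  have n: "n = n div p * p + s" by (simp add: s_def)
  have "?\<rho> ^ n = (1/2) ^ (n div p) * ?\<rho> ^ s"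
  proof -
    have "?\<rho> ^ n = ?\<rho> ^ (p * (n div p)) * ?\<rho> ^ s"
      by (subst n) (simp only: power_add mult.commute)
    then show ?thesis by (simp only: power_mult \<rho>p)
  qed
  moreover have "1/2 \<le> ?\<rho> ^ s" using power_decreasing[OF s, of ?\<rho>] \<rho> \<rho>p by simp
  ultimately have half: "(1/2) ^ (n div p) \<le> 2 * ?\<rho> ^ n"
    using mult_left_mono[of "1/2" "?\<rho> ^ s" "(1/2) ^ (n div p)"] by simp
  have As: "A ^ s \<le> A ^ p" using s A by (intro power_increasing) auto
  have "V s \<le> A ^ s * V 0 + real s * A ^ s * B * l" by (rule r)
  also have "\<dots> \<le> A ^ p * V 0 + real p * A ^ p * B * l"
    using As s A B l V[of 0] by (intro add_mono mult_right_mono mult_mono) auto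
  finally have Vs: "V s \<le> A ^ p * V 0 + real p * A ^ p * B * l" .
  have "V n \<le> (1/2) ^ (n div p) * V s + 2 * B' * l"
    by (subst n) (rule q)
  also have "\<dots> \<le> (1/2) ^ (n div p) * (A ^ p * V 0 + real p * A ^ p * B * l) + 2 * B' * l"
    using Vs by (intro add_right_mono mult_left_mono) auto
  also have "\<dots> = (1/2) ^ (n div p) * (A ^ p * V 0) + (1/2) ^ (n div p) * (real p * A ^ p * B * l) + 2 * B' * l"
    by (simp add: distrib_left)
  also have "\<dots> \<le> (2 * ?\<rho> ^ n) * (A ^ p * V 0) + 1 * (real p * A ^ p * B * l) + 2 * B' * l"
    using half A B l V[of 0] by (intro add_mono mult_right_mono power_le_one) auto
  also have "\<dots> = 2 * A ^ p * ?\<rho> ^ n * V 0 + (real p * A ^ p * B + 2 * B') * l"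
    by (simp add: algebra_simps)
  finally show ?thesis .
qed

text \<open>Only the constants \<open>\<theta>\<close> and \<open>D\<close> matter for uniform estimates.\<close>

definition branched :: "(real \<Rightarrow> real) \<Rightarrow> real \<Rightarrow> real \<Rightarrow> bool" where
  "branched f \<theta> D \<longleftrightarrow> (\<exists>N a b \<sigma> \<gamma> w. full_branch_system N a b f \<sigma> \<gamma> w \<theta> D)"

text \<open>A high power of \<open>f\<^sup>2\<close> contracts as strongly as needed while its distortion stays bounded; the
  required power, and hence all constants, depend on the bounds for \<open>f\<close> and \<open>f\<^sup>2\<close> only.\<close>

lemma uniform_contracting_power:
  assumes \<theta>: "0 < \<theta>" "\<theta> < 1" and D: "0 \<le> D"
  obtains p \<theta>' D' where "1 \<le> p" "0 < \<theta>'" "\<theta>' \<le> 1/4" "0 \<le> D'"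
    "\<theta>' * (1 + D' * exp (2 * D')) \<le> 1/2"
    "\<And>f. branched (f ^^ 2) \<theta> D \<Longrightarrow> branched (f ^^ p) \<theta>' D'"
proof -
  define D' where "D' = D / (1 - \<theta>)"
  have D': "0 \<le> D'" using \<theta> D by (simp add: D'_def)
  define E where "E = 1 + D' * exp (2 * D')"
  have E: "1 \<le> E" using D' by (simp add: E_def)
  have "(\<lambda>m. \<theta> ^ m) \<longlonglongrightarrow> 0" using \<theta> by (intro LIMSEQ_realpow_zero) auto
  moreover have "0 < 1 / (4 * E)" using E by simp
  ultimately have "\<forall>\<^sub>F m in sequentially. \<theta> ^ m < 1 / (4 * E)" by (rule order_tendstoD(2))
  then obtain m0 where "\<And>m. m \<ge> m0 \<Longrightarrow> \<theta> ^ m < 1 / (4 * E)" by (auto simp: eventually_sequentially)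
  then obtain m where m: "1 \<le> m" "\<theta> ^ m < 1 / (4 * E)" by (meson max.cobounded1 max.cobounded2)
  have t: "\<theta> ^ m * E < 1/4" using m(2) E by (simp add: field_simps)
  have "\<theta> ^ m * 1 \<le> \<theta> ^ m * E" using E \<theta> by (intro mult_left_mono) auto
  then have t': "\<theta> ^ m \<le> 1/4" using t by simp
  show ?thesis
  proof (rule that[of "2 * m" "\<theta> ^ m" D'])
    fix f :: "real \<Rightarrow> real" assume "branched (f ^^ 2) \<theta> D"
    then obtain N a b \<sigma> \<gamma> w where "full_branch_system N a b (f ^^ 2) \<sigma> \<gamma> w \<theta> D"
      unfolding branched_def by blast
    from full_branch_power[OF this \<theta>(2) m(1)] show "branched (f ^^ (2 * m)) (\<theta> ^ m) D'"
      unfolding branched_def D'_def funpow_mult by (simp add: mult.commute)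
  qed (use m(1) \<theta> t t' D' in \<open>auto simp: E_def\<close>)
qed

text \<open>The map is quantified after the constants: one pair \<open>C\<close>, \<open>\<rho>\<close> serves a whole family.\<close>

lemma uniform_lasota_yorke:
  assumes p: "1 \<le> p" and \<theta>: "0 < \<theta>1" and D: "0 \<le> D1" "0 \<le> D'"
    and small: "\<theta>' * (1 + D' * exp (2 * D')) \<le> 1/2"
  shows "\<exists>C \<rho>. 0 < C \<and> 0 < \<rho> \<and> \<rho> < 1 \<and> (\<forall>f. branched f \<theta>1 D1 \<longrightarrow> branched (f ^^ p) \<theta>' D' \<longrightarrow>
     (\<forall>h\<in>BV. \<forall>n. BV_norm ((frobenius_perron f ^^ n) h)
        \<le> ereal (C * \<rho> ^ n) * BV_norm h + ereal C * L1_norm h))"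
proof -
  define A where "A = max 1 (\<theta>1 * (1 + D1 * exp (2 * D1)))"
  define B where "B = D1 * exp (2 * D1)"
  define B' where "B' = D' * exp (2 * D')"
  define \<rho> where "\<rho> = root p (1/2)"
  define C where "C = 2 * A ^ p + (real p * A ^ p * B + 2 * B') + 1"
  have A: "1 \<le> A" by (simp add: A_def)
  have B: "0 \<le> B" "0 \<le> B'" using D by (auto simp: B_def B'_def)
  have Ap: "0 \<le> A ^ p" using A by simp
  have C: "0 < C" using Ap B by (simp add: C_def add_nonneg_pos)
  have \<rho>: "0 < \<rho>" "\<rho> < 1" using p by (auto simp: \<rho>_def)
  have "BV_norm ((frobenius_perron f ^^ n) h) \<le> ereal (C * \<rho> ^ n) * BV_norm h + ereal C * L1_norm h"
    if f: "branched f \<theta>1 D1" and fp: "branched (f ^^ p) \<theta>' D'" and h: "h \<in> BV" for f h n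
  proof -
    obtain N a b \<sigma> \<gamma> w where "full_branch_system N a b f \<sigma> \<gamma> w \<theta>1 D1"
      using f unfolding branched_def by blast
    then interpret F: full_branch_system N a b f \<sigma> \<gamma> w \<theta>1 D1 .
    obtain N' a' b' \<sigma>' \<gamma>' w' where "full_branch_system N' a' b' (f ^^ p) \<sigma>' \<gamma>' w' \<theta>' D'"
      using fp unfolding branched_def by blast
    then interpret S: full_branch_system N' a' b' "f ^^ p" \<sigma>' \<gamma>' w' \<theta>' D' .
    let ?P = "\<lambda>n. (frobenius_perron f ^^ n) h"
    define l where "l = (LINT x|leb01. \<bar>h x\<bar>)"
    have l: "0 \<le> l" by (simp add: l_def)
    have hi: "integrable leb01 h" using h by (simp add: BV_def)
    note it = F.frobenius_perron_iterate[OF h]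
    have L1: "(LINT x|leb01. \<bar>?P n x\<bar>) \<le> l" for n
    proof (induction n)
      case (Suc n)
      have "integrable leb01 (?P n)" using it[of n] by (simp add: BV_def)
      moreover have "is_transfer f (?P n) (?P (Suc n))"
        using F.frobenius_perron_transfer it[of n] by simp
      ultimately show ?case using F.is_transfer_L1_le Suc by (meson order_trans)
    qed (simp add: l_def)
    have step: "evar (?P (Suc n)) \<le> A * evar (?P n) + B * l" for n
    proof -
      have "is_transfer f (?P n) (?P (Suc n))"
        using F.frobenius_perron_transfer it[of n] by simp
      then have "evar (?P (Suc n)) \<le> \<theta>1 * (1 + D1 * exp (2 * D1)) * evar (?P n)
          + D1 * exp (2 * D1) * (LINT x|leb01. \<bar>?P n x\<bar>)"
        using F.lasota_yorke(2) it[of n] by blast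
      also have "\<dots> \<le> A * evar (?P n) + B * l"
        using L1[of n] B evar_nonneg[of "?P n"]
        by (intro add_mono mult_right_mono mult_mono) (auto simp: A_def B_def)
      finally show ?thesis .
    qed
    have contract: "evar (?P (n + p)) \<le> evar (?P n) / 2 + B' * l" for n
    proof -
      have eq: "?P (n + p) = (frobenius_perron f ^^ p) (?P n)"
        by (simp add: add.commute[of n] funpow_add)
      have "is_transfer (f ^^ p) (?P n) (?P (n + p))"
        unfolding eq using F.frobenius_perron_iterate it[of n] by blast
      then have "evar (?P (n + p)) \<le> \<theta>' * (1 + D' * exp (2 * D')) * evar (?P n)
          + D' * exp (2 * D') * (LINT x|leb01. \<bar>?P n x\<bar>)"
        using S.lasota_yorke(2) it[of n] by blast
      also have "\<dots> \<le> 1/2 * evar (?P n) + B' * l"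
        using L1[of n] B small evar_nonneg[of "?P n"]
        by (intro add_mono mult_right_mono mult_mono) (auto simp: B'_def)
      finally show ?thesis by simp
    qed
    have "evar (?P n) \<le> 2 * A ^ p * \<rho> ^ n * evar (?P 0) + (real p * A ^ p * B + 2 * B') * l"
      unfolding \<rho>_def
      by (rule lasota_yorke_recursion[where V = "\<lambda>n. evar (?P n)", OF p A B l evar_nonneg step contract])
    then have "(LINT x|leb01. \<bar>?P n x\<bar>) + evar (?P n)
        \<le> 2 * A ^ p * \<rho> ^ n * evar h + (real p * A ^ p * B + 2 * B' + 1) * l"
      using L1[of n] by (simp add: distrib_right)
    also have "\<dots> \<le> C * \<rho> ^ n * (l + evar h) + C * l"
    proof -
      have f1: "2 * A ^ p * \<rho> ^ n \<le> C * \<rho> ^ n"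
        using \<rho> Ap B by (intro mult_right_mono) (auto simp: C_def)
      have f2: "0 \<le> C * \<rho> ^ n" using C \<rho> by simp
      have "2 * A ^ p * \<rho> ^ n * evar h \<le> C * \<rho> ^ n * (l + evar h)"
        by (rule mult_mono[OF f1 _ f2]) (use l evar_nonneg[of h] in auto)
      moreover have "(real p * A ^ p * B + 2 * B' + 1) * l \<le> C * l"
        using l Ap by (intro mult_right_mono) (auto simp: C_def)
      ultimately show ?thesis by (rule add_mono)
    qed
    finally show ?thesis
      using BV_norm_eq[OF h] BV_norm_eq[of "?P n"] it[of n] by (simp add: L1_norm_def l_def)
  qed
  then show ?thesis using C \<rho> by blast
qed

section \<open>Derivatives, preimages and cylinders of full-branch systems\<close>

lemma has_real_derivative_inverse:
  fixes f g :: "real \<Rightarrow> real"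
  assumes "(f has_real_derivative c) (at x)" "c \<noteq> 0" "open S" "x \<in> S" "continuous_on S f"
    "\<And>z. z \<in> S \<Longrightarrow> g (f z) = z"
  shows "(g has_real_derivative inverse c) (at (f x))"
  using assms unfolding has_field_derivative_def
  by (intro has_derivative_inverse_strong[of S x f g]) auto

context full_branch_system
begin

lemma branch_homeomorphism:
  assumes i: "i \<in> N"
  obtains g where "homeomorphism {a i..b i} {0..1} g (\<gamma> i)" "\<And>x. x \<in> {a i<..<b i} \<Longrightarrow> g x = f x"
proof -
  have "closure {a i<..<b i} \<subseteq> \<gamma> i ` {0..1}"
  proof (rule closure_minimal)
    have "{0<..<1::real} \<subseteq> {0..1}" by auto
    then show "{a i<..<b i} \<subseteq> \<gamma> i ` {0..1}" using image[OF i] by (metis image_mono)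
    show "closed (\<gamma> i ` {0..1})"
      using compact_continuous_image[OF cont[OF i]] by (simp add: compact_imp_closed)
  qed
  then have "\<gamma> i ` {0..1} = {a i..b i}"
    using inverse_branch_range[OF i] interval[OF i] by auto
  then obtain g where g: "homeomorphism {0..1} {a i..b i} (\<gamma> i) g"
    using homeomorphism_compact[of "{0..1}" "\<gamma> i"] cont[OF i] inj_inverse_branch[OF i] by auto
  have "g x = f x" if x: "x \<in> {a i<..<b i}" for x
    using left_inverse[OF i, of x] homeomorphism_apply1[OF g, of "f x"] x by auto
  then show ?thesis using that homeomorphism_symD[OF g] by blast
qed

lemma weight_bounds_on_branch:
  assumes i: "i \<in> N" and x: "a i < x" "x < b i"
  shows "0 < w i (f x)" "w i (f x) \<le> \<theta>"
  using left_inverse[OF i x] weight_pos[OF i] weight_le[OF i] by auto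

lemma branch_derivative:
  assumes i: "i \<in> N" and x: "a i < x" "x < b i"
  shows "(f has_real_derivative \<sigma> i / w i (f x)) (at x)"
proof -
  have y: "0 < f x" "f x < 1" "\<gamma> i (f x) = x" using left_inverse[OF i x] by auto
  have "(f has_real_derivative inverse (\<sigma> i * w i (f x))) (at (\<gamma> i (f x)))"
  proof (rule has_real_derivative_inverse[where f = "\<gamma> i" and x = "f x" and S = "{0<..<1}"])
    show "(\<gamma> i has_real_derivative \<sigma> i * w i (f x)) (at (f x))" by (rule deriv[OF i y(1,2)])
    show "\<sigma> i * w i (f x) \<noteq> 0" using sign[OF i] weight_bounds_on_branch(1)[OF i x] by auto
    show "continuous_on {0<..<1} (\<gamma> i)" by (rule continuous_on_subset[OF cont[OF i]]) auto
    show "f (\<gamma> i z) = z" if "z \<in> {0<..<1}" for z using right_inverse[OF i, of z] that by auto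
  qed (use y in auto)
  moreover have "inverse (\<sigma> i * w i (f x)) = \<sigma> i / w i (f x)"
    using sign[OF i] by (auto simp: divide_inverse)
  ultimately show ?thesis using y(3) by simp
qed

lemma deriv_branch:
  "\<lbrakk>i \<in> N; a i < x; x < b i\<rbrakk> \<Longrightarrow> deriv f x = \<sigma> i / w i (f x)"
  by (rule DERIV_imp_deriv[OF branch_derivative])

lemma recip_abs_deriv:
  assumes i: "i \<in> N" and x: "a i < x" "x < b i"
  shows "1 / \<bar>deriv f x\<bar> = w i (f x)" "deriv f x \<noteq> 0"
  using deriv_branch[OF i x] weight_bounds_on_branch(1)[OF i x] sign[OF i] by auto

text \<open>The homeomorphism inverse to \<open>\<gamma> i\<close> extends \<open>f\<close>, and so \<open>f\<close> and \<open>f' = \<sigma> i / w i (f x)\<close> have one-sided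
  limits at the endpoints. The limit of \<open>f'\<close> is finite since the weight is positive on the closed interval.\<close>

lemma branch_at_endpoints:
  assumes i: "i \<in> N" and y: "0 \<le> y" "y \<le> 1"
  shows "branch_ext (a i) (b i) f (\<gamma> i y) = y"
    and "branch_deriv (a i) (b i) f (\<gamma> i y) = ereal (\<sigma> i / w i y)"
proof -
  obtain g where g: "homeomorphism {a i..b i} {0..1} g (\<gamma> i)" "\<And>x. x \<in> {a i<..<b i} \<Longrightarrow> g x = f x"
    using branch_homeomorphism[OF i] by blast
  have ab: "a i < b i" using interval[OF i] by simp
  have cg: "continuous_on {a i..b i} g" using g(1) by (simp add: homeomorphism_def)
  have gy: "g (\<gamma> i y) = y" using homeomorphism_apply2[OF g(1)] y by simp
  have g01: "g x \<in> {0..1}" if "x \<in> {a i..b i}" for x using g(1) that by (auto simp: homeomorphism_def)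
  have cd: "continuous_on {a i..b i} (\<lambda>x. ereal (\<sigma> i / w i (g x)))"
  proof (intro continuous_on_ereal continuous_on_divide continuous_on_const)
    show "continuous_on {a i..b i} (\<lambda>x. w i (g x))"
      by (rule continuous_on_compose2[OF continuous_weight cg]) (use g01 in auto)
    show "\<forall>x\<in>{a i..b i}. w i (g x) \<noteq> 0" using g01 weight_pos[OF i] by (auto simp: less_le)
  qed
  have ev: "\<forall>\<^sub>F x in at_right (a i). x \<in> {a i<..<b i}" "\<forall>\<^sub>F x in at_left (b i). x \<in> {a i<..<b i}"
    using eventually_at_right_real[OF ab] eventually_at_left_real[OF ab] by auto
  have f_ends: "(f \<longlongrightarrow> g (a i)) (at_right (a i))" "(f \<longlongrightarrow> g (b i)) (at_left (b i))"
    using continuous_on_Icc_at_rightD[OF cg ab] continuous_on_Icc_at_leftD[OF cg ab] ev g(2)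
    by (auto elim!: Lim_transform_eventually elim: eventually_mono)
  have d_eq: "ereal (\<sigma> i / w i (g x)) = ereal (deriv f x)" if "x \<in> {a i<..<b i}" for x
    using deriv_branch[OF i, of x] g(2)[OF that] that by simp
  have d_ends: "((\<lambda>x. ereal (deriv f x)) \<longlongrightarrow> ereal (\<sigma> i / w i (g (a i)))) (at_right (a i))"
      "((\<lambda>x. ereal (deriv f x)) \<longlongrightarrow> ereal (\<sigma> i / w i (g (b i)))) (at_left (b i))"
    using continuous_on_Icc_at_rightD[OF cd ab] continuous_on_Icc_at_leftD[OF cd ab] ev d_eq
    by (auto elim!: Lim_transform_eventually elim: eventually_mono)
  have Lims: "Lim (at_right (a i)) f = g (a i)" "Lim (at_left (b i)) f = g (b i)"
      "Lim (at_right (a i)) (\<lambda>x. ereal (deriv f x)) = ereal (\<sigma> i / w i (g (a i)))"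
      "Lim (at_left (b i)) (\<lambda>x. ereal (deriv f x)) = ereal (\<sigma> i / w i (g (b i)))"
    using f_ends d_ends by (auto intro!: tendsto_Lim)
  have range: "a i \<le> \<gamma> i y" "\<gamma> i y \<le> b i" using inverse_branch_range[OF i y] by auto
  show "branch_ext (a i) (b i) f (\<gamma> i y) = y"
    unfolding branch_ext_def using Lims(1,2) gy g(2)[of "\<gamma> i y"] range by auto
  show "branch_deriv (a i) (b i) f (\<gamma> i y) = ereal (\<sigma> i / w i y)"
    unfolding branch_deriv_def using Lims(3,4) gy d_eq[of "\<gamma> i y"] range by auto
qed

lemma branch_preimage_eq:
  assumes i: "i \<in> N" and y: "0 \<le> y" "y \<le> 1"
  shows "branch_preimage (a i) (b i) f y = \<gamma> i y"
  unfolding branch_preimage_def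
proof (rule inv_into_f_eq)
  obtain g where g: "homeomorphism {a i..b i} {0..1} g (\<gamma> i)"
    using branch_homeomorphism[OF i] by blast
  show "inj_on (branch_ext (a i) (b i) f) {a i..b i}"
  proof (rule inj_on_inverseI[of _ "\<gamma> i"])
    fix x assume x: "x \<in> {a i..b i}"
    then have "g x \<in> {0..1}" "\<gamma> i (g x) = x"
      using g by (auto simp: homeomorphism_def)
    then show "\<gamma> i (branch_ext (a i) (b i) f x) = x"
      using branch_at_endpoints(1)[OF i, of "g x"] by auto
  qed
qed (use inverse_branch_range[OF i y] branch_at_endpoints(1)[OF i y] in auto)

lemma branches_over_eq:
  assumes y: "0 \<le> y" "y \<le> 1" shows "branches_over N a b f y = N"
proof -
  have "y \<in> f ` {a i<..<b i} \<or> (y \<in> {0, 1} \<and> y \<in> branch_ext (a i) (b i) f ` {a i..b i})" if i: "i \<in> N" for i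
  proof (cases "y \<in> {0, 1}")
    case True
    then show ?thesis
      using branch_at_endpoints(1)[OF i y] inverse_branch_range[OF i y] by (metis atLeastAtMost_iff image_eqI)
  next
    case False
    then have "0 < y" "y < 1" using y by auto
    then show ?thesis
      using right_inverse[OF i, of y] inverse_branch_interior[OF i, of y] by (metis greaterThanLessThan_iff image_eqI)
  qed
  then show ?thesis unfolding branches_over_def by blast
qed

lemma image_branch: assumes i: "i \<in> N" shows "f ` {a i<..<b i} = {0<..<1}"
proof
  show "f ` {a i<..<b i} \<subseteq> {0<..<1}" using left_inverse[OF i] by auto
  show "{0<..<1} \<subseteq> f ` {a i<..<b i}"
  proof
    fix y :: real assume "y \<in> {0<..<1}"
    then show "y \<in> f ` {a i<..<b i}"
      using right_inverse[OF i, of y] inverse_branch_interior[OF i, of y]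
      by (metis greaterThanLessThan_iff image_eqI)
  qed
qed

lemma piecewise_expanding_of_contraction:
  assumes "\<theta> < 1" shows "piecewise_expanding N a b f"
  unfolding piecewise_expanding_def
proof (intro conjI ballI exI[of _ \<theta>])
  fix i assume i: "i \<in> N"
  show "f differentiable_on {a i<..<b i}"
    using branch_derivative[OF i] real_differentiable_def differentiable_at_withinI
    unfolding differentiable_on_def by (metis greaterThanLessThan_iff)
  obtain g where g: "homeomorphism {a i..b i} {0..1} g (\<gamma> i)" "\<And>x. x \<in> {a i<..<b i} \<Longrightarrow> g x = f x"
    using branch_homeomorphism[OF i] by blast
  then have "g ` {a i..b i} = {0..1}" by (simp add: homeomorphism_def)
  then show "\<exists>g g'. homeomorphism {a i..b i} (g ` {a i..b i}) g g' \<and> (\<forall>x\<in>{a i<..<b i}. g x = f x)"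
    using g by metis
next
  show "(SUP x\<in>{0..1}. recip_deriv (\<Union>i\<in>N. {a i<..<b i}) f x) \<le> ereal \<theta>"
  proof (rule SUP_least)
    fix x :: real
    show "recip_deriv (\<Union>i\<in>N. {a i<..<b i}) f x \<le> ereal \<theta>"
    proof (cases "x \<in> (\<Union>i\<in>N. {a i<..<b i})")
      case True
      then obtain i where i: "i \<in> N" "a i < x" "x < b i" by auto
      have "recip_deriv (\<Union>i\<in>N. {a i<..<b i}) f x = ereal (w i (f x))"
        using True recip_abs_deriv[OF i] by (simp add: recip_deriv_def one_ereal_def)
      then show ?thesis using weight_bounds_on_branch(2)[OF i] by simp
    next
      case False
      then show ?thesis unfolding recip_deriv_def if_not_P[OF False] using theta_pos by simp
    qed
  qed
qed (rule assms)

lemma nonsingular_system: "nonsingular N a b f"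
proof -
  let ?U = "\<Union>i\<in>N. {a i<..<b i}"
  have U: "?U \<in> sets lebesgue" by (rule open_intervals)
  have pre: "f -` A \<inter> ?U = {x \<in> ?U. f x \<in> A \<inter> {0<..<1}}" for A
    using left_inverse by auto
  have inc: "A \<inter> {0<..<1} \<in> sets lebesgue" if "A \<in> sets leb01" for A
    using that by (intro sets.Int) (auto simp: sets_restrict_space_iff)
  have m: "f \<in> measurable (lebesgue_on ?U) leb01"
  proof (rule measurableI)
    fix x assume "x \<in> space (lebesgue_on ?U)"
    then show "f x \<in> space leb01" using left_inverse by (auto simp: less_imp_le)
  next
    fix A assume A: "A \<in> sets leb01"
    have "{x \<in> ?U. f x \<in> A \<inter> {0<..<1}} \<in> sets lebesgue" by (rule vimage_sets[OF inc[OF A]]) simp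
    then have "f -` A \<inter> ?U \<in> sets lebesgue" unfolding pre .
    then show "f -` A \<inter> space (lebesgue_on ?U) \<in> sets (lebesgue_on ?U)"
      using U by (subst sets_restrict_space_iff) auto
  qed
  moreover have "absolutely_continuous leb01 (distr (lebesgue_on ?U) leb01 f)"
    unfolding absolutely_continuous_def
  proof
    fix A assume A: "A \<in> null_sets leb01"
    then have AS: "A \<in> sets leb01" by auto
    have "A \<in> null_sets lebesgue" using A by (subst (asm) null_sets_restrict_space) auto
    then have "negligible (A \<inter> {0<..<1})" by (intro negligible_Int) (simp add: negligible_iff_null_sets)
    then have n: "{x \<in> ?U. f x \<in> A \<inter> {0<..<1}} \<in> null_sets lebesgue"
      by (intro vimage_null) (auto simp: negligible_iff_null_sets)
    have "emeasure (distr (lebesgue_on ?U) leb01 f) A = emeasure (lebesgue_on ?U) (f -` A \<inter> ?U)"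
      using emeasure_distr[OF m AS] by simp
    also have "\<dots> = emeasure lebesgue (f -` A \<inter> ?U)" using U by (intro emeasure_restrict_space) auto
    also have "\<dots> = 0" using n unfolding pre by auto
    finally show "A \<in> null_sets (distr (lebesgue_on ?U) leb01 f)" using AS by (simp add: null_sets_def)
  qed
  ultimately show ?thesis unfolding nonsingular_def by blast
qed

lemma frobenius_perron_bounded:
  "\<exists>C::real. \<forall>h\<in>BV. frobenius_perron f h \<in> BV \<and> BV_norm (frobenius_perron f h) \<le> ereal C * BV_norm h"
proof (intro exI ballI conjI)
  fix h assume h: "h \<in> BV"
  let ?k = "frobenius_perron f h" and ?l = "LINT x|leb01. \<bar>h x\<bar>"
  let ?A = "\<theta> * (1 + D * exp (2 * D))" and ?B = "D * exp (2 * D)"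
  have t: "is_transfer f h ?k" by (rule frobenius_perron_transfer[OF h])
  show k: "?k \<in> BV" by (rule lasota_yorke(1)[OF h t])
  have hi: "integrable leb01 h" using h by (simp add: BV_def)
  have B: "0 \<le> ?B" using D_nonneg by simp
  have "0 \<le> 1 + ?B" using B by simp
  then have A: "0 \<le> ?A" using theta_pos by (intro mult_nonneg_nonneg) auto
  have l: "0 \<le> ?l" by simp
  have "(LINT x|leb01. \<bar>?k x\<bar>) + evar ?k \<le> ?l + (?A * evar h + ?B * ?l)"
    using is_transfer_L1_le[OF t hi] lasota_yorke(2)[OF h t] by (rule add_mono)
  also have "\<dots> \<le> (1 + ?A + ?B) * (?l + evar h)"
  proof -
    have "0 \<le> ?A * ?l" "0 \<le> (1 + ?B) * evar h" using A B l evar_nonneg[of h] by auto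
    then show ?thesis by (simp add: distrib_left distrib_right)
  qed
  finally show "BV_norm ?k \<le> ereal (1 + ?A + ?B) * BV_norm h"
    using BV_norm_eq[OF h] BV_norm_eq[OF k] by simp
qed

text \<open>The sharper form of the mean value argument, with the length of the branch interval in place of
  \<open>\<theta>\<close>, is what makes sums over infinitely many branches converge.\<close>

lemma inverse_branch_lipschitz_len:
  assumes i: "i \<in> N" and xy: "0 \<le> x" "x \<le> 1" "0 \<le> y" "y \<le> 1"
  shows "\<bar>\<gamma> i x - \<gamma> i y\<bar> \<le> exp D * len i * \<bar>x - y\<bar>"
proof -
  have *: "\<bar>\<gamma> i y - \<gamma> i x\<bar> \<le> exp D * len i * \<bar>x - y\<bar>" if xy: "0 \<le> x" "x < y" "y \<le> 1" for x y
  proof -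
    obtain \<xi> where \<xi>: "x < \<xi>" "\<xi> < y" "\<sigma> i * (\<gamma> i y - \<gamma> i x) = (y - x) * w i \<xi>"
      using mean_value[OF i xy] .
    have "\<bar>\<gamma> i y - \<gamma> i x\<bar> = \<bar>\<sigma> i * (\<gamma> i y - \<gamma> i x)\<bar>" using sign[OF i] by auto
    also have "\<dots> = w i \<xi> * \<bar>x - y\<bar>"
      unfolding \<xi>(3) using xy \<xi> weight_nonneg[of \<xi> i] by (simp add: abs_mult mult.commute)
    also have "\<dots> \<le> exp D * len i * \<bar>x - y\<bar>"
      using weight_le_len[of \<xi> i] \<xi> xy by (intro mult_right_mono) auto
    finally show ?thesis .
  qed
  show ?thesis
    using *[of x y] *[of y x] xy by (cases x y rule: linorder_cases) (auto simp: abs_minus_commute)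
qed

end

text \<open>A cylinder of length two is the part of a branch interval that is mapped into another one, hence
  the image of the latter under an inverse branch.\<close>

lemma cylinders_two:
  assumes F: "full_branch_system N a b f \<sigma> \<gamma> w \<theta> D"
  shows "(\<lambda>n. {pair_left \<gamma> a b n<..<pair_right \<gamma> a b n})
      ` {n. fst (prod_decode n) \<in> N \<and> snd (prod_decode n) \<in> N} = cylinders N a b f 2"
proof -
  interpret full_branch_system N a b f \<sigma> \<gamma> w \<theta> D by fact
  have ends: "{pair_left \<gamma> a b n<..<pair_right \<gamma> a b n}
      = {min (\<gamma> i (a j)) (\<gamma> i (b j))<..<max (\<gamma> i (a j)) (\<gamma> i (b j))}"
    if "prod_decode n = (i, j)" for n i j using that by (simp add: pair_left_def pair_right_def)
  have eq: "{min (\<gamma> i (a j)) (\<gamma> i (b j))<..<max (\<gamma> i (a j)) (\<gamma> i (b j))}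
      = {x. a i < x \<and> x < b i \<and> a j < f x \<and> f x < b j}" if ij: "i \<in> N" "j \<in> N" for i j
  proof -
    have "{min (\<gamma> i (a j)) (\<gamma> i (b j))<..<max (\<gamma> i (a j)) (\<gamma> i (b j))} = \<gamma> i ` {a j<..<b j}"
      using image_subinterval[of i "a j" "b j"] interval[OF ij(2)] ij by simp
    also have "\<dots> = {x. a i < x \<and> x < b i \<and> a j < f x \<and> f x < b j}"
    proof (intro set_eqI iffI)
      fix x assume "x \<in> \<gamma> i ` {a j<..<b j}"
      then obtain y where "x = \<gamma> i y" "a j < y" "y < b j" by auto
      then show "x \<in> {x. a i < x \<and> x < b i \<and> a j < f x \<and> f x < b j}"
        using interval[OF ij(2)] inverse_branch_interior[OF ij(1), of y] right_inverse[OF ij(1), of y] by auto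
    next
      fix x assume x: "x \<in> {x. a i < x \<and> x < b i \<and> a j < f x \<and> f x < b j}"
      then have "x = \<gamma> i (f x)" using left_inverse[OF ij(1), of x] by simp
      then show "x \<in> \<gamma> i ` {a j<..<b j}" using x by (metis (mono_tags, lifting) greaterThanLessThan_iff image_eqI mem_Collect_eq)
    qed
    finally show ?thesis .
  qed
  have less_two: "(\<forall>j<2. P j) \<longleftrightarrow> P 0 \<and> P (Suc 0)" for P :: "nat \<Rightarrow> bool"
    by (auto simp: numeral_2_eq_2 less_Suc_eq)
  have ne: "{x. a i < x \<and> x < b i \<and> a j < f x \<and> f x < b j} \<noteq> {}" if ij: "i \<in> N" "j \<in> N" for i j
    using right_inverse[OF ij(1), of "(a j + b j) / 2"] inverse_branch_interior[OF ij(1), of "(a j + b j) / 2"]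
      interval[OF ij(2)] by (auto intro!: exI[of _ "\<gamma> i ((a j + b j) / 2)"])
  show ?thesis
  proof (intro set_eqI iffI)
    fix C assume "C \<in> (\<lambda>n. {pair_left \<gamma> a b n<..<pair_right \<gamma> a b n})
      ` {n. fst (prod_decode n) \<in> N \<and> snd (prod_decode n) \<in> N}"
    then obtain n where n: "fst (prod_decode n) \<in> N" "snd (prod_decode n) \<in> N"
        "C = {pair_left \<gamma> a b n<..<pair_right \<gamma> a b n}" by blast
    obtain i j where p: "prod_decode n = (i, j)" by (cases "prod_decode n")
    have ij: "i \<in> N" "j \<in> N" using n p by auto
    have C: "C = {x. a i < x \<and> x < b i \<and> a j < f x \<and> f x < b j}"
      unfolding n(3) ends[OF p] by (rule eq[OF ij])
    have "C \<noteq> {}" using ne[OF ij] C by simp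
    moreover define v where "v l = (if l = 0 then i else j)" for l :: nat
    have "C = {x. \<forall>l<2. (f ^^ l) x \<in> {a (v l)<..<b (v l)}}"
      unfolding C less_two v_def by auto
    moreover have "\<forall>l<2. v l \<in> N" using ij by (simp add: v_def)
    ultimately show "C \<in> cylinders N a b f 2"
      unfolding cylinders_def by (intro CollectI conjI exI[of _ v])
  next
    fix C assume "C \<in> cylinders N a b f 2"
    then obtain v where v: "\<forall>l<(2::nat). v l \<in> N" "C = {x. \<forall>l<2. (f ^^ l) x \<in> {a (v l)<..<b (v l)}}"
      unfolding cylinders_def by blast
    then have ij: "v 0 \<in> N" "v (Suc 0) \<in> N" by auto
    have "C = {x. a (v 0) < x \<and> x < b (v 0) \<and> a (v (Suc 0)) < f x \<and> f x < b (v (Suc 0))}"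
      unfolding v(2) less_two by auto
    also have "\<dots> = {min (\<gamma> (v 0) (a (v (Suc 0)))) (\<gamma> (v 0) (b (v (Suc 0))))
        <..<max (\<gamma> (v 0) (a (v (Suc 0)))) (\<gamma> (v 0) (b (v (Suc 0))))}"
      by (rule eq[OF ij, symmetric])
    finally show "C \<in> (\<lambda>n. {pair_left \<gamma> a b n<..<pair_right \<gamma> a b n})
      ` {n. fst (prod_decode n) \<in> N \<and> snd (prod_decode n) \<in> N}"
      using ij ends[of "prod_encode (v 0, v (Suc 0))"]
      by (intro image_eqI[of _ _ "prod_encode (v 0, v (Suc 0))"]) auto
  qed
qed

text \<open>The bound is on the product of the weights along an orbit. It can be less than one even where a
  single factor is not.\<close>

lemma full_branch_square:
  assumes F: "full_branch_system N a b f \<sigma> \<gamma> w \<theta> D" and \<theta>2: "0 < \<theta>2"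
    and le: "\<And>i j x. \<lbrakk>i \<in> N; j \<in> N; a i < x; x < b i; a j < f x; f x < b j\<rbrakk> \<Longrightarrow> w i (f x) * w j (f (f x)) \<le> \<theta>2"
  shows "\<exists>M c d \<tau> \<eta> k. full_branch_system M c d (f ^^ 2) \<tau> \<eta> k \<theta>2 (D * \<theta> + D) \<and>
      (\<lambda>j. {c j<..<d j}) ` M = cylinders N a b f 2"
proof -
  interpret F: full_branch_system N a b f \<sigma> \<gamma> w \<theta> D by fact
  note S = full_branch_compose[OF F F]
  have two: "f ^^ 2 = f \<circ> f" by (simp add: numeral_2_eq_2)
  show ?thesis
    unfolding two cylinders_two[OF F, symmetric]
  proof (intro exI conjI)
    show "full_branch_system {n. fst (prod_decode n) \<in> N \<and> snd (prod_decode n) \<in> N}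
      (pair_left \<gamma> a b) (pair_right \<gamma> a b)
      (f \<circ> f) (\<lambda>n. \<sigma> (fst (prod_decode n)) * \<sigma> (snd (prod_decode n)))
      (\<lambda>n y. \<gamma> (fst (prod_decode n)) (\<gamma> (snd (prod_decode n)) y))
      (\<lambda>n y. w (fst (prod_decode n)) (\<gamma> (snd (prod_decode n)) y) * w (snd (prod_decode n)) y)
      \<theta>2 (D * \<theta> + D)"
    proof (rule full_branch_system.improve_contraction[OF S \<theta>2])
      fix n and y :: real
      assume n: "n \<in> {n. fst (prod_decode n) \<in> N \<and> snd (prod_decode n) \<in> N}" and y: "0 < y" "y < 1"
      let ?i = "fst (prod_decode n)" and ?j = "snd (prod_decode n)"
      have ij: "?i \<in> N" "?j \<in> N" using n by auto
      have j: "a ?j < \<gamma> ?j y" "\<gamma> ?j y < b ?j" "f (\<gamma> ?j y) = y"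
        using F.inverse_branch_interior[OF ij(2) y] F.right_inverse[OF ij(2) y] by auto
      then have u: "0 < \<gamma> ?j y" "\<gamma> ?j y < 1" using F.interval[OF ij(2)] by auto
      show "w ?i (\<gamma> ?j y) * w ?j y \<le> \<theta>2"
        using le[OF ij, of "\<gamma> ?i (\<gamma> ?j y)"] F.inverse_branch_interior[OF ij(1) u]
          F.right_inverse[OF ij(1) u] j by simp
    qed
  qed simp
qed

text \<open>The second iterate is the expanding one; the power \<open>p\<close> only serves to obtain the mixing
  density.\<close>

lemma pre_piecewise_of_full_branch:
  assumes F: "full_branch_system N a b f \<sigma> \<gamma> w \<theta> D"
    and F2: "full_branch_system M c d (f ^^ 2) \<tau> \<eta> k \<theta>2 D2" "\<theta>2 < 1"
    and cyl: "(\<lambda>j. {c j<..<d j}) ` M = cylinders N a b f 2"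
    and p: "1 \<le> p" and S: "branched (f ^^ p) \<theta>' D'" "\<theta>' \<le> 1/4"
  shows "pre_piecewise_convex_or_expanding N a b f"
proof -
  interpret F: full_branch_system N a b f \<sigma> \<gamma> w \<theta> D by fact
  interpret F2: full_branch_system M c d "f ^^ 2" \<tau> \<eta> k \<theta>2 D2 by fact
  obtain N' a' b' \<sigma>' \<gamma>' w' where "full_branch_system N' a' b' (f ^^ p) \<sigma>' \<gamma>' w' \<theta>' D'"
    using S unfolding branched_def by blast
  then have "strongly_contracting_system N' a' b' (f ^^ p) \<sigma>' \<gamma>' w' \<theta>' D'"
    using S(2) by (simp add: strongly_contracting_system_def strongly_contracting_system_axioms_def)
  note mix = exists_mixing_density[OF F p this]
  have n0: "\<exists>n0\<ge>1. \<exists>M c d. interval_partition M c d \<and>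
        (\<lambda>j. {c j<..<d j}) ` M = cylinders N a b f n0 \<and>
        (piecewise_convex M c d (f ^^ n0) \<or> piecewise_expanding M c d (f ^^ n0))"
    using F2.partition cyl F2.piecewise_expanding_of_contraction[OF F2(2)]
    by (intro exI[of _ "2::nat"]) auto
  show ?thesis
    unfolding pre_piecewise_convex_or_expanding_def
    by (intro conjI n0 F.nonsingular_system F.frobenius_perron_bounded mix)
qed

section \<open>The reciprocal derivative\<close>

context full_branch_system
begin

lemma recip_deriv_eq:
  "recip_deriv (\<Union>i\<in>N. {a i<..<b i}) f x = ereal (\<Sum>i. indicator {a i<..<b i} x * w i (f x))"
proof (cases "x \<in> (\<Union>i\<in>N. {a i<..<b i})")
  case True
  then obtain j where j: "j \<in> N" "a j < x" "x < b j" by auto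
  have z: "indicator {a i<..<b i} x * w i (f x) = 0" if "i \<noteq> j" for i
    using inj_branches[of i j x] j that weight_zero[of i] by (cases "i \<in> N") (auto simp: indicator_def)
  have "(\<Sum>i. indicator {a i<..<b i} x * w i (f x)) = (\<Sum>i\<in>{j}. indicator {a i<..<b i} x * w i (f x))"
    by (rule suminf_finite) (use z in auto)
  also have "\<dots> = w j (f x)" using j by (auto simp: indicator_def)
  finally show ?thesis
    using True recip_abs_deriv[OF j] by (simp add: recip_deriv_def one_ereal_def)
next
  case False
  then have z: "indicator {a i<..<b i} x * w i (f x) = 0" for i
    using weight_zero[of i] by (cases "i \<in> N") auto
  show ?thesis unfolding z recip_deriv_def if_not_P[OF False] by simp
qed

lemma recip_deriv_bounds:
  "0 \<le> recip_deriv (\<Union>i\<in>N. {a i<..<b i}) f x" "recip_deriv (\<Union>i\<in>N. {a i<..<b i}) f x \<le> ereal \<theta>"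
proof -
  have "0 \<le> recip_deriv (\<Union>i\<in>N. {a i<..<b i}) f x \<and> recip_deriv (\<Union>i\<in>N. {a i<..<b i}) f x \<le> ereal \<theta>"
  proof (cases "x \<in> (\<Union>i\<in>N. {a i<..<b i})")
    case True
    then obtain j where j: "j \<in> N" "a j < x" "x < b j" by auto
    then show ?thesis
      using True recip_abs_deriv[OF j] weight_bounds_on_branch[OF j]
      by (simp add: recip_deriv_def one_ereal_def)
  next
    case False
    then show ?thesis unfolding recip_deriv_def if_not_P[OF False] using theta_pos by simp
  qed
  then show "0 \<le> recip_deriv (\<Union>i\<in>N. {a i<..<b i}) f x"
    "recip_deriv (\<Union>i\<in>N. {a i<..<b i}) f x \<le> ereal \<theta>" by auto
qed

lemma recip_deriv_measurable:
  "recip_deriv (\<Union>i\<in>N. {a i<..<b i}) f \<in> borel_measurable leb01"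
proof -
  have "(\<lambda>x. indicator {a i<..<b i} x * w i (f x)) \<in> borel_measurable leb01" for i
  proof (cases "i \<in> N")
    case True
    have "{a i<..<b i} \<in> sets leb01" using interval[OF True] by (subst sets_restrict_space_iff) auto
    then have "(indicator {a i<..<b i} :: real \<Rightarrow> real) \<in> borel_measurable leb01" by simp
    moreover have "w i \<in> borel_measurable leb01"
      by (rule continuous_imp_measurable_on_sets_lebesgue[OF continuous_weight]) simp
    ultimately show ?thesis using comp_measurable by (intro borel_measurable_times) auto
  qed (simp add: weight_zero)
  then have "(\<lambda>x. ereal (\<Sum>i. indicator {a i<..<b i} x * w i (f x))) \<in> borel_measurable leb01"
    by (intro borel_measurable_ereal borel_measurable_suminf)
  then show ?thesis by (simp add: recip_deriv_eq[abs_def])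
qed

lemma esssup_recip_deriv:
  "esssup leb01 (recip_deriv (\<Union>i\<in>N. {a i<..<b i}) f) \<le> ereal \<theta>"
  "0 \<le> esssup leb01 (recip_deriv (\<Union>i\<in>N. {a i<..<b i}) f)"
proof -
  show "esssup leb01 (recip_deriv (\<Union>i\<in>N. {a i<..<b i}) f) \<le> ereal \<theta>"
    by (rule esssup_I[OF recip_deriv_measurable]) (use recip_deriv_bounds in auto)
  have "0 = esssup leb01 (\<lambda>_. 0::ereal)" by (rule esssup_const[symmetric]) simp
  also have "\<dots> \<le> esssup leb01 (recip_deriv (\<Union>i\<in>N. {a i<..<b i}) f)"
    by (rule esssup_mono) (use recip_deriv_bounds in auto)
  finally show "0 \<le> esssup leb01 (recip_deriv (\<Union>i\<in>N. {a i<..<b i}) f)" .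
qed

text \<open>The function \<open>1 / \<bar>f'\<bar>\<close> contributes on the \<open>i\<close>-th interval a jump of size at most \<open>exp D * len i\<close>
  at each of its endpoints and, in the coordinate \<open>f x\<close>, a Lipschitz function in between.\<close>

lemma variation_recip_deriv:
  "variation_on {0..1} (recip_deriv (\<Union>i\<in>N. {a i<..<b i}) f) \<le> ereal (D * exp (2 * D) + 2 * exp D)"
proof -
  define K where "K = D * exp (2 * D)"
  have K: "0 \<le> K" using D_nonneg by (simp add: K_def)
  \<comment> \<open>\<open>s i\<close> is the coordinate \<open>f x\<close> made increasing and extended by constants, so that \<open>v i\<close> is
    monotone on the whole line.\<close>
  define s where "s i x = (if x \<le> a i then 0 else if b i \<le> x then 1 else
      if \<sigma> i = 1 then f x else 1 - f x)" for i x
  define u where "u i x = indicator {a i<..<b i} x * w i (f x)" for i x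
  define v where "v i x = (if i \<in> N then K * len i * s i x + exp D * len i *
      ((if a i < x then 1 else 0) + (if b i \<le> x then 1 else 0)) else 0)" for i x
  have u0: "0 \<le> u i x" "u i x \<le> exp D * len i" for i x
  proof -
    have "0 \<le> u i x \<and> u i x \<le> exp D * len i"
    proof (cases "i \<in> N \<and> a i < x \<and> x < b i")
      case True
      then show ?thesis
        using left_inverse[of i x] weight_nonneg[of "f x" i] weight_le_len[of "f x" i]
        by (auto simp: u_def indicator_def)
    next
      case False
      then have "u i x = 0" using weight_zero[of i] by (auto simp: u_def indicator_def)
      then show ?thesis using len_nonneg[of i] by simp
    qed
    then show "0 \<le> u i x" "u i x \<le> exp D * len i" by auto
  qed
  have s01: "0 \<le> s i x \<and> s i x \<le> 1" if "i \<in> N" for i x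
    using left_inverse[OF that, of x] by (auto simp: s_def)
  have s_mono: "s i x \<le> s i y" if i: "i \<in> N" and xy: "x \<le> y" for i x y
  proof (cases "a i < x \<and> y < b i")
    case True
    then have r: "0 < f x" "f x < 1" "0 < f y" "f y < 1" "\<gamma> i (f x) = x" "\<gamma> i (f y) = y"
      using left_inverse[OF i, of x] left_inverse[OF i, of y] xy by auto
    have "\<sigma> i * f x \<le> \<sigma> i * f y"
    proof (cases "f x" "f y" rule: linorder_cases)
      case less
      then have "0 < \<sigma> i * (y - x)" using inverse_branch_strict[OF i, of "f x" "f y"] r by simp
      then show ?thesis using sign[OF i] xy less by auto
    next
      case greater
      then have "0 < \<sigma> i * (x - y)" using inverse_branch_strict[OF i, of "f y" "f x"] r by simp
      then show ?thesis using sign[OF i] xy greater by auto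
    qed simp
    then show ?thesis using True sign[OF i] xy by (auto simp: s_def)
  next
    case False
    then show ?thesis using s01[OF i, of x] s01[OF i, of y] xy by (auto simp: s_def)
  qed
  have inc: "\<bar>u i x - u i y\<bar> \<le> v i y - v i x" if xy: "x < y" for i x y
  proof (cases "i \<in> N")
    case True
    have e0: "0 \<le> exp D * len i" using len_nonneg[of i] by simp
    have Ks: "0 \<le> K * len i * (s i y - s i x)"
      using K len_nonneg[of i] s_mono[OF True, of x y] xy by simp
    show ?thesis
    proof (cases "a i < x \<and> y < b i")
      case inside: True
      then have r: "0 < f x" "f x < 1" "0 < f y" "f y < 1"
        using left_inverse[OF True, of x] left_inverse[OF True, of y] xy by auto
      have "\<bar>u i x - u i y\<bar> = \<bar>w i (f x) - w i (f y)\<bar>"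
        using inside xy by (simp add: u_def indicator_def)
      also have "\<dots> \<le> K * len i * \<bar>f x - f y\<bar>"
        unfolding K_def by (rule weight_lipschitz) (use r in auto)
      also have "\<bar>f x - f y\<bar> = s i y - s i x"
        using s_mono[OF True, of x y] inside xy by (auto simp: s_def split: if_splits)
      finally show ?thesis using inside xy True by (simp add: v_def algebra_simps)
    next
      case False
      then consider "y \<le> a i \<or> b i \<le> x" | "x \<le> a i" "a i < y" | "x < b i" "b i \<le> y" by linarith
      then show ?thesis
      proof cases
        case 1
        then have "u i x = 0" "u i y = 0" using xy by (auto simp: u_def)
        then show ?thesis using 1 Ks e0 True xy interval[OF True] by (auto simp: v_def algebra_simps)
      next
        case 2
        then have "u i x = 0" by (simp add: u_def)
        then show ?thesis using 2 Ks e0 True u0[of i y] interval[OF True] by (auto simp: v_def algebra_simps)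
      next
        case 3
        then have "u i y = 0" by (simp add: u_def)
        then show ?thesis using 3 Ks e0 True u0[of i x] interval[OF True] by (auto simp: v_def algebra_simps)
      qed
    qed
  next
    case False
    then show ?thesis by (simp add: v_def u_def weight_zero)
  qed
  have v01: "0 \<le> v i x" "v i x \<le> (K + 2 * exp D) * len i" for i x
  proof -
    have "0 \<le> v i x \<and> v i x \<le> (K + 2 * exp D) * len i"
    proof (cases "i \<in> N")
      case True
      have "0 \<le> K * len i * s i x" using K len_nonneg[of i] s01[OF True, of x] by simp
      moreover have "K * len i * s i x \<le> K * len i * 1"
        by (rule mult_left_mono) (use K len_nonneg[of i] s01[OF True, of x] in auto)
      moreover have "0 \<le> exp D * len i" using len_nonneg[of i] by simp
      ultimately show ?thesis using True by (simp add: v_def algebra_simps)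
    qed (use K len_nonneg[of i] in \<open>simp add: v_def\<close>)
    then show "0 \<le> v i x" "v i x \<le> (K + 2 * exp D) * len i" by auto
  qed
  have sl: "summable (\<lambda>i. (K + 2 * exp D) * len i)" "summable (\<lambda>i. exp D * len i)"
    by (intro summable_mult summable_len)+
  have sv: "summable (\<lambda>i. v i x)" for x
    by (rule summable_comparison_test[OF _ sl(1)]) (use v01 in auto)
  have su: "summable (\<lambda>i. u i x)" for x
    by (rule summable_comparison_test[OF _ sl(2)]) (use u0 in auto)
  have "variation_on {0..1} (\<lambda>x. ereal (\<Sum>i. u i x)) \<le> ereal (K + 2 * exp D)"
  proof (rule variation_on_le_of_majorant[where v = "\<lambda>x. (\<Sum>i. v i x)"])
    fix x y :: real
    have "(\<Sum>i. v i y) \<le> (\<Sum>i. (K + 2 * exp D) * len i)" by (rule suminf_le[OF v01(2) sv sl(1)])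
    also have "\<dots> = (K + 2 * exp D) * (\<Sum>i. len i)" by (rule suminf_mult[OF summable_len])
    also have "\<dots> \<le> (K + 2 * exp D) * 1" using suminf_len_le K by (intro mult_left_mono) auto
    finally have "(\<Sum>i. v i y) \<le> K + 2 * exp D" by simp
    moreover have "0 \<le> (\<Sum>i. v i x)" by (rule suminf_nonneg[OF sv v01(1)])
    ultimately show "(\<Sum>i. v i y) - (\<Sum>i. v i x) \<le> K + 2 * exp D" by simp
    assume xy: "x < y"
    have sd: "summable (\<lambda>i. v i y - v i x)" by (rule summable_diff[OF sv sv])
    have sa: "summable (\<lambda>i. \<bar>u i x - u i y\<bar>)"
      by (rule summable_comparison_test[OF _ sd]) (use inc[OF xy] in auto)
    have "\<bar>(\<Sum>i. u i x) - (\<Sum>i. u i y)\<bar> = \<bar>\<Sum>i. u i x - u i y\<bar>" by (simp only: suminf_diff[OF su su])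
    also have "\<dots> \<le> (\<Sum>i. \<bar>u i x - u i y\<bar>)" by (rule summable_rabs[OF sa])
    also have "\<dots> \<le> (\<Sum>i. v i y - v i x)" by (rule suminf_le[OF inc[OF xy] sa sd])
    also have "\<dots> = (\<Sum>i. v i y) - (\<Sum>i. v i x)" by (rule suminf_diff[OF sv sv, symmetric])
    finally show "\<bar>(\<Sum>i. u i x) - (\<Sum>i. u i y)\<bar> \<le> (\<Sum>i. v i y) - (\<Sum>i. v i x)" .
  qed (use K in simp)
  moreover have "recip_deriv (\<Union>i\<in>N. {a i<..<b i}) f = (\<lambda>x. ereal (\<Sum>i. u i x))"
    by (rule ext) (simp add: recip_deriv_eq u_def)
  ultimately show ?thesis by (simp add: K_def)
qed

end

section \<open>Expanding \<open>C\<^sup>2\<close> branches\<close>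

lemma constant_sign:
  fixes g :: "real \<Rightarrow> real"
  assumes "continuous_on {a<..<b} g" "\<And>x. x \<in> {a<..<b} \<Longrightarrow> g x \<noteq> 0"
  obtains \<sigma> where "\<sigma> = 1 \<or> \<sigma> = -1" "\<And>x. x \<in> {a<..<b} \<Longrightarrow> \<bar>g x\<bar> = \<sigma> * g x"
proof -
  have "connected (g ` {a<..<b})" by (rule connected_continuous_image[OF assms(1)]) simp
  moreover have "0 \<notin> g ` {a<..<b}" using assms(2) by force
  ultimately have "\<not> (g x < 0 \<and> 0 < g y)" if "x \<in> {a<..<b}" "y \<in> {a<..<b}" for x y
    using connectedD_interval[of "g ` {a<..<b}" "g x" "g y" 0] that by auto
  then consider "\<And>x. x \<in> {a<..<b} \<Longrightarrow> 0 \<le> g x" | "\<And>x. x \<in> {a<..<b} \<Longrightarrow> g x \<le> 0"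
    by (meson leI)
  then show ?thesis
    by cases (rule that[of 1], auto, rule that[of "-1"], auto)
qed

text \<open>The inverse branch and the logarithm of its weight are Lipschitz on the open interval, so
  that both extend to its closure. The extension of the weight is positive as its logarithm is
  finite.\<close>

lemma inverse_branch_of_C2:
  fixes f f' f'' :: "real \<Rightarrow> real"
  assumes bij: "bij_betw f {a<..<b} {0<..<1}"
    and d1: "\<And>x. x \<in> {a<..<b} \<Longrightarrow> (f has_real_derivative f' x) (at x)"
    and d2: "\<And>x. x \<in> {a<..<b} \<Longrightarrow> (f' has_real_derivative f'' x) (at x)"
    and \<theta>: "0 < \<theta>" "\<And>x. x \<in> {a<..<b} \<Longrightarrow> 1 / \<theta> \<le> \<bar>f' x\<bar>"
    and D: "0 \<le> D" "\<And>x. x \<in> {a<..<b} \<Longrightarrow> \<bar>f'' x\<bar> \<le> D * (f' x)\<^sup>2"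
  shows "\<exists>\<sigma> \<gamma> w. (\<sigma> = 1 \<or> \<sigma> = -1) \<and> continuous_on {0..1} \<gamma> \<and>
      (\<forall>y. 0 < y \<longrightarrow> y < 1 \<longrightarrow> (\<gamma> has_real_derivative \<sigma> * w y) (at y) \<and> f (\<gamma> y) = y) \<and>
      \<gamma> ` {0<..<1} = {a<..<b} \<and>
      (\<forall>y. 0 \<le> y \<longrightarrow> y \<le> 1 \<longrightarrow> 0 < w y \<and> w y \<le> \<theta>) \<and>
      (\<forall>x y. 0 \<le> x \<longrightarrow> x \<le> 1 \<longrightarrow> 0 \<le> y \<longrightarrow> y \<le> 1 \<longrightarrow> w x \<le> exp (D * \<bar>x - y\<bar>) * w y)"
proof -
  let ?I = "{a<..<b}" and ?U = "{0<..<1::real}"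
  have nz: "f' x \<noteq> 0" if "x \<in> ?I" for x
  proof -
    have "0 < 1 / \<theta>" using \<theta>(1) by simp
    then show ?thesis using \<theta>(2)[OF that] by auto
  qed
  have "continuous_on ?I f'"
    by (rule continuous_at_imp_continuous_on) (use DERIV_isCont[OF d2] in blast)
  then obtain \<sigma> where \<sigma>: "\<sigma> = 1 \<or> \<sigma> = -1" "\<And>x. x \<in> ?I \<Longrightarrow> \<bar>f' x\<bar> = \<sigma> * f' x"
    using constant_sign nz by metis
  have cf: "continuous_on ?I f"
    by (rule continuous_at_imp_continuous_on) (use DERIV_isCont[OF d1] in blast)
  define g where "g = inv_into ?I f"
  have gI: "g y \<in> ?I" "f (g y) = y" if "y \<in> ?U" for y
  proof -
    have "y \<in> f ` ?I" using bij that by (simp add: bij_betw_def)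
    then show "g y \<in> ?I" "f (g y) = y" unfolding g_def by (rule inv_into_into, rule f_inv_into_f)
  qed
  have gf: "g (f x) = x" if "x \<in> ?I" for x
    using bij that unfolding g_def bij_betw_def by (auto intro: inv_into_f_f)
  have fI: "f x \<in> ?U" if "x \<in> ?I" for x using bij that by (auto simp: bij_betw_def)
  have gd: "(g has_real_derivative inverse (f' (g y))) (at y)" if y: "y \<in> ?U" for y
    using has_real_derivative_inverse[OF d1 nz _ _ cf gf, of "g y"] gI[OF y] by simp
  have g_lip: "\<theta>-lipschitz_on ?U g"
  proof (rule lipschitz_onI)
    fix x y assume xy: "x \<in> ?U" "y \<in> ?U"
    have "norm (g x - g y) \<le> \<theta> * norm (x - y)"
    proof (rule field_differentiable_bound[of ?U g "\<lambda>y. inverse (f' (g y))"])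
      fix z assume z: "z \<in> ?U"
      show "(g has_real_derivative inverse (f' (g z))) (at z within ?U)"
        by (rule has_field_derivative_at_within[OF gd[OF z]])
      have "inverse \<bar>f' (g z)\<bar> \<le> inverse (1 / \<theta>)"
        using \<theta>(1) \<theta>(2)[OF gI(1)[OF z]] by (intro le_imp_inverse_le) auto
      then show "norm (inverse (f' (g z))) \<le> \<theta>" by (simp add: abs_inverse)
    qed (use xy in auto)
    then show "dist (g x) (g y) \<le> \<theta> * dist x y" by (simp add: dist_real_def)
  qed (use \<theta>(1) in simp)
  define l where "l y = - ln (\<sigma> * f' (g y))" for y
  have pos: "0 < \<sigma> * f' (g y)" if "y \<in> ?U" for y
    using \<sigma>(2)[OF gI(1)[OF that]] nz[OF gI(1)[OF that]] by (metis zero_less_abs_iff)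
  have l_d: "(l has_real_derivative - f'' (g y) / (f' (g y))\<^sup>2) (at y)" if y: "y \<in> ?U" for y
  proof -
    note c = DERIV_chain2[OF d2[OF gI(1)[OF y]] gd[OF y]]
    have "(l has_real_derivative - (inverse (\<sigma> * f' (g y)) * (\<sigma> * (f'' (g y) * inverse (f' (g y)))))) (at y)"
      unfolding l_def
      by (rule DERIV_minus, rule DERIV_chain2[where f = ln and g = "\<lambda>y. \<sigma> * f' (g y)"],
          rule DERIV_ln[OF pos[OF y]], rule DERIV_cmult[OF c])
    moreover have "- (inverse (\<sigma> * f' (g y)) * (\<sigma> * (f'' (g y) * inverse (f' (g y))))) = - f'' (g y) / (f' (g y))\<^sup>2"
      using \<sigma>(1) by (auto simp: power2_eq_square divide_inverse)
    ultimately show ?thesis by simp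
  qed
  have l_lip: "D-lipschitz_on ?U l"
  proof (rule lipschitz_onI)
    fix x y assume xy: "x \<in> ?U" "y \<in> ?U"
    have "norm (l x - l y) \<le> D * norm (x - y)"
    proof (rule field_differentiable_bound[of ?U l "\<lambda>y. - f'' (g y) / (f' (g y))\<^sup>2"])
      fix z assume z: "z \<in> ?U"
      show "(l has_real_derivative - f'' (g z) / (f' (g z))\<^sup>2) (at z within ?U)"
        by (rule has_field_derivative_at_within[OF l_d[OF z]])
      show "norm (- f'' (g z) / (f' (g z))\<^sup>2) \<le> D"
        using D(2)[OF gI(1)[OF z]] nz[OF gI(1)[OF z]] by (simp add: divide_le_eq)
    qed (use xy in auto)
    then show "dist (l x) (l y) \<le> D * dist x y" by (simp add: dist_real_def)
  qed (rule D(1))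
  have cl: "closure ?U = {0..1}" by simp
  obtain \<gamma> where \<gamma>: "\<theta>-lipschitz_on {0..1} \<gamma>" "\<And>y. y \<in> ?U \<Longrightarrow> \<gamma> y = g y"
    using lipschitz_extend_closure[OF g_lip] unfolding cl by blast
  obtain m where m: "D-lipschitz_on {0..1} m" "\<And>y. y \<in> ?U \<Longrightarrow> m y = l y"
    using lipschitz_extend_closure[OF l_lip] unfolding cl by blast
  define w where "w y = exp (m y)" for y
  have w_eq: "w y = inverse \<bar>f' (g y)\<bar>" if y: "y \<in> ?U" for y
    using m(2)[OF y] pos[OF y] \<sigma>(2)[OF gI(1)[OF y]] by (simp add: w_def l_def exp_minus)
  have A: "\<forall>y. 0 < y \<longrightarrow> y < 1 \<longrightarrow> (\<gamma> has_real_derivative \<sigma> * w y) (at y) \<and> f (\<gamma> y) = y"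
  proof (intro allI impI conjI)
    fix y :: real assume y: "0 < y" "y < 1"
    have yU: "y \<in> ?U" using y by simp
    have "\<sigma> * w y = inverse (f' (g y))"
      unfolding w_eq[OF yU] \<sigma>(2)[OF gI(1)[OF yU]] using \<sigma>(1) by auto
    then have "(g has_real_derivative \<sigma> * w y) (at y)" using gd[OF yU] by simp
    then show "(\<gamma> has_real_derivative \<sigma> * w y) (at y)"
      by (rule has_field_derivative_transform_within_open[of _ _ _ ?U]) (use \<gamma>(2) y in auto)
    show "f (\<gamma> y) = y" using \<gamma>(2)[OF yU] gI(2)[OF yU] by simp
  qed
  have B: "\<gamma> ` ?U = ?I"
  proof -
    have "\<gamma> ` ?U = g ` ?U" using \<gamma>(2) by (rule image_cong[OF refl])
    also have "\<dots> = ?I" using gI(1) gf fI by force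
    finally show ?thesis .
  qed
  have C: "\<forall>y. 0 \<le> y \<longrightarrow> y \<le> 1 \<longrightarrow> 0 < w y \<and> w y \<le> \<theta>"
  proof (intro allI impI)
    fix y :: real assume y: "0 \<le> y" "y \<le> 1"
    have "w y \<le> \<theta>"
    proof (rule continuous_on_unit_le[OF _ _ y])
      show "continuous_on {0..1} w"
        unfolding w_def by (intro continuous_intros lipschitz_on_continuous_on[OF m(1)])
      fix y :: real assume "0 < y" "y < 1"
      then have yU: "y \<in> ?U" by simp
      have "inverse \<bar>f' (g y)\<bar> \<le> inverse (1 / \<theta>)"
        using \<theta>(1) \<theta>(2)[OF gI(1)[OF yU]] by (intro le_imp_inverse_le) auto
      then show "w y \<le> \<theta>" using w_eq[OF yU] by simp
    qed
    then show "0 < w y \<and> w y \<le> \<theta>" by (simp add: w_def)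
  qed
  have E: "\<forall>x y. 0 \<le> x \<longrightarrow> x \<le> 1 \<longrightarrow> 0 \<le> y \<longrightarrow> y \<le> 1 \<longrightarrow> w x \<le> exp (D * \<bar>x - y\<bar>) * w y"
  proof (intro allI impI)
    fix x y :: real assume that: "0 \<le> x" "x \<le> 1" "0 \<le> y" "y \<le> 1"
    have "\<bar>m x - m y\<bar> \<le> D * \<bar>x - y\<bar>"
      using lipschitz_onD[OF m(1), of x y] that by (simp add: dist_real_def)
    then have "exp (m x) \<le> exp (D * \<bar>x - y\<bar> + m y)" by simp
    then show "w x \<le> exp (D * \<bar>x - y\<bar>) * w y" by (simp add: w_def exp_add)
  qed
  have "continuous_on {0..1} \<gamma>" by (rule lipschitz_on_continuous_on[OF \<gamma>(1)])
  then show ?thesis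
    by (intro exI[of _ \<sigma>] exI[of _ \<gamma>] exI[of _ w] conjI \<sigma>(1) A B C E)
qed

lemma full_branch_system_of_C2:
  fixes f f' f'' :: "real \<Rightarrow> real"
  assumes part: "interval_partition N a b"
    and bij: "\<And>i. i \<in> N \<Longrightarrow> bij_betw f {a i<..<b i} {0<..<1}"
    and d1: "\<And>i x. \<lbrakk>i \<in> N; x \<in> {a i<..<b i}\<rbrakk> \<Longrightarrow> (f has_real_derivative f' x) (at x)"
    and d2: "\<And>i x. \<lbrakk>i \<in> N; x \<in> {a i<..<b i}\<rbrakk> \<Longrightarrow> (f' has_real_derivative f'' x) (at x)"
    and \<theta>: "0 < \<theta>" "\<And>i x. \<lbrakk>i \<in> N; x \<in> {a i<..<b i}\<rbrakk> \<Longrightarrow> 1 / \<theta> \<le> \<bar>f' x\<bar>"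
    and D: "0 \<le> D" "\<And>i x. \<lbrakk>i \<in> N; x \<in> {a i<..<b i}\<rbrakk> \<Longrightarrow> \<bar>f'' x\<bar> \<le> D * (f' x)\<^sup>2"
  shows "\<exists>\<sigma> \<gamma> w. full_branch_system N a b f \<sigma> \<gamma> w \<theta> D"
proof -
  define Q where "Q i \<sigma> \<gamma> w \<longleftrightarrow> (\<sigma> = 1 \<or> \<sigma> = (-1::real)) \<and> continuous_on {0..1} \<gamma> \<and>
      (\<forall>y. 0 < y \<longrightarrow> y < 1 \<longrightarrow> (\<gamma> has_real_derivative \<sigma> * w y) (at y) \<and> f (\<gamma> y) = y) \<and>
      \<gamma> ` {0<..<1} = {a i<..<b i} \<and>
      (\<forall>y. 0 \<le> y \<longrightarrow> y \<le> 1 \<longrightarrow> 0 < w y \<and> w y \<le> \<theta>) \<and>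
      (\<forall>x y. 0 \<le> x \<longrightarrow> x \<le> 1 \<longrightarrow> 0 \<le> y \<longrightarrow> y \<le> 1 \<longrightarrow> w x \<le> exp (D * \<bar>x - y\<bar>) * w y)"
    for i \<sigma> \<gamma> w
  have "\<forall>i\<in>N. \<exists>\<sigma> \<gamma> w. Q i \<sigma> \<gamma> w"
  proof
    fix i assume i: "i \<in> N"
    show "\<exists>\<sigma> \<gamma> w. Q i \<sigma> \<gamma> w"
      unfolding Q_def
      by (rule inverse_branch_of_C2[OF bij[OF i] d1[OF i] d2[OF i] \<theta>(1) \<theta>(2)[OF i] D(1) D(2)[OF i]])
  qed
  then obtain \<sigma> \<gamma> w where Q: "\<And>i. i \<in> N \<Longrightarrow> Q i (\<sigma> i) (\<gamma> i) (w i)" by metis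
  have "full_branch_system N a b f \<sigma> \<gamma> (\<lambda>i y. if i \<in> N then w i y else 0) \<theta> D"
  proof
    show "interval_partition N a b" by (rule part)
    show "0 < \<theta>" "0 \<le> D" by fact+
  qed (use Q in \<open>simp_all add: Q_def\<close>)
  then show ?thesis by blast
qed

section \<open>\<open>C\<^sup>2\<close>-close maps\<close>

lemma partial_deriv_real_eq:
  assumes S: "open S" "x \<in> S" and eq: "\<And>z. z \<in> S \<Longrightarrow> v z = u z"
    and u: "(u has_real_derivative c) (at x)"
  shows "partial_deriv S 1 v x = c"
proof -
  have "(v has_derivative (*) c) (at x)"
    using u unfolding has_field_derivative_def
    by (rule has_derivative_transform_within_open[OF _ S]) (simp add: eq)
  then have "frechet_derivative v (at x) = (*) c" by (rule frechet_derivative_at[symmetric])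
  then show ?thesis by (simp add: partial_deriv_def at_within_open[OF S(2,1)])
qed

lemma C2_on_real:
  fixes f :: "real \<Rightarrow> real"
  assumes S: "open S" and f: "C2_on S f" and x: "x \<in> S"
  shows "(f has_real_derivative deriv f x) (at x)"
    and "(deriv f has_real_derivative deriv (deriv f) x) (at x)"
proof -
  have d: "(f has_real_derivative deriv f z) (at z)" if "z \<in> S" for z
  proof -
    have "f differentiable (at z within S)" using f that by (simp add: C2_on_def differentiable_on_def)
    then have "f differentiable (at z)" unfolding at_within_open[OF that S] .
    then show ?thesis by (simp add: DERIV_deriv_iff_real_differentiable)
  qed
  then show "(f has_real_derivative deriv f x) (at x)" using x .
  have eq: "partial_deriv S 1 f z = deriv f z" if "z \<in> S" for z
    by (rule partial_deriv_real_eq[OF S that refl d[OF that]])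
  have "partial_deriv S 1 f differentiable (at x within S)"
    using f x by (simp add: C2_on_def differentiable_on_def)
  then have "partial_deriv S 1 f differentiable (at x)" unfolding at_within_open[OF x S] .
  then have "deriv f differentiable (at x)"
    unfolding differentiable_def using has_derivative_transform_within_open[OF _ S x] eq by blast
  then show "(deriv f has_real_derivative deriv (deriv f) x) (at x)"
    by (simp add: DERIV_deriv_iff_real_differentiable)
qed

lemma C2_norm_leD:
  assumes n: "C2_norm S d \<le> ereal r" and p: "p \<in> S"
  shows "\<bar>d p\<bar> \<le> r"
    and "e \<in> Basis \<Longrightarrow> \<bar>partial_deriv S e d p\<bar> \<le> r"
    and "\<lbrakk>e \<in> Basis; e' \<in> Basis\<rbrakk> \<Longrightarrow> \<bar>partial_deriv S e' (partial_deriv S e d) p\<bar> \<le> r"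
proof -
  have *: "t \<le> r" if "ereal t \<in> (\<lambda>p. ereal \<bar>d p\<bar>) ` S
        \<union> {ereal \<bar>partial_deriv S e d p\<bar> | e p. e \<in> Basis \<and> p \<in> S}
        \<union> {ereal \<bar>partial_deriv S e' (partial_deriv S e d) p\<bar> | e e' p.
              e \<in> Basis \<and> e' \<in> Basis \<and> p \<in> S}" for t
    using order_trans[OF Sup_upper[OF that] n[unfolded C2_norm_def]] by simp
  show "\<bar>d p\<bar> \<le> r" using p by (intro *) blast
  show "e \<in> Basis \<Longrightarrow> \<bar>partial_deriv S e d p\<bar> \<le> r" using p by (intro *) blast
  show "\<lbrakk>e \<in> Basis; e' \<in> Basis\<rbrakk> \<Longrightarrow> \<bar>partial_deriv S e' (partial_deriv S e d) p\<bar> \<le> r"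
    using p by (intro *) blast
qed

lemma C2_difference_bounds:
  fixes f g :: "real \<Rightarrow> real"
  assumes S: "open S" and f: "C2_on S f" and g: "C2_on S g"
    and n: "C2_norm S (\<lambda>x. f x - g x) \<le> ereal r" and x: "x \<in> S"
  shows "\<bar>f x - g x\<bar> \<le> r" "\<bar>deriv f x - deriv g x\<bar> \<le> r"
    "\<bar>deriv (deriv f) x - deriv (deriv g) x\<bar> \<le> r"
proof -
  let ?d = "\<lambda>x. f x - g x"
  have eq: "partial_deriv S 1 ?d z = deriv f z - deriv g z" if z: "z \<in> S" for z
    by (rule partial_deriv_real_eq[OF S z refl])
      (intro DERIV_diff C2_on_real(1)[OF S f z] C2_on_real(1)[OF S g z])
  have eq': "partial_deriv S 1 (partial_deriv S 1 ?d) x = deriv (deriv f) x - deriv (deriv g) x"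
  proof (rule partial_deriv_real_eq[OF S x])
    show "((\<lambda>z. deriv f z - deriv g z) has_real_derivative deriv (deriv f) x - deriv (deriv g) x) (at x)"
      by (intro DERIV_diff C2_on_real(2)[OF S f x] C2_on_real(2)[OF S g x])
  qed (rule eq)
  show "\<bar>f x - g x\<bar> \<le> r" by (rule C2_norm_leD(1)[OF n x])
  show "\<bar>deriv f x - deriv g x\<bar> \<le> r" using C2_norm_leD(2)[OF n x, of 1] eq[OF x] by simp
  show "\<bar>deriv (deriv f) x - deriv (deriv g) x\<bar> \<le> r"
    using C2_norm_leD(3)[OF n x, of 1 1] eq' by simp
qed

text \<open>The strip contains the segments parallel to the axes between its points, so that bounds on
  partial derivatives give Lipschitz bounds in each variable.\<close>

lemma directional_lipschitz:
  fixes d :: "'a::euclidean_space \<Rightarrow> real" and c :: "real \<Rightarrow> 'a"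
  assumes d: "d differentiable_on S" and T: "convex T" and c: "\<And>t. t \<in> T \<Longrightarrow> c t \<in> S"
    and c': "\<And>t. t \<in> T \<Longrightarrow> (c has_derivative (\<lambda>s. s *\<^sub>R e)) (at t within T)"
    and b: "\<And>p. p \<in> S \<Longrightarrow> \<bar>partial_deriv S e d p\<bar> \<le> r" and st: "s \<in> T" "t \<in> T"
  shows "\<bar>d (c s) - d (c t)\<bar> \<le> r * \<bar>s - t\<bar>"
proof -
  have "norm (d (c s) - d (c t)) \<le> r * norm (s - t)"
  proof (rule field_differentiable_bound[OF T])
    fix z assume z: "z \<in> T"
    let ?F = "frechet_derivative d (at (c z) within S)"
    have "(d has_derivative ?F) (at (c z) within S)"
      using d c[OF z] by (simp add: differentiable_on_def frechet_derivative_works)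
    then have "(d has_derivative ?F) (at (c z) within c ` T)"
      by (rule has_derivative_subset) (use c in auto)
    from has_derivative_in_compose[OF c'[OF z] this]
    have "((\<lambda>t. d (c t)) has_derivative (\<lambda>s. ?F (s *\<^sub>R e))) (at z within T)" .
    moreover have "?F (s *\<^sub>R e) = partial_deriv S e d (c z) * s" for s
      using linear_frechet_derivative[of d "at (c z) within S"] d c[OF z]
      by (simp add: differentiable_on_def linear_cmul partial_deriv_def mult.commute)
    ultimately show "((\<lambda>t. d (c t)) has_field_derivative partial_deriv S e d (c z)) (at z within T)"
      by (simp add: has_field_derivative_def)
    show "norm (partial_deriv S e d (c z)) \<le> r" using b[OF c[OF z]] by simp
  qed (use st in auto)
  then show ?thesis by simp
qed

lemma fiber_difference_bounds:
  fixes g h :: "real \<Rightarrow> real \<Rightarrow> real"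
  assumes g: "C2_on ({a<..<b} \<times> {0..1}) (\<lambda>(x, y). g x y)" and h: "C2_on ({a<..<b} \<times> {0..1}) (\<lambda>(x, y). h x y)"
    and n: "C2_norm ({a<..<b} \<times> {0..1}) (\<lambda>(x, y). g x y - h x y) \<le> ereal r"
  shows "\<lbrakk>x \<in> {a<..<b}; y \<in> {0..1}\<rbrakk> \<Longrightarrow> \<bar>g x y - h x y\<bar> \<le> r"
    and "\<lbrakk>x \<in> {a<..<b}; y \<in> {0..1}; z \<in> {0..1}\<rbrakk> \<Longrightarrow>
      \<bar>(g x y - h x y) - (g x z - h x z)\<bar> \<le> r * \<bar>y - z\<bar>"
    and "\<lbrakk>x \<in> {a<..<b}; x' \<in> {a<..<b}; y \<in> {0..1}\<rbrakk> \<Longrightarrow>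
      \<bar>(g x y - h x y) - (g x' y - h x' y)\<bar> \<le> r * \<bar>x - x'\<bar>"
proof -
  let ?S = "{a<..<b} \<times> {0..1::real}" and ?d = "\<lambda>(x, y). g x y - h x y"
  have "(\<lambda>p. (case p of (x, y) \<Rightarrow> g x y) - (case p of (x, y) \<Rightarrow> h x y)) differentiable_on ?S"
    by (rule differentiable_on_diff) (use g h in \<open>simp_all add: C2_on_def\<close>)
  moreover have "(\<lambda>p. (case p of (x, y) \<Rightarrow> g x y) - (case p of (x, y) \<Rightarrow> h x y)) = ?d"
    by (simp add: fun_eq_iff split: prod.split)
  ultimately have d: "?d differentiable_on ?S" by simp
  have B: "(1, 0) \<in> (Basis :: (real \<times> real) set)" "(0, 1) \<in> (Basis :: (real \<times> real) set)"
    by (auto simp: Basis_prod_def)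
  show "\<lbrakk>x \<in> {a<..<b}; y \<in> {0..1}\<rbrakk> \<Longrightarrow> \<bar>g x y - h x y\<bar> \<le> r"
    using C2_norm_leD(1)[OF n, of "(x, y)"] by simp
  show "\<bar>(g x y - h x y) - (g x z - h x z)\<bar> \<le> r * \<bar>y - z\<bar>"
    if "x \<in> {a<..<b}" "y \<in> {0..1}" "z \<in> {0..1}"
  proof -
    have "\<bar>?d (x, y) - ?d (x, z)\<bar> \<le> r * \<bar>y - z\<bar>"
    proof (rule directional_lipschitz[OF d, of "{0..1}" "\<lambda>t. (x, t)" "(0, 1)"])
      show "((\<lambda>t. (x, t)) has_derivative (\<lambda>s. s *\<^sub>R (0, 1))) (at t within {0..1})" for t
        by (auto intro!: derivative_eq_intros)
      show "\<bar>partial_deriv ?S (0, 1) ?d p\<bar> \<le> r" if "p \<in> ?S" for p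
        by (rule C2_norm_leD(2)[OF n that B(2)])
    qed (use that in auto)
    then show ?thesis by simp
  qed
  show "\<bar>(g x y - h x y) - (g x' y - h x' y)\<bar> \<le> r * \<bar>x - x'\<bar>"
    if "x \<in> {a<..<b}" "x' \<in> {a<..<b}" "y \<in> {0..1}"
  proof -
    have "\<bar>?d (x, y) - ?d (x', y)\<bar> \<le> r * \<bar>x - x'\<bar>"
    proof (rule directional_lipschitz[OF d, of "{a<..<b}" "\<lambda>t. (t, y)" "(1, 0)"])
      show "((\<lambda>t. (t, y)) has_derivative (\<lambda>s. s *\<^sub>R (1, 0))) (at t within {a<..<b})" for t
        by (auto intro!: derivative_eq_intros)
      show "\<bar>partial_deriv ?S (1, 0) ?d p\<bar> \<le> r" if "p \<in> ?S" for p
        by (rule C2_norm_leD(2)[OF n that B(1)])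
    qed (use that in auto)
    then show ?thesis by simp
  qed
qed

section \<open>Perturbations of a full-branch map\<close>

text \<open>As \<open>\<bar>g'\<bar> \<ge> 1\<close> and \<open>\<delta> \<le> 1/2\<close>, one has \<open>\<bar>g'\<bar> \<le> 2 * \<bar>f'\<bar>\<close> and \<open>\<delta> \<le> 2 * f'\<^sup>2\<close>, which turns the distortion
  constant \<open>D\<close> into \<open>4 * D + 2\<close>.\<close>

lemma perturbed_system:
  fixes f g f' g' f'' g'' :: "real \<Rightarrow> real"
  assumes part: "interval_partition N a b" and \<delta>: "0 \<le> \<delta>" "\<delta> \<le> 1/2" and D: "0 \<le> D"
    and bij: "\<And>i. i \<in> N \<Longrightarrow> bij_betw f {a i<..<b i} {0<..<1}"
    and d1: "\<And>i x. \<lbrakk>i \<in> N; x \<in> {a i<..<b i}\<rbrakk> \<Longrightarrow> (f has_real_derivative f' x) (at x)"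
    and d2: "\<And>i x. \<lbrakk>i \<in> N; x \<in> {a i<..<b i}\<rbrakk> \<Longrightarrow> (f' has_real_derivative f'' x) (at x)"
    and g1: "\<And>i x. \<lbrakk>i \<in> N; x \<in> {a i<..<b i}\<rbrakk> \<Longrightarrow> 1 \<le> \<bar>g' x\<bar>"
    and g2: "\<And>i x. \<lbrakk>i \<in> N; x \<in> {a i<..<b i}\<rbrakk> \<Longrightarrow> \<bar>g'' x\<bar> \<le> D * (g' x)\<^sup>2"
    and c1: "\<And>i x. \<lbrakk>i \<in> N; x \<in> {a i<..<b i}\<rbrakk> \<Longrightarrow> \<bar>f' x - g' x\<bar> \<le> \<delta>"
    and c2: "\<And>i x. \<lbrakk>i \<in> N; x \<in> {a i<..<b i}\<rbrakk> \<Longrightarrow> \<bar>f'' x - g'' x\<bar> \<le> \<delta>"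
  shows "\<exists>\<sigma> \<gamma> w. full_branch_system N a b f \<sigma> \<gamma> w (1 / (1 - \<delta>)) (4 * D + 2)"
proof (rule full_branch_system_of_C2[OF part bij d1 d2])
  fix i x assume ix: "i \<in> N" "x \<in> {a i<..<b i}"
  have l: "1 - \<delta> \<le> \<bar>f' x\<bar>" using g1[OF ix] c1[OF ix] by linarith
  then show "1 / (1 / (1 - \<delta>)) \<le> \<bar>f' x\<bar>" by simp
  have "\<bar>g' x\<bar> \<le> 2 * \<bar>f' x\<bar>" using l c1[OF ix] \<delta> by linarith
  then have "\<bar>g' x\<bar>\<^sup>2 \<le> (2 * \<bar>f' x\<bar>)\<^sup>2" by (rule power_mono) simp
  then have "D * (g' x)\<^sup>2 \<le> D * (4 * (f' x)\<^sup>2)" using D by (intro mult_left_mono) (auto simp: power_mult_distrib)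
  moreover have "(1/2)\<^sup>2 \<le> \<bar>f' x\<bar>\<^sup>2" using l \<delta> by (intro power_mono) auto
  then have "\<delta> \<le> 2 * (f' x)\<^sup>2" using \<delta> by (simp add: power2_eq_square)
  ultimately show "\<bar>f'' x\<bar> \<le> (4 * D + 2) * (f' x)\<^sup>2"
    using g2[OF ix] c2[OF ix] by (simp add: algebra_simps)
qed (use \<delta> D in auto)

text \<open>The map \<open>f\<close> is a perturbation of \<open>g\<close>; both come with inverse branches and with a common
  distortion constant, so that all constants below depend on \<open>D\<close> alone.\<close>

locale perturbed_full_branch =
  F: full_branch_system N a b f \<sigma> \<gamma> w "1 / (1 - \<delta>)" D + G: full_branch_system N a b g \<tau> \<eta> k 1 D
  for N a b f \<sigma> \<gamma> w \<delta> D g \<tau> \<eta> k +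
  assumes delta: "0 \<le> \<delta>" "\<delta> \<le> 1/2"
    and close: "\<And>i x. \<lbrakk>i \<in> N; x \<in> {a i<..<b i}\<rbrakk> \<Longrightarrow> \<bar>f x - g x\<bar> \<le> \<delta>"
    and close_deriv: "\<And>i x. \<lbrakk>i \<in> N; x \<in> {a i<..<b i}\<rbrakk> \<Longrightarrow> \<bar>deriv f x - deriv g x\<bar> \<le> \<delta>"
begin

lemma w_eq: "\<lbrakk>i \<in> N; x \<in> {a i<..<b i}\<rbrakk> \<Longrightarrow> w i (f x) = 1 / \<bar>deriv f x\<bar>"
  using F.recip_abs_deriv(1)[of i x] by simp

lemma k_eq: "\<lbrakk>i \<in> N; x \<in> {a i<..<b i}\<rbrakk> \<Longrightarrow> k i (g x) = 1 / \<bar>deriv g x\<bar>"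
  using G.recip_abs_deriv(1)[of i x] by simp

lemma deriv_g_ge: assumes ix: "i \<in> N" "x \<in> {a i<..<b i}" shows "1 \<le> \<bar>deriv g x\<bar>"
  using G.weight_bounds_on_branch[of i x] k_eq[OF ix] G.recip_abs_deriv(2)[of i x] ix
  by (simp add: divide_le_eq)

text \<open>Two numbers of absolute value at least \<open>1/2\<close> and \<open>1\<close> that differ by at most \<open>1/2\<close> have the same
  sign.\<close>

lemma orientation: assumes i: "i \<in> N" shows "\<sigma> i = \<tau> i"
proof -
  obtain x where x: "x \<in> {a i<..<b i}" using F.interval[OF i] by (meson dense greaterThanLessThan_iff)
  have *: "\<sigma> i = \<tau> i" if "0 < u" "1 \<le> v" "\<bar>\<sigma> i * u - \<tau> i * v\<bar> \<le> 1/2" for u v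
    using that F.sign[OF i] G.sign[OF i] by auto
  have "deriv f x = \<sigma> i * (1 / w i (f x))" "deriv g x = \<tau> i * (1 / k i (g x))"
    using F.deriv_branch[OF i] G.deriv_branch[OF i] x by auto
  then show ?thesis
    using *[of "1 / w i (f x)" "1 / k i (g x)"] close_deriv[OF i x] delta
      F.weight_bounds_on_branch[OF i, of x] G.weight_bounds_on_branch[OF i, of x] x by auto
qed

text \<open>Relative closeness of the derivatives, as \<open>\<bar>g'\<bar> \<ge> 1\<close>.\<close>

lemma w_le:
  assumes ix: "i \<in> N" "x \<in> {a i<..<b i}" shows "w i (f x) \<le> k i (g x) / (1 - \<delta>)"
proof -
  have g1: "1 \<le> \<bar>deriv g x\<bar>" by (rule deriv_g_ge[OF ix])
  have "\<delta> * 1 \<le> \<delta> * \<bar>deriv g x\<bar>" using g1 delta by (intro mult_left_mono) auto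
  then have "(1 - \<delta>) * \<bar>deriv g x\<bar> \<le> \<bar>deriv f x\<bar>"
    using close_deriv[OF ix] by (simp add: left_diff_distrib)
  moreover have "0 < (1 - \<delta>) * \<bar>deriv g x\<bar>" using g1 delta by (intro mult_pos_pos) auto
  ultimately have "1 / \<bar>deriv f x\<bar> \<le> 1 / ((1 - \<delta>) * \<bar>deriv g x\<bar>)" by (intro divide_left_mono) auto
  then show ?thesis unfolding w_eq[OF ix] k_eq[OF ix] by (simp add: mult.commute)
qed

text \<open>\<open>K * len i\<close> is the Lipschitz constant of the \<open>i\<close>-th weight, by \<open>weight_lipschitz\<close>.\<close>

definition K :: real where "K = D * exp (2 * D)"
definition C :: real where "C = K + 2 * exp D"

lemma K_nonneg: "0 \<le> K" using F.D_nonneg by (simp add: K_def)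

lemma len_le_1: "F.len i \<le> 1"
  using F.interval[of i] by (auto simp: F.len_def)

text \<open>Both maps are compared at \<open>x = \<gamma> i y\<close>: there \<open>g x\<close> is within \<open>\<delta>\<close> of \<open>f x = y\<close>, and moving from \<open>g x\<close> to
  \<open>y\<close> changes \<open>\<eta> i\<close> and its weight by multiples of \<open>len i * \<delta>\<close>. The factor \<open>len i\<close> makes the differences
  summable over the branches.\<close>

lemma perturbed_point:
  assumes i: "i \<in> N" and y: "0 < y" "y < 1"
  shows "\<bar>\<gamma> i y - \<eta> i y\<bar> \<le> C * F.len i * \<delta>" and "\<bar>w i y - k i y\<bar> \<le> C * F.len i * \<delta>"
proof -
  define x where "x = \<gamma> i y"
  have x: "x \<in> {a i<..<b i}" "f x = y"
    using F.inverse_branch_interior[OF i y] F.right_inverse[OF i y] by (auto simp: x_def)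
  have gx: "0 < g x" "g x < 1" "\<eta> i (g x) = x" using G.left_inverse[OF i, of x] x by auto
  have c: "\<bar>g x - y\<bar> \<le> \<delta>" using close[OF i x(1)] x(2) by (simp add: abs_minus_commute)
  have len: "0 \<le> F.len i" by (rule F.len_nonneg)
  have eD: "exp D * F.len i * \<delta> \<le> C * F.len i * \<delta>"
    using K_nonneg len delta by (intro mult_right_mono) (auto simp: C_def)
  have "\<bar>\<eta> i (g x) - \<eta> i y\<bar> \<le> exp D * F.len i * \<bar>g x - y\<bar>"
    by (rule G.inverse_branch_lipschitz_len[OF i]) (use gx y in auto)
  also have "\<dots> \<le> exp D * F.len i * \<delta>" using c len by (intro mult_left_mono) auto
  finally show "\<bar>\<gamma> i y - \<eta> i y\<bar> \<le> C * F.len i * \<delta>" using eD gx(3) x_def by simp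
  have "\<bar>k i (g x) - k i y\<bar> \<le> K * F.len i * \<bar>g x - y\<bar>"
    unfolding K_def by (rule G.weight_lipschitz) (use gx y in auto)
  also have "\<dots> \<le> K * F.len i * \<delta>" using c len K_nonneg by (intro mult_left_mono) auto
  finally have 1: "\<bar>k i (g x) - k i y\<bar> \<le> K * F.len i * \<delta>" .
  have 2: "\<bar>w i (f x) - k i (g x)\<bar> \<le> 2 * exp D * F.len i * \<delta>"
  proof -
    have g1: "1 \<le> \<bar>deriv g x\<bar>" by (rule deriv_g_ge[OF i x(1)])
    have f1: "1/2 \<le> \<bar>deriv f x\<bar>" using g1 close_deriv[OF i x(1)] delta by linarith
    have nz: "\<bar>deriv f x\<bar> \<noteq> 0" "\<bar>deriv g x\<bar> \<noteq> 0" using f1 g1 by linarith+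
    have "w i (f x) - k i (g x) = (\<bar>deriv g x\<bar> - \<bar>deriv f x\<bar>) * (1 / \<bar>deriv f x\<bar>) * (1 / \<bar>deriv g x\<bar>)"
      unfolding w_eq[OF i x(1)] k_eq[OF i x(1)] using nz by (simp add: field_simps)
    then have "\<bar>w i (f x) - k i (g x)\<bar>
        = \<bar>\<bar>deriv g x\<bar> - \<bar>deriv f x\<bar>\<bar> * (1 / \<bar>deriv f x\<bar>) * (1 / \<bar>deriv g x\<bar>)"
      by (simp add: abs_mult)
    also have "\<dots> \<le> \<delta> * 2 * (exp D * F.len i)"
    proof (intro mult_mono)
      show "\<bar>\<bar>deriv g x\<bar> - \<bar>deriv f x\<bar>\<bar> \<le> \<delta>" using close_deriv[OF i x(1)] by linarith
      show "1 / \<bar>deriv f x\<bar> \<le> 2" using f1 by (simp add: divide_le_eq)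
      show "1 / \<bar>deriv g x\<bar> \<le> exp D * F.len i"
        using G.weight_le_len[of "g x" i] k_eq[OF i x(1)] gx by simp
    qed (use delta len in auto)
    finally show ?thesis by (simp add: mult_ac)
  qed
  have "C * F.len i * \<delta> = K * F.len i * \<delta> + 2 * exp D * F.len i * \<delta>"
    by (simp add: C_def distrib_right)
  then show "\<bar>w i y - k i y\<bar> \<le> C * F.len i * \<delta>" using 1 2 x(2) by simp
qed

lemma perturbed_point_closed:
  assumes i: "i \<in> N" and y: "0 \<le> y" "y \<le> 1"
  shows "\<bar>\<gamma> i y - \<eta> i y\<bar> \<le> C * F.len i * \<delta>" and "\<bar>w i y - k i y\<bar> \<le> C * F.len i * \<delta>"
proof -
  show "\<bar>\<gamma> i y - \<eta> i y\<bar> \<le> C * F.len i * \<delta>"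
    by (rule continuous_on_unit_le[of "\<lambda>y. \<bar>\<gamma> i y - \<eta> i y\<bar>", OF _ _ y])
      (intro continuous_intros F.cont[OF i] G.cont[OF i], rule perturbed_point(1)[OF i])
  show "\<bar>w i y - k i y\<bar> \<le> C * F.len i * \<delta>"
    by (rule continuous_on_unit_le[of "\<lambda>y. \<bar>w i y - k i y\<bar>", OF _ _ y])
      (intro continuous_intros F.continuous_weight G.continuous_weight, rule perturbed_point(2)[OF i])
qed

text \<open>The points \<open>f x\<close> and \<open>g x\<close> may lie in different branch intervals, however close they are. As
  the branch of \<open>g\<close> is onto, \<open>f x = g x'\<close> for some \<open>x'\<close> near \<open>x\<close> in the same branch interval as
  \<open>x\<close>, and expansion of \<open>g\<^sup>2\<close> is used at \<open>x'\<close>.\<close>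

lemma perturbed_square_contraction:
  assumes \<rho>: "1 < \<rho>" "\<And>x. x \<in> iterate_domain N a b g 2 \<Longrightarrow> \<rho> \<le> \<bar>deriv (g ^^ 2) x\<bar>"
    and ij: "i \<in> N" "j \<in> N" and x: "a i < x" "x < b i" and fx: "a j < f x" "f x < b j"
  shows "w i (f x) * w j (f (f x)) \<le> (1 / \<rho> + K * \<delta>) / (1 - \<delta>)\<^sup>2"
proof -
  have xI: "x \<in> {a i<..<b i}" and fxJ: "f x \<in> {a j<..<b j}" using x fx by auto
  have f01: "0 < f x" "f x < 1" using F.left_inverse[OF ij(1) x] by auto
  define x' where "x' = \<eta> i (f x)"
  have x': "a i < x'" "x' < b i" "g x' = f x"
    using G.inverse_branch_interior[OF ij(1) f01] G.right_inverse[OF ij(1) f01] by (auto simp: x'_def)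
  have gx: "0 < g x" "g x < 1" using G.left_inverse[OF ij(1) x] by auto
  have "\<bar>k i (g x) - k i (f x)\<bar> \<le> K * F.len i * \<bar>g x - f x\<bar>"
    unfolding K_def by (rule G.weight_lipschitz) (use gx f01 in auto)
  also have "\<dots> \<le> K * 1 * \<delta>"
    using close[OF ij(1) xI] len_le_1[of i] F.len_nonneg[of i] K_nonneg
    by (intro mult_mono) (auto simp: abs_minus_commute)
  finally have near: "k i (g x) \<le> k i (g x') + K * \<delta>" using x'(3) by simp
  have "x' \<in> iterate_domain N a b g 2"
    using x' fx ij by (auto simp: iterate_domain_def numeral_2_eq_2 less_Suc_eq)
  then have "\<rho> \<le> \<bar>deriv (g ^^ 2) x'\<bar>" by (rule \<rho>(2))
  also have "deriv (g ^^ 2) x' = deriv g (g x') * deriv g x'"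
  proof -
    have "(g has_real_derivative deriv g x') (at x')"
      using G.branch_derivative[OF ij(1) x'(1,2)] DERIV_imp_deriv by metis
    moreover have "(g has_real_derivative deriv g (g x')) (at (g x'))"
      using G.branch_derivative[OF ij(2), of "g x'"] DERIV_imp_deriv fx unfolding x'(3) by metis
    ultimately have "((\<lambda>x. g (g x)) has_real_derivative deriv g (g x') * deriv g x') (at x')"
      by (rule DERIV_chain2[rotated])
    then have "deriv (\<lambda>x. g (g x)) x' = deriv g (g x') * deriv g x'" by (rule DERIV_imp_deriv)
    moreover have "g ^^ 2 = (\<lambda>x. g (g x))" by (simp add: numeral_2_eq_2 fun_eq_iff)
    ultimately show ?thesis by simp
  qed
  finally have "\<rho> \<le> \<bar>deriv g (g x')\<bar> * \<bar>deriv g x'\<bar>" by (simp add: abs_mult)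
  then have "1 / (\<bar>deriv g (g x')\<bar> * \<bar>deriv g x'\<bar>) \<le> 1 / \<rho>" using \<rho>(1) by (intro divide_left_mono mult_pos_pos) auto
  then have prod: "k i (g x') * k j (g (g x')) \<le> 1 / \<rho>"
    using k_eq[OF ij(1), of x'] k_eq[OF ij(2), of "g x'"] x' fx by (simp add: mult.commute)
  have kj: "0 < k j (g (g x'))" "k j (g (g x')) \<le> 1"
    using G.weight_bounds_on_branch[OF ij(2), of "g x'"] x'(3) fx by auto
  have ki: "0 < k i (g x)" using G.weight_bounds_on_branch[OF ij(1) x] by simp
  have d: "0 < 1 - \<delta>" using delta by simp
  have "w i (f x) * w j (f (f x)) \<le> (k i (g x) / (1 - \<delta>)) * (k j (g (f x)) / (1 - \<delta>))"
    using w_le[OF ij(1) xI] w_le[OF ij(2) fxJ] F.weight_bounds_on_branch(1)[OF ij(2) fx] ki d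
    by (intro mult_mono) auto
  also have "\<dots> = (k i (g x) * k j (g (g x'))) / (1 - \<delta>)\<^sup>2" by (simp add: x'(3) power2_eq_square)
  also have "\<dots> \<le> (1 / \<rho> + K * \<delta>) / (1 - \<delta>)\<^sup>2"
  proof (rule divide_right_mono)
    have "k i (g x) * k j (g (g x')) \<le> (k i (g x') + K * \<delta>) * k j (g (g x'))"
      using near kj by (intro mult_right_mono) auto
    also have "\<dots> = k i (g x') * k j (g (g x')) + (K * \<delta>) * k j (g (g x'))" by (rule distrib_right)
    also have "\<dots> \<le> 1 / \<rho> + (K * \<delta>) * 1"
      using prod kj K_nonneg delta by (intro add_mono mult_left_mono) auto
    finally show "k i (g x) * k j (g (g x')) \<le> 1 / \<rho> + K * \<delta>" by simp
  qed simp
  finally show ?thesis .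
qed

end

lemma infsum_ereal_le:
  assumes "\<And>i. i \<in> A \<Longrightarrow> 0 \<le> t i" and "\<And>F. \<lbrakk>finite F; F \<subseteq> A\<rbrakk> \<Longrightarrow> (\<Sum>i\<in>F. t i) \<le> r"
  shows "(\<Sum>\<^sub>\<infinity>i\<in>A. ereal (t i)) \<le> ereal r"
proof -
  have "(\<Sum>\<^sub>\<infinity>i\<in>A. ereal (t i)) = (SUP F\<in>{F. finite F \<and> F \<subseteq> A}. \<Sum>i\<in>F. ereal (t i))"
    by (rule nonneg_infsum_complete) (use assms(1) in auto)
  also have "\<dots> \<le> ereal r" by (rule SUP_least) (use assms(2) in auto)
  finally show ?thesis .
qed

context perturbed_full_branch
begin

lemma C_nonneg: "0 \<le> C" using K_nonneg by (simp add: C_def)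

lemma sum_recip_branch_deriv_difference:
  assumes y: "y \<in> {0..1}"
  shows "(\<Sum>\<^sub>\<infinity>i\<in>branches_over N a b g y.
      \<bar>1 / branch_deriv (a i) (b i) f (branch_preimage (a i) (b i) f y)
       - 1 / branch_deriv (a i) (b i) g (branch_preimage (a i) (b i) g y)\<bar>) \<le> ereal (C * \<delta>)"
proof -
  have y': "0 \<le> y" "y \<le> 1" using y by auto
  have "\<bar>1 / branch_deriv (a i) (b i) f (branch_preimage (a i) (b i) f y)
       - 1 / branch_deriv (a i) (b i) g (branch_preimage (a i) (b i) g y)\<bar> = ereal \<bar>w i y - k i y\<bar>"
    if i: "i \<in> N" for i
  proof -
    have nz: "\<sigma> i / w i y \<noteq> 0" "\<tau> i / k i y \<noteq> 0"
      using F.weight_pos[OF i y'] G.weight_pos[OF i y'] F.sign[OF i] G.sign[OF i] by auto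
    have "1 / branch_deriv (a i) (b i) f (branch_preimage (a i) (b i) f y) = ereal (1 / (\<sigma> i / w i y))"
      using F.branch_at_endpoints(2)[OF i y'] F.branch_preimage_eq[OF i y'] nz(1)
      by (simp add: one_ereal_def)
    moreover have "1 / branch_deriv (a i) (b i) g (branch_preimage (a i) (b i) g y) = ereal (1 / (\<tau> i / k i y))"
      using G.branch_at_endpoints(2)[OF i y'] G.branch_preimage_eq[OF i y'] nz(2)
      by (simp add: one_ereal_def)
    moreover have "\<bar>1 / (\<sigma> i / w i y) - 1 / (\<tau> i / k i y)\<bar> = \<bar>w i y - k i y\<bar>"
      using F.sign[OF i] orientation[OF i] by auto
    ultimately show ?thesis by (simp only: ereal_minus(1) abs_ereal.simps(1))
  qed
  then have "(\<Sum>\<^sub>\<infinity>i\<in>branches_over N a b g y.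
      \<bar>1 / branch_deriv (a i) (b i) f (branch_preimage (a i) (b i) f y)
       - 1 / branch_deriv (a i) (b i) g (branch_preimage (a i) (b i) g y)\<bar>)
      = (\<Sum>\<^sub>\<infinity>i\<in>N. ereal \<bar>w i y - k i y\<bar>)"
    unfolding G.branches_over_eq[OF y'] by (rule infsum_cong)
  also have "\<dots> \<le> ereal (C * \<delta>)"
  proof (rule infsum_ereal_le)
    fix F assume F: "finite F" "F \<subseteq> N"
    have "(\<Sum>i\<in>F. \<bar>w i y - k i y\<bar>) \<le> (\<Sum>i\<in>F. (C * \<delta>) * (b i - a i))"
    proof (rule sum_mono)
      fix i assume "i \<in> F"
      then have i: "i \<in> N" using F by auto
      show "\<bar>w i y - k i y\<bar> \<le> (C * \<delta>) * (b i - a i)"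
        using perturbed_point_closed(2)[OF i y'] i by (simp add: F.len_def mult_ac)
    qed
    also have "\<dots> = (C * \<delta>) * (\<Sum>i\<in>F. b i - a i)" by (rule sum_distrib_left[symmetric])
    also have "\<dots> \<le> (C * \<delta>) * 1"
      using F.sum_len_le[OF F] C_nonneg delta by (intro mult_left_mono) auto
    finally show "(\<Sum>i\<in>F. \<bar>w i y - k i y\<bar>) \<le> C * \<delta>" by simp
  qed simp
  finally show ?thesis .
qed

text \<open>Measurability has to be checked, as the essential supremum of a non-measurable function is
  infinite.\<close>

lemma esssup_preimage_distance:
  "esssup leb01 (\<lambda>y. SUP i\<in>branches_over N a b g y.
      ereal (dist (branch_preimage (a i) (b i) g y) (branch_preimage (a i) (b i) f y))) \<le> ereal (C * \<delta>)"
proof (rule esssup_I)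
  have eq: "(SUP i\<in>branches_over N a b g y.
      ereal (dist (branch_preimage (a i) (b i) g y) (branch_preimage (a i) (b i) f y)))
      = (SUP i\<in>N. ereal \<bar>\<eta> i y - \<gamma> i y\<bar>)" if y: "y \<in> space leb01" for y
  proof -
    have y': "0 \<le> y" "y \<le> 1" using y by auto
    show ?thesis
      unfolding G.branches_over_eq[OF y']
      by (rule SUP_cong) (auto simp: F.branch_preimage_eq[OF _ y'] G.branch_preimage_eq[OF _ y'] dist_real_def)
  qed
  have "(\<lambda>y. SUP i\<in>N. ereal \<bar>\<eta> i y - \<gamma> i y\<bar>) \<in> borel_measurable leb01"
  proof (rule borel_measurable_SUP)
    fix i assume i: "i \<in> N"
    have "continuous_on {0..1} (\<lambda>y. \<bar>\<eta> i y - \<gamma> i y\<bar>)" by (intro continuous_intros F.cont[OF i] G.cont[OF i])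
    then have "(\<lambda>y. \<bar>\<eta> i y - \<gamma> i y\<bar>) \<in> borel_measurable leb01"
      by (rule continuous_imp_measurable_on_sets_lebesgue) simp
    then show "(\<lambda>y. ereal \<bar>\<eta> i y - \<gamma> i y\<bar>) \<in> borel_measurable leb01" by (rule borel_measurable_ereal)
  qed simp
  then show "(\<lambda>y. SUP i\<in>branches_over N a b g y.
      ereal (dist (branch_preimage (a i) (b i) g y) (branch_preimage (a i) (b i) f y))) \<in> borel_measurable leb01"
    by (rule measurable_cong[THEN iffD2, rotated]) (rule eq)
  show "AE y in leb01. (SUP i\<in>branches_over N a b g y.
      ereal (dist (branch_preimage (a i) (b i) g y) (branch_preimage (a i) (b i) f y))) \<le> ereal (C * \<delta>)"
  proof (rule AE_I2)
    fix y assume y: "y \<in> space leb01"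
    then have y': "0 \<le> y" "y \<le> 1" by auto
    show "(SUP i\<in>branches_over N a b g y.
      ereal (dist (branch_preimage (a i) (b i) g y) (branch_preimage (a i) (b i) f y))) \<le> ereal (C * \<delta>)"
      unfolding eq[OF y]
    proof (rule SUP_least)
      fix i assume i: "i \<in> N"
      have "C * F.len i * \<delta> \<le> C * 1 * \<delta>"
        using len_le_1[of i] C_nonneg delta by (intro mult_right_mono mult_left_mono) auto
      then show "ereal \<bar>\<eta> i y - \<gamma> i y\<bar> \<le> ereal (C * \<delta>)"
        using perturbed_point_closed(1)[OF i y'] by (simp add: abs_minus_commute)
    qed
  qed
qed

end

section \<open>Cylinders of length one, fiber maps and limits at zero\<close>

lemma cylinders_one:
  assumes "interval_partition N a b" shows "cylinders N a b f 1 = (\<lambda>i. {a i<..<b i}) ` N"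
proof -
  have "{a i<..<b i} \<noteq> {}" if "i \<in> N" for i
  proof -
    have "a i < b i" using assms that unfolding interval_partition_def by blast
    then show ?thesis by simp
  qed
  then show ?thesis
    by (auto simp: cylinders_def image_iff intro!: exI[of _ "\<lambda>_. _"])
qed

lemma fiber_Lip_le_iff:
  "fiber_Lip Q G \<le> ereal r \<longleftrightarrow>
    (\<forall>J\<in>Q. \<forall>y\<in>{0..1}. \<forall>x\<in>J. \<forall>x'\<in>J. \<bar>G x y - G x' y\<bar> \<le> r * \<bar>x - x'\<bar>)"
proof -
  have "fiber_Lip Q G \<le> ereal r \<longleftrightarrow> (\<forall>J\<in>Q. \<forall>y\<in>{0..1}. \<forall>x\<in>J. \<forall>x'\<in>J. x \<noteq> x' \<longrightarrow>
      dist (G x y) (G x' y) / dist x x' \<le> r)"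
  proof (intro iffI ballI impI)
    fix J and y x x' :: real assume L: "fiber_Lip Q G \<le> ereal r"
      and J: "J \<in> Q" "y \<in> {0..1}" "x \<in> J" "x' \<in> J" "x \<noteq> x'"
    have "ereal (dist (G x y) (G x' y) / dist x x') \<le> fiber_Lip Q G"
      unfolding fiber_Lip_def by (rule Sup_upper) (use J in blast)
    then show "dist (G x y) (G x' y) / dist x x' \<le> r" using L by (meson ereal_less_eq(3) order_trans)
  next
    assume R: "\<forall>J\<in>Q. \<forall>y\<in>{0..1}. \<forall>x\<in>J. \<forall>x'\<in>J. x \<noteq> x' \<longrightarrow> dist (G x y) (G x' y) / dist x x' \<le> r"
    show "fiber_Lip Q G \<le> ereal r"
      unfolding fiber_Lip_def
    proof (rule Sup_least)
      fix v assume "v \<in> {ereal (dist (G x1 y) (G x2 y) / dist x1 x2) | J y x1 x2.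
            J \<in> Q \<and> y \<in> {0..1} \<and> x1 \<in> J \<and> x2 \<in> J \<and> x1 \<noteq> x2}"
      then obtain J y x1 x2 where v: "v = ereal (dist (G x1 y) (G x2 y) / dist x1 x2)"
          and J: "J \<in> Q" "y \<in> {0..1}" "x1 \<in> J" "x2 \<in> J" "x1 \<noteq> x2" by blast
      have "dist (G x1 y) (G x2 y) / dist x1 x2 \<le> r" using R J by blast
      then show "v \<le> ereal r" unfolding v by simp
    qed
  qed
  moreover have "(x \<noteq> x' \<longrightarrow> dist (G x y) (G x' y) / dist x x' \<le> r) \<longleftrightarrow>
      \<bar>G x y - G x' y\<bar> \<le> r * \<bar>x - x'\<bar>" for x x' y
    by (cases "x = x'") (auto simp: dist_real_def divide_le_eq)
  ultimately show ?thesis by simp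
qed

lemma x_times_ln_tendsto_0: "((\<lambda>x::real. x * ln x) \<longlongrightarrow> 0) (at_right 0)"
  unfolding filterlim_at_right_to_top
proof (rule Lim_transform_eventually)
  show "((\<lambda>x::real. - (ln x / x)) \<longlongrightarrow> 0) at_top"
    using tendsto_minus[OF ln_x_over_x_tendsto_0] by simp
  show "\<forall>\<^sub>F x in at_top. - (ln x / x) = inverse x * ln (inverse (x::real))"
    using eventually_gt_at_top[of 0] by eventually_elim (simp add: ln_inverse divide_inverse mult.commute)
qed

lemma eventually_near_zero:
  fixes h :: "real \<Rightarrow> real"
  assumes "isCont h 0" "h 0 < c"
  obtains d where "0 < d" "\<And>x. \<lbrakk>0 \<le> x; x < d\<rbrakk> \<Longrightarrow> h x \<le> c"
proof -
  have "(h \<longlongrightarrow> h 0) (nhds 0)"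
    using assms(1) unfolding isCont_def tendsto_at_iff_tendsto_nhds .
  then have "\<forall>\<^sub>F x in nhds 0. h x < c" using assms(2) by (rule order_tendstoD(2))
  then obtain d where d: "0 < d" "\<forall>x. dist x 0 < d \<longrightarrow> h x < c"
    unfolding eventually_nhds_metric by blast
  then show ?thesis by (intro that[of d]) (auto simp: dist_real_def less_imp_le)
qed

section \<open>Admissibility of the perturbation\<close>

theorem theoremC:
  fixes N :: "nat set" and a b :: "nat \<Rightarrow> real"
    and f :: "real \<Rightarrow> real \<Rightarrow> real" and G :: "real \<Rightarrow> real \<Rightarrow> real \<Rightarrow> real"
  assumes partition: "interval_partition N a b"
    and G_range: "\<And>\<delta> i x y. \<lbrakk>\<delta> \<in> {0..<1}; i \<in> N; x \<in> {a i<..<b i}; y \<in> {0..1}\<rbrakk>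
                    \<Longrightarrow> G \<delta> x y \<in> {0..1}"
    and G0_H1: "\<exists>\<alpha>. H1 \<alpha> (G 0)"
    and G0_H2: "H2 ((\<lambda>i. {a i<..<b i}) ` N) (G 0)"
    and G0_C2: "\<And>i. i \<in> N \<Longrightarrow>
        \<exists>g. C2_on ({a i..b i} \<times> {0..1}) g \<and>
            (\<forall>x\<in>{a i<..<b i}. \<forall>y\<in>{0..1}. g (x, y) = G 0 x y)"
    and f0_cases:
      "(pre_piecewise_convex_or_expanding N a b (f 0) \<and>
         (\<forall>i\<in>N. \<forall>x\<in>{a i<..<b i}. 0 < deriv (deriv (f 0)) x) \<and>
         (\<Sum>\<^sub>\<infinity>i\<in>N. 1 / \<bar>branch_deriv (a i) (b i) (f 0) (a i)\<bar>) < \<infinity>)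
       \<or> (piecewise_expanding N a b (f 0) \<and>
         (\<Sum>\<^sub>\<infinity>i\<in>N. 1 / \<bar>branch_deriv (a i) (b i) (f 0) (a i)\<bar>) < \<infinity>)"
    and f0_C2: "\<And>i. i \<in> N \<Longrightarrow> C2_on {a i<..<b i} (f 0)"
    and f0_distortion: "\<exists>D>0. \<forall>i\<in>N. \<forall>x\<in>{a i<..<b i}.
        \<bar>deriv (deriv (f 0)) x\<bar> / \<bar>deriv (f 0) x\<bar>\<^sup>2 \<le> D"
    and f0_deriv: "\<And>i x. \<lbrakk>i \<in> N; x \<in> {a i<..<b i}\<rbrakk> \<Longrightarrow> 1 \<le> \<bar>deriv (f 0) x\<bar>"
    and f0_expand: "\<exists>\<rho>>1. \<forall>x\<in>iterate_domain N a b (f 0) 2. \<rho> \<le> \<bar>deriv (f 0 ^^ 2) x\<bar>"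
    and f0_full: "\<And>i. i \<in> N \<Longrightarrow> f 0 ` {a i<..<b i} = {0<..<1}"
    and G_C2: "\<And>\<delta> i. \<lbrakk>\<delta> \<in> {0..<1}; i \<in> N\<rbrakk> \<Longrightarrow>
        C2_on ({a i<..<b i} \<times> {0..1}) (\<lambda>(x, y). G \<delta> x y) \<and>
        C2_norm ({a i<..<b i} \<times> {0..1}) (\<lambda>(x, y). G \<delta> x y - G 0 x y) \<le> ereal \<delta>"
    and f_C2: "\<And>\<delta> i. \<lbrakk>\<delta> \<in> {0..<1}; i \<in> N\<rbrakk> \<Longrightarrow>
        C2_on {a i<..<b i} (f \<delta>) \<and>
        C2_norm {a i<..<b i} (\<lambda>x. f \<delta> x - f 0 x) \<le> ereal \<delta>"
    and f_diffeo: "\<And>\<delta> i. \<lbrakk>\<delta> \<in> {0..<1}; i \<in> N\<rbrakk> \<Longrightarrow>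
        diffeo_on {a i<..<b i} {0<..<1} (f \<delta>)"
  shows "\<exists>\<delta>1. 0 < \<delta>1 \<and> \<delta>1 < 1 \<and> (\<exists>R. admissible_R_perturbation N a b f G R \<delta>1)"
proof -
  let ?Q = "(\<lambda>i. {a i<..<b i}) ` N"
  obtain \<alpha> where \<alpha>: "H1 \<alpha> (G 0)" using G0_H1 by blast
  have \<alpha>01: "0 \<le> \<alpha>" "\<alpha> < 1"
    and \<alpha>_contr: "AE x in leb01. \<forall>z1\<in>{0..1}. \<forall>z2\<in>{0..1}. dist (G 0 x z1) (G 0 x z2) \<le> \<alpha> * dist z1 z2"
    using \<alpha> by (auto simp: H1_def)
  obtain \<Lambda> where \<Lambda>: "0 \<le> \<Lambda>" "fiber_Lip ?Q (G 0) \<le> ereal \<Lambda>"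
  proof (cases "fiber_Lip ?Q (G 0)")
    case (real r)
    then show ?thesis using that[of "max 0 r"] by simp
  next
    case PInf
    then show ?thesis using G0_H2 by (simp add: H2_def)
  next
    case MInf
    then show ?thesis using that[of 0] by simp
  qed
  obtain D where D: "0 < D" "\<And>i x. \<lbrakk>i \<in> N; x \<in> {a i<..<b i}\<rbrakk> \<Longrightarrow>
      \<bar>deriv (deriv (f 0)) x\<bar> / \<bar>deriv (f 0) x\<bar>\<^sup>2 \<le> D"
    using f0_distortion by blast
  have D': "\<bar>deriv (deriv (f 0)) x\<bar> \<le> D * (deriv (f 0) x)\<^sup>2" if "i \<in> N" "x \<in> {a i<..<b i}" for i x
    using D(2)[OF that] f0_deriv[OF that] by (auto simp: divide_le_eq split: if_splits)
  obtain \<rho> where \<rho>: "1 < \<rho>" "\<And>x. x \<in> iterate_domain N a b (f 0) 2 \<Longrightarrow> \<rho> \<le> \<bar>deriv (f 0 ^^ 2) x\<bar>"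
    using f0_expand by blast
  define D1 where "D1 = 4 * D + 2"
  have D1: "0 \<le> D1" using D(1) by (simp add: D1_def)
  define K where "K = D1 * exp (2 * D1)"
  define C where "C = K + 2 * exp D1"
  have K: "0 \<le> K" using D1 by (simp add: K_def)
  have "1 \<le> exp D1" using D1 by simp
  then have C: "1 \<le> C" using K unfolding C_def by linarith
  \<comment> \<open>A contraction rate for \<open>f\<^sub>\<delta>\<^sup>2\<close> strictly between the rate \<open>1 / \<rho>\<close> of \<open>f\<^sub>0\<^sup>2\<close> and \<open>1\<close>; likewise \<open>\<alpha>2\<close> for the fibers.\<close>
  define \<theta>2 where "\<theta>2 = (1 + 1 / \<rho>) / 2"
  have \<theta>2: "0 < \<theta>2" "\<theta>2 < 1" "1 / \<rho> < \<theta>2" using \<rho>(1) by (auto simp: \<theta>2_def field_simps)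
  define \<alpha>2 where "\<alpha>2 = (1 + \<alpha>) / 2"
  have \<alpha>2: "\<alpha> < \<alpha>2" "\<alpha>2 < 1" using \<alpha>01 by (auto simp: \<alpha>2_def)
  obtain d1 where d1: "0 < d1" "\<And>\<delta>. \<lbrakk>0 \<le> \<delta>; \<delta> < d1\<rbrakk> \<Longrightarrow> (1 / \<rho> + K * \<delta>) / (1 - \<delta>)\<^sup>2 \<le> \<theta>2"
  proof (rule eventually_near_zero[of "\<lambda>\<delta>. (1 / \<rho> + K * \<delta>) / (1 - \<delta>)\<^sup>2" \<theta>2])
    show "isCont (\<lambda>\<delta>. (1 / \<rho> + K * \<delta>) / (1 - \<delta>)\<^sup>2) 0" by (intro continuous_intros) auto
  qed (use \<theta>2(3) in auto)
  obtain d2 where d2: "0 < d2" "\<And>\<delta>. \<lbrakk>0 \<le> \<delta>; \<delta> < d2\<rbrakk> \<Longrightarrow> (\<alpha> + \<delta>) * (1 / (1 - \<delta>)) \<le> \<alpha>2"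
  proof (rule eventually_near_zero[of "\<lambda>\<delta>. (\<alpha> + \<delta>) * (1 / (1 - \<delta>))" \<alpha>2])
    show "isCont (\<lambda>\<delta>. (\<alpha> + \<delta>) * (1 / (1 - \<delta>))) 0" by (intro continuous_intros) auto
  qed (use \<alpha>2 in auto)
  define \<delta>0 where "\<delta>0 = min (min (1/2) ((1 - \<alpha>) / 2)) (min d1 d2)"
  have "\<delta>0 \<le> 1/2" by (simp add: \<delta>0_def)
  then have \<delta>0: "0 < \<delta>0" "\<delta>0 < 1" using d1(1) d2(1) \<alpha>01 by (auto simp: \<delta>0_def)
  have \<delta>D: "0 \<le> \<delta>" "\<delta> \<le> 1/2" "\<delta> < 1" "\<alpha> + \<delta> < 1" "\<delta> < d1" "\<delta> < d2" "\<delta> \<in> {0..<1}" if "\<delta> \<in> {0..<\<delta>0}" for \<delta>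
    using that \<alpha>01 by (auto simp: \<delta>0_def)
  have C2f: "C2_on {a i<..<b i} (f \<delta>)" "C2_norm {a i<..<b i} (\<lambda>x. f \<delta> x - f 0 x) \<le> ereal \<delta>"
    if "\<delta> \<in> {0..<1}" "i \<in> N" for \<delta> i
    using f_C2[OF that] by auto
  have open_I: "open {a i<..<b i}" for i by simp
  have z: "(0::real) \<in> {0..<1}" by simp
  have close: "\<bar>f \<delta> x - f 0 x\<bar> \<le> \<delta>" "\<bar>deriv (f \<delta>) x - deriv (f 0) x\<bar> \<le> \<delta>"
      "\<bar>deriv (deriv (f \<delta>)) x - deriv (deriv (f 0)) x\<bar> \<le> \<delta>"
    if "\<delta> \<in> {0..<1}" "i \<in> N" "x \<in> {a i<..<b i}" for \<delta> i x
    using C2_difference_bounds[OF open_I C2f(1)[OF that(1,2)] C2f(1)[OF z that(2)] C2f(2)[OF that(1,2)] that(3)]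
    by auto
  have system: "\<exists>\<sigma> \<gamma> w. full_branch_system N a b (f \<delta>) \<sigma> \<gamma> w (1 / (1 - \<delta>)) D1" if \<delta>: "\<delta> \<in> {0..<\<delta>0}" for \<delta>
    unfolding D1_def
  proof (rule perturbed_system[OF partition \<delta>D(1,2)[OF \<delta>] less_imp_le[OF D(1)], where g' = "deriv (f 0)"
        and g'' = "deriv (deriv (f 0))" and f' = "deriv (f \<delta>)" and f'' = "deriv (deriv (f \<delta>))"])
    note \<delta>1 = \<delta>D(7)[OF \<delta>]
    show "bij_betw (f \<delta>) {a i<..<b i} {0<..<1}" if "i \<in> N" for i
      using f_diffeo[OF \<delta>1 that] by (simp add: diffeo_on_def)
    fix i x assume ix: "i \<in> N" "x \<in> {a i<..<b i}"
    show "(f \<delta> has_real_derivative deriv (f \<delta>) x) (at x)"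
      "(deriv (f \<delta>) has_real_derivative deriv (deriv (f \<delta>)) x) (at x)"
      using C2_on_real[OF open_I C2f(1)[OF \<delta>1 ix(1)] ix(2)] by auto
    show "1 \<le> \<bar>deriv (f 0) x\<bar>" "\<bar>deriv (deriv (f 0)) x\<bar> \<le> D * (deriv (f 0) x)\<^sup>2"
      using f0_deriv[OF ix] D'[OF ix] by auto
    show "\<bar>deriv (f \<delta>) x - deriv (f 0) x\<bar> \<le> \<delta>"
      "\<bar>deriv (deriv (f \<delta>)) x - deriv (deriv (f 0)) x\<bar> \<le> \<delta>"
      using close[OF \<delta>1 ix] by auto
  qed
  have "0 \<in> {0..<\<delta>0}" using \<delta>0(1) by simp
  from system[OF this] obtain \<tau> \<eta> k where G0: "full_branch_system N a b (f 0) \<tau> \<eta> k 1 D1" by auto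
  have perturbed: "\<exists>\<sigma> \<gamma> w. perturbed_full_branch N a b (f \<delta>) \<sigma> \<gamma> w \<delta> D1 (f 0) \<tau> \<eta> k"
    if \<delta>: "\<delta> \<in> {0..<\<delta>0}" for \<delta>
  proof -
    obtain \<sigma> \<gamma> w where F: "full_branch_system N a b (f \<delta>) \<sigma> \<gamma> w (1 / (1 - \<delta>)) D1"
      using system[OF \<delta>] by blast
    have "perturbed_full_branch N a b (f \<delta>) \<sigma> \<gamma> w \<delta> D1 (f 0) \<tau> \<eta> k"
      unfolding perturbed_full_branch_def perturbed_full_branch_axioms_def
      using F G0 \<delta>D(1,2,7)[OF \<delta>] close(1,2) by blast
    then show ?thesis by blast
  qed
  have square: "\<exists>M c d \<tau> \<eta> k. full_branch_system M c d (f \<delta> ^^ 2) \<tau> \<eta> k \<theta>2 (3 * D1) \<and>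
      (\<lambda>j. {c j<..<d j}) ` M = cylinders N a b (f \<delta>) 2" if \<delta>: "\<delta> \<in> {0..<\<delta>0}" for \<delta>
  proof -
    obtain \<sigma> \<gamma> w where "perturbed_full_branch N a b (f \<delta>) \<sigma> \<gamma> w \<delta> D1 (f 0) \<tau> \<eta> k"
      using perturbed[OF \<delta>] by blast
    then interpret P: perturbed_full_branch N a b "f \<delta>" \<sigma> \<gamma> w \<delta> D1 "f 0" \<tau> \<eta> k .
    have "\<exists>M c d \<tau> \<eta> k. full_branch_system M c d (f \<delta> ^^ 2) \<tau> \<eta> k \<theta>2 (D1 * (1 / (1 - \<delta>)) + D1) \<and>
      (\<lambda>j. {c j<..<d j}) ` M = cylinders N a b (f \<delta>) 2"
    proof (rule full_branch_square[OF P.F.full_branch_system_axioms \<theta>2(1)])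
      fix i j x assume ij: "i \<in> N" "j \<in> N" and x: "a i < x" "x < b i" "a j < f \<delta> x" "f \<delta> x < b j"
      have "w i (f \<delta> x) * w j (f \<delta> (f \<delta> x)) \<le> (1 / \<rho> + K * \<delta>) / (1 - \<delta>)\<^sup>2"
        using P.perturbed_square_contraction[OF \<rho> ij x] by (simp add: P.K_def K_def)
      also have "\<dots> \<le> \<theta>2" by (rule d1(2)) (use \<delta>D[OF \<delta>] in auto)
      finally show "w i (f \<delta> x) * w j (f \<delta> (f \<delta> x)) \<le> \<theta>2" .
    qed
    moreover have "D1 * (1 / (1 - \<delta>)) + D1 \<le> 3 * D1"
    proof -
      have "1 / (1 - \<delta>) \<le> 2" using \<delta>D(2)[OF \<delta>] by (simp add: divide_le_eq)
      then show ?thesis using mult_left_mono[OF _ D1, of "1 / (1 - \<delta>)" 2] by simp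
    qed
    ultimately show ?thesis using full_branch_system.weaken_distortion by metis
  qed
  obtain p \<theta>' E where p: "1 \<le> p" "0 < \<theta>'" "\<theta>' \<le> 1/4" "0 \<le> E" "\<theta>' * (1 + E * exp (2 * E)) \<le> 1/2"
      "\<And>f. branched (f ^^ 2) \<theta>2 (3 * D1) \<Longrightarrow> branched (f ^^ p) \<theta>' E"
    using uniform_contracting_power[OF \<theta>2(1,2), of "3 * D1"] D1 by auto
  have power: "branched (f \<delta> ^^ p) \<theta>' E" if "\<delta> \<in> {0..<\<delta>0}" for \<delta>
  proof -
    have "branched (f \<delta> ^^ 2) \<theta>2 (3 * D1)"
      using square[OF that] unfolding branched_def by (elim exE conjE) (intro exI)
    then show ?thesis by (rule p(6))
  qed
  have branched2: "branched (f \<delta>) 2 D1" if \<delta>: "\<delta> \<in> {0..<\<delta>0}" for \<delta>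
  proof -
    obtain \<sigma> \<gamma> w where F: "full_branch_system N a b (f \<delta>) \<sigma> \<gamma> w (1 / (1 - \<delta>)) D1"
      using system[OF \<delta>] by blast
    have "full_branch_system N a b (f \<delta>) \<sigma> \<gamma> w 2 D1"
    proof (rule full_branch_system.improve_contraction[OF F])
      fix i and y :: real assume "i \<in> N" "0 < y" "y < 1"
      then have "w i y \<le> 1 / (1 - \<delta>)" using full_branch_system.weight_le[OF F, of i y] by simp
      also have "\<dots> \<le> 2" using \<delta>D(2)[OF \<delta>] by (simp add: divide_le_eq)
      finally show "w i y \<le> 2" .
    qed simp
    then show ?thesis unfolding branched_def by blast
  qed
  have "\<exists>A r. 0 < A \<and> 0 < r \<and> r < 1 \<and> (\<forall>f. branched f 2 D1 \<longrightarrow> branched (f ^^ p) \<theta>' E \<longrightarrow>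
     (\<forall>h\<in>BV. \<forall>n. BV_norm ((frobenius_perron f ^^ n) h)
        \<le> ereal (A * r ^ n) * BV_norm h + ereal A * L1_norm h))"
    by (rule uniform_lasota_yorke[OF p(1) _ D1 p(4,5)]) simp
  then obtain A r where A: "0 < A" "0 < r" "r < 1" "\<And>f h n. \<lbrakk>branched f 2 D1; branched (f ^^ p) \<theta>' E; h \<in> BV\<rbrakk> \<Longrightarrow>
      BV_norm ((frobenius_perron f ^^ n) h) \<le> ereal (A * r ^ n) * BV_norm h + ereal A * L1_norm h"
    by blast
  have iter1: "iter_recip_deriv N a b h 1 = recip_deriv (\<Union>i\<in>N. {a i<..<b i}) h" for h
  proof -
    have "iterate_domain N a b h 1 = (\<Union>i\<in>N. {a i<..<b i})" by (auto simp: iterate_domain_def)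
    then show ?thesis by (simp only: funpow_0 One_nat_def funpow.simps comp_id)
  qed
  have fib: "\<bar>G \<delta> x y - G 0 x y\<bar> \<le> \<delta>"
      "\<bar>(G \<delta> x y - G 0 x y) - (G \<delta> x z - G 0 x z)\<bar> \<le> \<delta> * \<bar>y - z\<bar>"
      "\<bar>(G \<delta> x y - G 0 x y) - (G \<delta> x' y - G 0 x' y)\<bar> \<le> \<delta> * \<bar>x - x'\<bar>"
    if "\<delta> \<in> {0..<1}" "i \<in> N" "x \<in> {a i<..<b i}" "x' \<in> {a i<..<b i}" "y \<in> {0..1}" "z \<in> {0..1}" for \<delta> i x x' y z
    using fiber_difference_bounds[of "a i" "b i" "G \<delta>" "G 0" \<delta>] G_C2[OF that(1,2)] G_C2[OF z that(2)] that by auto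
  \<comment> \<open>The value at \<open>0\<close> is arbitrary but must be positive.\<close>
  define R where "R \<delta> = (if \<delta> = 0 then 1 else C * \<delta>)" for \<delta> :: real
  have R: "C * \<delta> \<le> R \<delta>" if "0 \<le> \<delta>" for \<delta> using that by (simp add: R_def)
  have "R_perturbation_below N a b f G R \<delta>0"
    unfolding R_perturbation_below_def
  proof (intro conjI ballI)
    fix \<delta> assume \<delta>: "\<delta> \<in> {0..<\<delta>0}"
    obtain \<sigma> \<gamma> w where "perturbed_full_branch N a b (f \<delta>) \<sigma> \<gamma> w \<delta> D1 (f 0) \<tau> \<eta> k"
      using perturbed[OF \<delta>] by blast
    then interpret P: perturbed_full_branch N a b "f \<delta>" \<sigma> \<gamma> w \<delta> D1 "f 0" \<tau> \<eta> k .
    have C_eq: "P.C = C" by (simp add: P.C_def P.K_def C_def K_def)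
    have CR: "ereal (P.C * \<delta>) \<le> ereal (R \<delta>)" using R[OF \<delta>D(1)[OF \<delta>]] C_eq by simp
    obtain M c d \<tau>' \<eta>' k' where S: "full_branch_system M c d (f \<delta> ^^ 2) \<tau>' \<eta>' k' \<theta>2 (3 * D1)"
      and cyl: "(\<lambda>j. {c j<..<d j}) ` M = cylinders N a b (f \<delta>) 2"
      using square[OF \<delta>] by (elim exE conjE) (rule that; assumption)
    show "pre_piecewise_convex_or_expanding N a b (f \<delta>)"
      by (rule pre_piecewise_of_full_branch[OF P.F.full_branch_system_axioms S \<theta>2(2) cyl p(1) power[OF \<delta>] p(3)])
    show "f \<delta> ` {a i<..<b i} = f 0 ` {a i<..<b i}" if "i \<in> N" for i
      using P.F.image_branch[OF that] P.G.image_branch[OF that] by simp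
    show "0 < R \<delta>" using \<delta>D(1)[OF \<delta>] C by (simp add: R_def)
    show "(\<Sum>\<^sub>\<infinity>i\<in>branches_over N a b (f 0) y.
              \<bar>1 / branch_deriv (a i) (b i) (f \<delta>) (branch_preimage (a i) (b i) (f \<delta>) y)
               - 1 / branch_deriv (a i) (b i) (f 0) (branch_preimage (a i) (b i) (f 0) y)\<bar>)
           \<le> ereal (R \<delta>)" if "y \<in> {0..1}" for y
      using P.sum_recip_branch_deriv_difference[OF that] CR by (rule order_trans)
    show "esssup leb01 (\<lambda>y. SUP i\<in>branches_over N a b (f 0) y.
           ereal (dist (branch_preimage (a i) (b i) (f 0) y)
                       (branch_preimage (a i) (b i) (f \<delta>) y))) \<le> ereal (R \<delta>)"
      using P.esssup_preimage_distance CR by (rule order_trans)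
    fix x y assume "x \<in> (\<Union>i\<in>N. {a i<..<b i})" and y: "y \<in> {0..1::real}"
    then obtain i where i: "i \<in> N" "x \<in> {a i<..<b i}" by blast
    have "\<bar>G \<delta> x y - G 0 x y\<bar> \<le> \<delta>" by (rule fib(1)[OF \<delta>D(7)[OF \<delta>] i i(2) y y])
    also have "\<dots> \<le> C * \<delta>" using C \<delta>D(1)[OF \<delta>] mult_right_mono[of 1 C \<delta>] by simp
    finally show "dist (G 0 x y) (G \<delta> x y) \<le> R \<delta>"
      using R[OF \<delta>D(1)[OF \<delta>]] by (simp add: dist_real_def abs_minus_commute)
  next
    have "((\<lambda>\<delta>. C * (\<delta> * ln \<delta>)) \<longlongrightarrow> 0) (at_right 0)"
      using tendsto_mult_right_zero[OF x_times_ln_tendsto_0] .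
    then show "((\<lambda>\<delta>. R \<delta> * ln \<delta>) \<longlongrightarrow> 0) (at_right 0)"
    proof (rule Lim_transform_eventually)
      show "\<forall>\<^sub>F \<delta> in at_right 0. C * (\<delta> * ln \<delta>) = R \<delta> * ln \<delta>"
        using eventually_at_right_less[of 0] by eventually_elim (simp add: R_def)
    qed
  qed
  moreover have "admissible_below N a b f G \<delta>0"
    unfolding admissible_below_def
  proof (intro conjI)
    show "\<exists>D \<rho>. 0 < D \<and> 0 < \<rho> \<and> \<rho> < 1 \<and>
        (\<forall>h\<in>BV. \<forall>\<delta>\<in>{0..<\<delta>0}. \<forall>n\<ge>1.
           BV_norm ((frobenius_perron (f \<delta>) ^^ n) h)
             \<le> ereal (D * \<rho> ^ n) * BV_norm h + ereal D * L1_norm h)"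
      using A branched2 power by blast
    have lip: "fiber_Lip ?Q (G \<delta>) \<le> ereal (\<Lambda> + 1)" if \<delta>: "\<delta> \<in> {0..<\<delta>0}" for \<delta>
      unfolding fiber_Lip_le_iff
    proof (intro ballI)
      fix J x x' and y :: real assume J: "J \<in> ?Q" "y \<in> {0..1}" "x \<in> J" "x' \<in> J"
      then obtain i where i: "i \<in> N" "J = {a i<..<b i}" by blast
      have "\<bar>G 0 x y - G 0 x' y\<bar> \<le> \<Lambda> * \<bar>x - x'\<bar>"
        using \<Lambda>(2) J unfolding fiber_Lip_le_iff by blast
      moreover have "\<bar>(G \<delta> x y - G 0 x y) - (G \<delta> x' y - G 0 x' y)\<bar> \<le> \<delta> * \<bar>x - x'\<bar>"
        by (rule fib(3)[OF \<delta>D(7)[OF \<delta>] i(1) _ _ J(2) J(2)]) (use J i in auto)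
      moreover have "\<delta> * \<bar>x - x'\<bar> \<le> 1 * \<bar>x - x'\<bar>" using \<delta>D(3)[OF \<delta>] by (intro mult_right_mono) auto
      ultimately show "\<bar>G \<delta> x y - G \<delta> x' y\<bar> \<le> (\<Lambda> + 1) * \<bar>x - x'\<bar>"
        by (simp add: distrib_right)
    qed
    have ess: "esssup leb01 (iter_recip_deriv N a b (f \<delta>) 1) \<le> ereal (1 / (1 - \<delta>))"
        "0 \<le> esssup leb01 (iter_recip_deriv N a b (f \<delta>) 1)"
        "variation_on {0..1} (iter_recip_deriv N a b (f \<delta>) 1) \<le> ereal (K + 2 * exp D1)"
      if \<delta>: "\<delta> \<in> {0..<\<delta>0}" for \<delta>
    proof -
      obtain \<sigma> \<gamma> w where F: "full_branch_system N a b (f \<delta>) \<sigma> \<gamma> w (1 / (1 - \<delta>)) D1"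
        using system[OF \<delta>] by blast
      show "esssup leb01 (iter_recip_deriv N a b (f \<delta>) 1) \<le> ereal (1 / (1 - \<delta>))"
        "0 \<le> esssup leb01 (iter_recip_deriv N a b (f \<delta>) 1)"
        "variation_on {0..1} (iter_recip_deriv N a b (f \<delta>) 1) \<le> ereal (K + 2 * exp D1)"
        unfolding iter1 K_def
        using full_branch_system.esssup_recip_deriv[OF F] full_branch_system.variation_recip_deriv[OF F] by auto
    qed
    have prod: "ereal ((\<alpha> + \<delta>) ^ 1) * esssup leb01 (iter_recip_deriv N a b (f \<delta>) 1) \<le> ereal \<alpha>2"
      if \<delta>: "\<delta> \<in> {0..<\<delta>0}" for \<delta>
    proof -
      have "ereal ((\<alpha> + \<delta>) ^ 1) * esssup leb01 (iter_recip_deriv N a b (f \<delta>) 1)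
          \<le> ereal (\<alpha> + \<delta>) * ereal (1 / (1 - \<delta>))"
        using ess(1)[OF \<delta>] \<alpha>01 \<delta>D(1)[OF \<delta>] by (simp only: power_one_right) (rule ereal_mult_left_mono, auto)
      also have "\<dots> = ereal ((\<alpha> + \<delta>) * (1 / (1 - \<delta>)))" by simp
      also have "\<dots> \<le> ereal \<alpha>2" using d2(2)[OF \<delta>D(1,6)[OF \<delta>]] by (simp only: ereal_less_eq(3))
      finally show ?thesis .
    qed
    \<comment> \<open>With \<open>k = 1\<close> no derivative of \<open>f\<^sub>\<delta>\<close>, which may be unbounded over the branches, enters the
      Lipschitz constant of the fiber map.\<close>
    show "\<exists>\<alpha> k.
        (\<forall>\<delta>\<in>{0..<\<delta>0}.
           H1 (\<alpha> \<delta>) (G \<delta>) \<and>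
           H2 ((\<lambda>i. {a i<..<b i}) ` N) (G \<delta>) \<and>
           H3 N a b (f \<delta>) (G \<delta>) (\<alpha> \<delta>) k) \<and>
        (SUP \<delta>\<in>{0..<\<delta>0}.
           ereal (\<alpha> \<delta> ^ k) * esssup leb01 (iter_recip_deriv N a b (f \<delta>) k)) < 1 \<and>
        (SUP \<delta>\<in>{0..<\<delta>0}.
           fiber_Lip ((\<lambda>i. {a i<..<b i}) ` N) (G \<delta>) *
             esssup leb01 (iter_recip_deriv N a b (f \<delta>) k)
           + variation_on {0..1} (iter_recip_deriv N a b (f \<delta>) k)) < \<infinity>"
    proof (intro exI[of _ "\<lambda>\<delta>. \<alpha> + \<delta>"] exI[of _ "1::nat"] conjI ballI)
      fix \<delta> assume \<delta>: "\<delta> \<in> {0..<\<delta>0}"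
      obtain \<sigma> \<gamma> w where F: "full_branch_system N a b (f \<delta>) \<sigma> \<gamma> w (1 / (1 - \<delta>)) D1"
        using system[OF \<delta>] by blast
      show H1: "H1 (\<alpha> + \<delta>) (G \<delta>)"
        unfolding H1_def
      proof (intro conjI)
        show "0 \<le> \<alpha> + \<delta>" "\<alpha> + \<delta> < 1" using \<alpha>01 \<delta>D[OF \<delta>] by auto
        show "AE x in leb01. \<forall>z1\<in>{0..1}. \<forall>z2\<in>{0..1}. dist (G \<delta> x z1) (G \<delta> x z2) \<le> (\<alpha> + \<delta>) * dist z1 z2"
          using \<alpha>_contr full_branch_system.AE_interval[OF F]
        proof eventually_elim
          case (elim x)
          then obtain i where i: "i \<in> N" "x \<in> {a i<..<b i}" by blast
          show ?case
          proof (intro ballI)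
            fix z1 z2 :: real assume z12: "z1 \<in> {0..1}" "z2 \<in> {0..1}"
            have "\<bar>G 0 x z1 - G 0 x z2\<bar> \<le> \<alpha> * \<bar>z1 - z2\<bar>" using elim(1) z12 by (simp add: dist_real_def)
            moreover have "\<bar>(G \<delta> x z1 - G 0 x z1) - (G \<delta> x z2 - G 0 x z2)\<bar> \<le> \<delta> * \<bar>z1 - z2\<bar>"
              by (rule fib(2)[OF \<delta>D(7)[OF \<delta>] i i(2) z12])
            ultimately show "dist (G \<delta> x z1) (G \<delta> x z2) \<le> (\<alpha> + \<delta>) * dist z1 z2"
              by (simp add: dist_real_def distrib_right)
          qed
        qed
      qed
      show H2: "H2 ?Q (G \<delta>)"
        using lip[OF \<delta>] unfolding H2_def by (rule le_less_trans) simp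
      have fiber1: "fiber_iter (f \<delta>) (G \<delta>) 1 = G \<delta>"
        by (simp add: fiber_iter_def fun_eq_iff)
      have "ereal ((\<alpha> + \<delta>) ^ 1) * esssup leb01 (iter_recip_deriv N a b (f \<delta>) 1) < 1"
        using prod[OF \<delta>] \<alpha>2(2) by (metis ereal_less(3) le_less_trans less_ereal.simps(1) one_ereal_def)
      then show "H3 N a b (f \<delta>) (G \<delta>) (\<alpha> + \<delta>) 1"
        unfolding H3_def fiber1 cylinders_one[OF partition] using H1 H2 by simp
    next
      have "(SUP \<delta>\<in>{0..<\<delta>0}. ereal ((\<alpha> + \<delta>) ^ 1) * esssup leb01 (iter_recip_deriv N a b (f \<delta>) 1)) \<le> ereal \<alpha>2"
        by (rule SUP_least) (rule prod)
      also have "ereal \<alpha>2 < 1" using \<alpha>2(2) by (simp add: one_ereal_def)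
      finally show "(SUP \<delta>\<in>{0..<\<delta>0}. ereal ((\<alpha> + \<delta>) ^ 1) * esssup leb01 (iter_recip_deriv N a b (f \<delta>) 1)) < 1" .
    next
      have "(SUP \<delta>\<in>{0..<\<delta>0}. fiber_Lip ?Q (G \<delta>) * esssup leb01 (iter_recip_deriv N a b (f \<delta>) 1)
           + variation_on {0..1} (iter_recip_deriv N a b (f \<delta>) 1)) \<le> ereal ((\<Lambda> + 1) * 2 + (K + 2 * exp D1))"
      proof (rule SUP_least)
        fix \<delta> assume \<delta>: "\<delta> \<in> {0..<\<delta>0}"
        let ?e = "esssup leb01 (iter_recip_deriv N a b (f \<delta>) 1)"
        have "1 / (1 - \<delta>) \<le> 2" using \<delta>D(2)[OF \<delta>] by (simp add: divide_le_eq)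
        then have e2: "?e \<le> ereal 2" using ess(1)[OF \<delta>] by (meson ereal_less_eq(3) order_trans)
        have "fiber_Lip ?Q (G \<delta>) * ?e \<le> ereal (\<Lambda> + 1) * ?e"
          by (rule ereal_mult_right_mono[OF lip[OF \<delta>] ess(2)[OF \<delta>]])
        also have "\<dots> \<le> ereal (\<Lambda> + 1) * ereal 2"
          by (rule ereal_mult_left_mono[OF e2]) (use \<Lambda>(1) in simp)
        finally have "fiber_Lip ?Q (G \<delta>) * ?e + variation_on {0..1} (iter_recip_deriv N a b (f \<delta>) 1)
            \<le> ereal (\<Lambda> + 1) * ereal 2 + ereal (K + 2 * exp D1)"
          using ess(3)[OF \<delta>] by (rule add_mono)
        then show "fiber_Lip ?Q (G \<delta>) * ?e + variation_on {0..1} (iter_recip_deriv N a b (f \<delta>) 1)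
            \<le> ereal ((\<Lambda> + 1) * 2 + (K + 2 * exp D1))" by simp
      qed
      then show "(SUP \<delta>\<in>{0..<\<delta>0}. fiber_Lip ?Q (G \<delta>) * esssup leb01 (iter_recip_deriv N a b (f \<delta>) 1)
           + variation_on {0..1} (iter_recip_deriv N a b (f \<delta>) 1)) < \<infinity>"
        by (rule le_less_trans) simp
    qed
  qed
  ultimately have "admissible_R_perturbation N a b f G R \<delta>0"
    unfolding admissible_R_perturbation_def using \<delta>0 by blast
  then show ?thesis using \<delta>0 by blast
qed

end
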